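(* Let $\alpha_2,\gamma_1,\gamma_2,\Gamma$ be real constants with $\Gamma>0$ and $\alpha_2\neq0$. Let real numbers $s,s_1$ satisfy $1\le s_1\le s<s_1+1$. Then there exists $u_0\in H^s(\mathbf{T})$ such that for no $T>0$ does the Cauchy problem $$\partial_t u=i\alpha_2\partial_x^2u+i\gamma_1|u|^2u+\gamma_2\partial_x(|u|^2u)-i\Gamma u\,\partial_x(|u|^2),\quad x\in\mathbf{T},\qquad u(0,\cdot)=u_0,$$ have a solution $u\in C([0,T];H^{s_1}(\mathbf{T}))$ on $[0,T]$, and for no $T>0$ does it have a solution $u\in C([-T,0];H^{s_1}(\mathbf{T}))$ on $[-T,0]$.
   Context: Notation: $\mathbf{T}=\mathbf{R}/2\pi\mathbf{Z}$; functions are complex-valued; $\hat f(k)=\frac1{\sqrt{2\pi}}\int_{\mathbf{T}}e^{-ikx}f(x)\,dx$ for $k\in\mathbf{Z}$; $\langle\xi\rangle=1+|\xi|$; $\|f\|_{H^s}=\|\langle k\rangle^s\hat f(k)\|_{\ell^2(\mathbf{Z})}$. Notion of solution: Let $T>0$, $s\ge0$, $u_0\in H^s(\mathbf{T})$. A function $u$ is a solution of the Cauchy problem on $[0,T)$ if $u\in L^\infty_{loc}([0,T);H^s(\mathbf{T}))\cap L^3_{loc}([0,T)\times\mathbf{T})$, $\partial_x(|u|^2)\in L^1_{loc}([0,T);H^{-s}(\mathbf{T}))$, and for every $\phi\in C_0^\infty([0,T)\times\mathbf{T})$, $$-\int_0^T\!\!\int_{\mathbf{T}}u\,\partial_t\phi\,dx\,dt-\int_{\mathbf{T}}u_0\phi(0,\cdot)\,dx=\int_0^T\!\!\int_{\mathbf{T}}\big[i\alpha_2u\,\partial_x^2\phi+|u|^2u(i\gamma_1\phi-\gamma_2\partial_x\phi)\big]dx\,dt-i\Gamma\int_0^T\langle\partial_x(|u|^2)(t),u(t)\phi(t)\rangle_{H^{-s},H^s}\,dt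 .$$ A function $u$ is a solution on the closed interval $[0,T]$ if $u\in C([0,T];H^{s}(\mathbf{T}))$ for some $s>1/2$ and $u|_{[0,T)}$ is a solution on $[0,T)$, that is, $u|_{[0,T)}\in L^\infty_{loc}([0,T);H^s(\mathbf{T}))\cap L^3_{loc}([0,T)\times\mathbf{T})$, $\partial_x(|u|^2)\in L^1_{loc}([0,T);H^{-s}(\mathbf{T}))$, and the displayed integral identity holds for every $\phi\in C_0^\infty([0,T)\times\mathbf{T})$. Solutions on $(-T,0]$ and $[-T,0]$ are defined in a similar manner (with test functions in $C_0^\infty((-T,0]\times\mathbf{T})$, time integrals over $(-T,0)$, and the term $-\int_{\mathbf{T}}u_0\phi(0,\cdot)\,dx$ replaced by $+\int_{\mathbf{T}}u_0\phi(0,\cdot)\,dx$). *)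

theory Defs
  imports "HOL-Analysis.Analysis"
begin

text \<open>
  Functions on the torus \<open>\<real> / 2\<pi>\<int>\<close> are \<open>2\<pi>\<close>-periodic functions on the real line, integrated over
  one period.  A space-time function is curried: \<open>u t\<close> is the function at time \<open>t\<close>.  Elements
  of Lebesgue and Sobolev spaces are handled through representatives; no notion below depends
  on the values of a function on a null set of the torus.
\<close>

definition periodic :: "(real \<Rightarrow> complex) \<Rightarrow> bool" where
  "periodic f \<longleftrightarrow> (\<forall>x. f (x + 2 * pi) = f x)"

definition torus_integral :: "(real \<Rightarrow> complex) \<Rightarrow> complex" where
  "torus_integral f = (LINT x:{0..2 * pi}|lebesgue. f x)"

definition fourier_coeff :: "(real \<Rightarrow> complex) \<Rightarrow> int \<Rightarrow> complex" where
  "fourier_coeff f k =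
     of_real (1 / sqrt (2 * pi)) * torus_integral (\<lambda>x. exp (- (\<i> * of_int k * of_real x)) * f x)"

definition japanese_bracket :: "real \<Rightarrow> real" where
  "japanese_bracket \<xi> = 1 + \<bar>\<xi>\<bar>"

subsection \<open>Sobolev spaces\<close>

definition weighted_l2 :: "real \<Rightarrow> (int \<Rightarrow> complex) \<Rightarrow> bool" where
  "weighted_l2 s a \<longleftrightarrow>
     (\<lambda>k. (japanese_bracket (of_int k) powr s * cmod (a k))\<^sup>2) summable_on UNIV"

definition weighted_l2_norm :: "real \<Rightarrow> (int \<Rightarrow> complex) \<Rightarrow> real" where
  "weighted_l2_norm s a =
     sqrt (\<Sum>\<^sub>\<infinity>k. (japanese_bracket (of_int k) powr s * cmod (a k))\<^sup>2)"

text \<open>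
  \<open>H\<^sup>s\<close> for \<open>s \<ge> 0\<close> is a space of square-integrable functions; the spaces of negative order are
  spaces of distributions, see \<open>in_Hs_distr\<close>.
\<close>

definition Hs :: "real \<Rightarrow> (real \<Rightarrow> complex) set" where
  "Hs s = {f. periodic f \<and> f \<in> borel_measurable lebesgue \<and>
              set_integrable lebesgue {0..2 * pi} (\<lambda>x. (cmod (f x))\<^sup>2) \<and>
              weighted_l2 s (fourier_coeff f)}"

definition Hs_norm :: "real \<Rightarrow> (real \<Rightarrow> complex) \<Rightarrow> real" where
  "Hs_norm s f = weighted_l2_norm s (fourier_coeff f)"

text \<open>
  Distributions on the torus are functionals on periodic smooth functions (the values on other
  arguments are never used).
\<close>

type_synonym distr = "(real \<Rightarrow> complex) \<Rightarrow> complex"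

definition distr_of :: "(real \<Rightarrow> complex) \<Rightarrow> distr" where
  "distr_of f = (\<lambda>\<psi>. torus_integral (\<lambda>x. f x * \<psi> x))"

definition distr_deriv :: "distr \<Rightarrow> distr" where
  "distr_deriv F = (\<lambda>\<psi>. - F (\<lambda>x. vector_derivative \<psi> (at x)))"

definition distr_coeff :: "distr \<Rightarrow> int \<Rightarrow> complex" where
  "distr_coeff F k = of_real (1 / sqrt (2 * pi)) * F (\<lambda>x. exp (- (\<i> * of_int k * of_real x)))"

definition in_Hs_distr :: "real \<Rightarrow> distr \<Rightarrow> bool" where
  "in_Hs_distr s F \<longleftrightarrow> weighted_l2 s (distr_coeff F)"

definition Hs_distr_norm :: "real \<Rightarrow> distr \<Rightarrow> real" where
  "Hs_distr_norm s F = weighted_l2_norm s (distr_coeff F)"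

text \<open>
  The bilinear pairing of \<open>H\<^bsup>-s\<^esup>\<close> with \<open>H\<^sup>s\<close>, the extension of \<open>\<integral> f g dx\<close>.  With the present
  normalisation Parseval's identity is \<open>\<integral> f g dx = \<Sum>k. f^(k) g^(-k)\<close>, hence the \<open>-k\<close> and the
  absence of a complex conjugate.
\<close>

definition duality_pairing :: "distr \<Rightarrow> (real \<Rightarrow> complex) \<Rightarrow> complex" where
  "duality_pairing F g = (\<Sum>\<^sub>\<infinity>k. distr_coeff F k * fourier_coeff g (- k))"

lemma distr_coeff_distr_of: "distr_coeff (distr_of f) k = fourier_coeff f k"
  by (simp add: distr_coeff_def distr_of_def fourier_coeff_def mult.commute)

lemma distr_coeff_distr_deriv:
  "distr_coeff (distr_deriv (distr_of f)) k = \<i> * of_int k * fourier_coeff f k"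
proof -
  have "vector_derivative (\<lambda>x. exp (- (\<i> * of_int k * of_real x))) (at x) =
        - (\<i> * of_int k) * exp (- (\<i> * of_int k * of_real x))" for x :: real
    by (rule vector_derivative_at,
        rule has_vector_derivative_real_field[of "\<lambda>z. exp (- (\<i> * of_int k * z))"])
       (auto intro!: derivative_eq_intros)
  then have "distr_coeff (distr_deriv (distr_of f)) k = of_real (1 / sqrt (2 * pi)) *
      - torus_integral (\<lambda>x. - (\<i> * of_int k) * (exp (- (\<i> * of_int k * of_real x)) * f x))"
    by (simp add: distr_coeff_def distr_of_def distr_deriv_def mult.left_commute mult.commute)
  then show ?thesis
    unfolding fourier_coeff_def torus_integral_def set_integral_mult_right by simp
qed

subsection \<open>Function spaces in space-time\<close>

text \<open>
  Here \<open>J\<close> is a time interval, and ``locally'' refers to compact subsets of \<open>J\<close>.  As \<open>H\<^sup>s\<close> is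
  separable, strong measurability in time with values in \<open>H\<^sup>s\<close> is measurability of every Fourier
  coefficient.
\<close>

definition Linf_loc_Hs :: "real set \<Rightarrow> real \<Rightarrow> (real \<Rightarrow> real \<Rightarrow> complex) set" where
  "Linf_loc_Hs J s = {u.
     (\<forall>k. (\<lambda>t. fourier_coeff (u t) k) \<in> borel_measurable (lebesgue_on J)) \<and>
     (\<forall>K. compact K \<and> K \<subseteq> J \<longrightarrow>
        (\<exists>M. AE t in lebesgue. t \<in> K \<longrightarrow> u t \<in> Hs s \<and> Hs_norm s (u t) \<le> M))}"

definition L3_loc :: "real set \<Rightarrow> (real \<Rightarrow> real \<Rightarrow> complex) set" where
  "L3_loc J = {u.
     (\<lambda>(t, x). u t x) \<in> borel_measurable (lebesgue_on (J \<times> UNIV)) \<and>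
     (\<forall>K. compact K \<and> K \<subseteq> J \<longrightarrow>
        set_integrable lebesgue (K \<times> {0..2 * pi}) (\<lambda>(t, x). (cmod (u t x)) ^ 3))}"

definition L1_loc_Hs_distr :: "real set \<Rightarrow> real \<Rightarrow> (real \<Rightarrow> distr) set" where
  "L1_loc_Hs_distr J s = {F.
     (\<forall>k. (\<lambda>t. distr_coeff (F t) k) \<in> borel_measurable (lebesgue_on J)) \<and>
     (\<forall>K. compact K \<and> K \<subseteq> J \<longrightarrow>
        (AE t in lebesgue. t \<in> K \<longrightarrow> in_Hs_distr s (F t)) \<and>
        set_integrable lebesgue K (\<lambda>t. Hs_distr_norm s (F t)))}"

definition continuous_Hs :: "real set \<Rightarrow> real \<Rightarrow> (real \<Rightarrow> real \<Rightarrow> complex) set" where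
  "continuous_Hs I s = {u. \<forall>t\<in>I. u t \<in> Hs s \<and>
     ((\<lambda>\<tau>. Hs_norm s (\<lambda>x. u \<tau> x - u t x)) \<longlongrightarrow> 0) (at t within I)}"

subsection \<open>Test functions\<close>

definition smooth_plane :: "(real \<Rightarrow> real \<Rightarrow> complex) \<Rightarrow> bool" where
  "smooth_plane \<phi> \<longleftrightarrow> (\<exists>D :: nat \<Rightarrow> nat \<Rightarrow> real \<Rightarrow> real \<Rightarrow> complex. D 0 0 = \<phi> \<and>
     (\<forall>m n. continuous_on UNIV (\<lambda>(t, x). D m n t x) \<and>
        (\<forall>t x. ((\<lambda>\<tau>. D m n \<tau> x) has_vector_derivative D (Suc m) n t x) (at t) \<and>
               (D m n t has_vector_derivative D m (Suc n) t x) (at x))))"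

text \<open>
  For \<open>J = [0,T)\<close> or \<open>J = (-T,0]\<close>, smoothness up to the endpoint \<open>0\<close> is expressed by an extension
  to all times; the values for \<open>t\<close> outside \<open>J\<close> play no role.
\<close>

definition test_functions :: "real set \<Rightarrow> (real \<Rightarrow> real \<Rightarrow> complex) set" where
  "test_functions J = {\<phi>. smooth_plane \<phi> \<and> (\<forall>t. periodic (\<phi> t)) \<and>
     (\<exists>K. compact K \<and> K \<subseteq> J \<and> (\<forall>t\<in>J - K. \<forall>x. \<phi> t x = 0))}"

definition dt :: "(real \<Rightarrow> real \<Rightarrow> complex) \<Rightarrow> real \<Rightarrow> real \<Rightarrow> complex" where
  "dt \<phi> t x = vector_derivative (\<lambda>\<tau>. \<phi> \<tau> x) (at t)"

definition dx :: "(real \<Rightarrow> real \<Rightarrow> complex) \<Rightarrow> real \<Rightarrow> real \<Rightarrow> complex" where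
  "dx \<phi> t x = vector_derivative (\<phi> t) (at x)"

subsection \<open>Solutions of the Cauchy problem\<close>

definition dx_abs_sq :: "(real \<Rightarrow> real \<Rightarrow> complex) \<Rightarrow> real \<Rightarrow> distr" where
  "dx_abs_sq u t = distr_deriv (distr_of (\<lambda>x. of_real ((cmod (u t x))\<^sup>2)))"

text \<open>
  The parameter \<open>\<epsilon>\<close> is the sign of the boundary term: \<open>1\<close> for \<open>J = [0,T)\<close>, \<open>-1\<close> for
  \<open>J = (-T,0]\<close>.
\<close>

definition weak_identity ::
  "real \<Rightarrow> real \<Rightarrow> real \<Rightarrow> real \<Rightarrow> real set \<Rightarrow> real \<Rightarrow> (real \<Rightarrow> complex) \<Rightarrow>
   (real \<Rightarrow> real \<Rightarrow> complex) \<Rightarrow> (real \<Rightarrow> real \<Rightarrow> complex) \<Rightarrow> bool" where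
  "weak_identity \<alpha>\<^sub>2 \<gamma>\<^sub>1 \<gamma>\<^sub>2 \<Gamma> J \<epsilon> u0 u \<phi> \<longleftrightarrow>
     - (LINT t:J|lebesgue. torus_integral (\<lambda>x. u t x * dt \<phi> t x))
       - of_real \<epsilon> * torus_integral (\<lambda>x. u0 x * \<phi> 0 x) =
     (LINT t:J|lebesgue. torus_integral (\<lambda>x.
         \<i> * of_real \<alpha>\<^sub>2 * u t x * dx (dx \<phi>) t x
         + of_real ((cmod (u t x))\<^sup>2) * u t x *
             (\<i> * of_real \<gamma>\<^sub>1 * \<phi> t x - of_real \<gamma>\<^sub>2 * dx \<phi> t x)))
       - \<i> * of_real \<Gamma> *
         (LINT t:J|lebesgue. duality_pairing (dx_abs_sq u t) (\<lambda>x. u t x * \<phi> t x))"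

definition solution_on ::
  "real \<Rightarrow> real \<Rightarrow> real \<Rightarrow> real \<Rightarrow> real \<Rightarrow> real set \<Rightarrow> real \<Rightarrow> (real \<Rightarrow> complex) \<Rightarrow>
   (real \<Rightarrow> real \<Rightarrow> complex) \<Rightarrow> bool" where
  "solution_on \<alpha>\<^sub>2 \<gamma>\<^sub>1 \<gamma>\<^sub>2 \<Gamma> s J \<epsilon> u0 u \<longleftrightarrow>
     s \<ge> 0 \<and> u0 \<in> Hs s \<and>
     u \<in> Linf_loc_Hs J s \<inter> L3_loc J \<and>
     dx_abs_sq u \<in> L1_loc_Hs_distr J (- s) \<and>
     (\<forall>\<phi>\<in>test_functions J. weak_identity \<alpha>\<^sub>2 \<gamma>\<^sub>1 \<gamma>\<^sub>2 \<Gamma> J \<epsilon> u0 u \<phi>)"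

definition forward_solution ::
  "real \<Rightarrow> real \<Rightarrow> real \<Rightarrow> real \<Rightarrow> real \<Rightarrow> real \<Rightarrow> (real \<Rightarrow> complex) \<Rightarrow>
   (real \<Rightarrow> real \<Rightarrow> complex) \<Rightarrow> bool" where
  "forward_solution \<alpha>\<^sub>2 \<gamma>\<^sub>1 \<gamma>\<^sub>2 \<Gamma> s T u0 u \<longleftrightarrow>
     T > 0 \<and> solution_on \<alpha>\<^sub>2 \<gamma>\<^sub>1 \<gamma>\<^sub>2 \<Gamma> s {0..<T} 1 u0 u"

definition backward_solution ::
  "real \<Rightarrow> real \<Rightarrow> real \<Rightarrow> real \<Rightarrow> real \<Rightarrow> real \<Rightarrow> (real \<Rightarrow> complex) \<Rightarrow>
   (real \<Rightarrow> real \<Rightarrow> complex) \<Rightarrow> bool" where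
  "backward_solution \<alpha>\<^sub>2 \<gamma>\<^sub>1 \<gamma>\<^sub>2 \<Gamma> s T u0 u \<longleftrightarrow>
     T > 0 \<and> solution_on \<alpha>\<^sub>2 \<gamma>\<^sub>1 \<gamma>\<^sub>2 \<Gamma> s {-T<..0} (-1) u0 u"

definition closed_forward_solution ::
  "real \<Rightarrow> real \<Rightarrow> real \<Rightarrow> real \<Rightarrow> real \<Rightarrow> (real \<Rightarrow> complex) \<Rightarrow>
   (real \<Rightarrow> real \<Rightarrow> complex) \<Rightarrow> bool" where
  "closed_forward_solution \<alpha>\<^sub>2 \<gamma>\<^sub>1 \<gamma>\<^sub>2 \<Gamma> T u0 u \<longleftrightarrow>
     (\<exists>s>1/2. u \<in> continuous_Hs {0..T} s \<and> forward_solution \<alpha>\<^sub>2 \<gamma>\<^sub>1 \<gamma>\<^sub>2 \<Gamma> s T u0 u)"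

definition closed_backward_solution ::
  "real \<Rightarrow> real \<Rightarrow> real \<Rightarrow> real \<Rightarrow> real \<Rightarrow> (real \<Rightarrow> complex) \<Rightarrow>
   (real \<Rightarrow> real \<Rightarrow> complex) \<Rightarrow> bool" where
  "closed_backward_solution \<alpha>\<^sub>2 \<gamma>\<^sub>1 \<gamma>\<^sub>2 \<Gamma> T u0 u \<longleftrightarrow>
     (\<exists>s>1/2. u \<in> continuous_Hs {-T..0} s \<and> backward_solution \<alpha>\<^sub>2 \<gamma>\<^sub>1 \<gamma>\<^sub>2 \<Gamma> s T u0 u)"

end

theory Submission
  imports Defs "HOL-Computational_Algebra.Polynomial"
begin

text \<open>
  On the Fourier side the equation reads, with \<open>k\<^sub>3 = k\<^sub>1 + k\<^sub>2 - k\<close>,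
  \<open>a\<^sub>k' = - i \<alpha>\<^sub>2 k\<^sup>2 a\<^sub>k + (1/2\<pi>) \<Sum> (i \<gamma>\<^sub>1 + i \<gamma>\<^sub>2 k + \<Gamma> (k - k\<^sub>1)) a\<^bsub>k\<^sub>1\<^esub> a\<^bsub>k\<^sub>2\<^esub> cnj a\<^bsub>k\<^sub>3\<^esub>\<close>.
  The triples with \<open>k\<^sub>2 = k\<close> make \<open>a\<^sub>k\<close> grow essentially at
  the rate \<open>\<Gamma> k \<parallel>u\<parallel>\<^sup>2 / 2\<pi>\<close>, with \<open>L\<^sup>2\<close> norm.  A forward solution that stays in \<open>H\<^bsup>s\<^sub>1\<^esup>\<close> therefore has positive
  frequencies which are damped backwards in time, and this parabolic smoothing gains one
  derivative at time \<open>0\<close>: \<open>\<bar>a\<^sub>k(0)\<bar> \<le> C k\<^bsup>-s\<^sub>1-1\<^esup>\<close> for \<open>k > 0\<close>.  To close this estimate the datum is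
  taken to be the constant mode plus a small lacunary perturbation: triples with \<open>k\<^sub>1\<close> or \<open>k\<^sub>2\<close>
  as only high frequency are then a small perturbation of the damping, those with \<open>k\<^sub>3\<close> as only
  high frequency are oscillating and are removed by a normal form, and triples with two high
  frequencies are smoother because \<open>s\<^sub>1 \<ge> 1\<close>.  The coefficients of the datum at \<open>\<plusminus> 2\<^sup>j\<close> are chosen
  to decay more slowly than \<open>C k\<^bsup>-s\<^sub>1-1\<^esup>\<close>.  Backward solutions are reduced to forward ones by the
  reflection \<open>(t, x) \<mapsto> (- t, - x)\<close>, which changes the signs of \<open>\<alpha>\<^sub>2\<close> and \<open>\<gamma>\<^sub>1\<close> only.
\<close>

section \<open>Sums over triples of frequencies\<close>

text \<open>The triples in which k_3 alone is high cannot be absorbed by the damping: k_3 is close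
  to -k, negative frequencies are not damped backwards in time, and the pair (0, 0) carries no small
  factor. Their size k * k^(-s), with s the order of the solution, is one power of k above what a
  gain of one derivative tolerates. Their phase is of size k^2 against a symbol of size k, so the
  normal form wins this power back. The mode k is coupled with all modes between 3k/4 and 5k/4. A
  barrier must therefore have comparable values at neighbouring frequencies, which fails for
  exponential decay in k (T - t). The profile 1 / (1 + c k (T - t)) has this property and is of size
  1/k at time 0, which is the gain of one derivative. The datum is lacunary because coefficients
  |k|^(-p) at powers of two belong to H^s as soon as p > s, whereas a full series would require p >
  s + 1/2. An exponent with s < p < \<open>s\<^sub>1\<close> + 1 exists exactly if s <
  \<open>s\<^sub>1\<close> + 1.\<close>

lemma Cauchy_Schwarz_infsum:
  fixes f g :: "'a \<Rightarrow> real"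
  assumes f: "(\<lambda>x. (f x)\<^sup>2) summable_on A" and g: "(\<lambda>x. (g x)\<^sup>2) summable_on A"
  shows "(\<lambda>x. \<bar>f x * g x\<bar>) summable_on A"
    and "(\<Sum>\<^sub>\<infinity>x\<in>A. \<bar>f x * g x\<bar>) \<le> sqrt (\<Sum>\<^sub>\<infinity>x\<in>A. (f x)\<^sup>2) * sqrt (\<Sum>\<^sub>\<infinity>x\<in>A. (g x)\<^sup>2)"
proof -
  have fin: "(\<Sum>x\<in>F. \<bar>f x * g x\<bar>) \<le> sqrt (\<Sum>\<^sub>\<infinity>x\<in>A. (f x)\<^sup>2) * sqrt (\<Sum>\<^sub>\<infinity>x\<in>A. (g x)\<^sup>2)"
    if "finite F" "F \<subseteq> A" for F
  proof -
    have "(\<Sum>x\<in>F. \<bar>f x * g x\<bar>) \<le> L2_set f F * L2_set g F"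
      using L2_set_mult_ineq[of f g F] by (simp add: abs_mult)
    also have "\<dots> \<le> sqrt (\<Sum>\<^sub>\<infinity>x\<in>A. (f x)\<^sup>2) * sqrt (\<Sum>\<^sub>\<infinity>x\<in>A. (g x)\<^sup>2)"
      unfolding L2_set_def using that f g
      by (intro mult_mono real_sqrt_le_mono finite_sum_le_infsum) (auto intro!: sum_nonneg infsum_nonneg)
    finally show ?thesis .
  qed
  show "(\<lambda>x. \<bar>f x * g x\<bar>) summable_on A"
    by (rule nonneg_bdd_above_summable_on) (auto intro!: bdd_aboveI2 fin)
  then show "(\<Sum>\<^sub>\<infinity>x\<in>A. \<bar>f x * g x\<bar>) \<le> sqrt (\<Sum>\<^sub>\<infinity>x\<in>A. (f x)\<^sup>2) * sqrt (\<Sum>\<^sub>\<infinity>x\<in>A. (g x)\<^sup>2)"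
    by (rule infsum_le_finite_sums) (rule fin)
qed

lemma has_sum_product_real:
  fixes f :: "'a \<Rightarrow> real" and g :: "'b \<Rightarrow> real"
  assumes "f summable_on UNIV" "g summable_on UNIV" "\<And>x. 0 \<le> f x" "\<And>x. 0 \<le> g x"
  shows "((\<lambda>p. f (fst p) * g (snd p)) has_sum (infsum f UNIV * infsum g UNIV)) UNIV"
proof -
  have 1: "((\<lambda>y. f x * g y) has_sum f x * infsum g UNIV) UNIV" for x
    using assms by (intro has_sum_cmult_right) auto
  have 2: "((\<lambda>x. f x * infsum g UNIV) has_sum (infsum f UNIV * infsum g UNIV)) UNIV"
    using assms by (intro has_sum_cmult_left) auto
  have "((\<lambda>p. f (fst p) * g (snd p)) has_sum (infsum f UNIV * infsum g UNIV)) (UNIV \<times> UNIV)"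
  proof (rule has_sum_SigmaI)
    show "(\<lambda>p. f (fst p) * g (snd p)) summable_on UNIV \<times> UNIV"
      by (rule summable_on_SigmaI[where g = "\<lambda>x. f x * infsum g UNIV"])
        (use 1 has_sum_imp_summable[OF 2] assms in auto)
  qed (use 1 2 in auto)
  then show ?thesis by simp
qed

text \<open>Giving a factor sqrt h to each of \<open>f\<close> and \<open>g\<close> reduces the
  claim to Cauchy-Schwarz, and the bijections turn the two square sums into products of independent
  sums. In the applications \<open>p\<close>, \<open>q\<close>, \<open>r\<close> are the three
  frequencies of a triple in any order, so that any one of them can be the one summed in l1.\<close>

lemma trilinear_bound:
  fixes f g h :: "'a \<Rightarrow> real" and p q r :: "'b \<Rightarrow> 'a"
  assumes f: "(\<lambda>x. (f x)\<^sup>2) summable_on UNIV" and g: "(\<lambda>x. (g x)\<^sup>2) summable_on UNIV"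
    and h: "h summable_on UNIV" "\<And>x. 0 \<le> h x"
    and pr: "bij (\<lambda>i. (p i, r i))" and qr: "bij (\<lambda>i. (q i, r i))"
  shows "(\<lambda>i. \<bar>f (p i)\<bar> * \<bar>g (q i)\<bar> * h (r i)) summable_on UNIV"
    and "(\<Sum>\<^sub>\<infinity>i. \<bar>f (p i)\<bar> * \<bar>g (q i)\<bar> * h (r i)) \<le>
         sqrt (\<Sum>\<^sub>\<infinity>x. (f x)\<^sup>2) * sqrt (\<Sum>\<^sub>\<infinity>x. (g x)\<^sup>2) * infsum h UNIV"
proof -
  define F where "F i = \<bar>f (p i)\<bar> * sqrt (h (r i))" for i
  define G where "G i = \<bar>g (q i)\<bar> * sqrt (h (r i))" for i
  have FG: "\<bar>F i * G i\<bar> = \<bar>f (p i)\<bar> * \<bar>g (q i)\<bar> * h (r i)" for i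
    using h(2)[of "r i"] by (simp add: F_def G_def abs_mult)
  have F2: "((\<lambda>i. (F i)\<^sup>2) has_sum ((\<Sum>\<^sub>\<infinity>x. (f x)\<^sup>2) * infsum h UNIV)) UNIV"
    using has_sum_reindex_bij_betw[OF pr, of "\<lambda>p. (f (fst p))\<^sup>2 * h (snd p)"]
      has_sum_product_real[OF f h(1) _ h(2)]
    by (simp add: F_def power_mult_distrib h(2))
  have G2: "((\<lambda>i. (G i)\<^sup>2) has_sum ((\<Sum>\<^sub>\<infinity>x. (g x)\<^sup>2) * infsum h UNIV)) UNIV"
    using has_sum_reindex_bij_betw[OF qr, of "\<lambda>p. (g (fst p))\<^sup>2 * h (snd p)"]
      has_sum_product_real[OF g h(1) _ h(2)]
    by (simp add: G_def power_mult_distrib h(2))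
  note CS = Cauchy_Schwarz_infsum[OF has_sum_imp_summable[OF F2] has_sum_imp_summable[OF G2]]
  show "(\<lambda>i. \<bar>f (p i)\<bar> * \<bar>g (q i)\<bar> * h (r i)) summable_on UNIV"
    using CS(1) by (simp only: FG)
  have "sqrt ((\<Sum>\<^sub>\<infinity>x. (f x)\<^sup>2) * infsum h UNIV) * sqrt ((\<Sum>\<^sub>\<infinity>x. (g x)\<^sup>2) * infsum h UNIV)
      = sqrt (\<Sum>\<^sub>\<infinity>x. (f x)\<^sup>2) * sqrt (\<Sum>\<^sub>\<infinity>x. (g x)\<^sup>2) * (sqrt (infsum h UNIV) * sqrt (infsum h UNIV))"
    by (simp add: real_sqrt_mult mult_ac)
  also have "sqrt (infsum h UNIV) * sqrt (infsum h UNIV) = infsum h UNIV"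
    by (simp add: infsum_nonneg h(2))
  finally show "(\<Sum>\<^sub>\<infinity>i. \<bar>f (p i)\<bar> * \<bar>g (q i)\<bar> * h (r i)) \<le>
         sqrt (\<Sum>\<^sub>\<infinity>x. (f x)\<^sup>2) * sqrt (\<Sum>\<^sub>\<infinity>x. (g x)\<^sup>2) * infsum h UNIV"
    using CS(2) by (simp add: FG infsumI[OF F2] infsumI[OF G2])
qed

section \<open>Weighted square-summable sequences\<close>

abbreviation jb :: "int \<Rightarrow> real" where "jb k \<equiv> japanese_bracket (of_int k)"

lemma jb_ge_1 [simp]: "1 \<le> jb k"
  by (simp add: japanese_bracket_def)

lemma jb_pos [simp]: "0 < jb k"
  by (simp add: japanese_bracket_def add_pos_nonneg)

lemma jb_nonneg [simp]: "0 \<le> jb k"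
  by (rule less_imp_le[OF jb_pos])

lemma jb_nonzero [simp]: "jb k \<noteq> 0"
  using jb_pos[of k] by linarith

lemma summable_jb: "(\<lambda>k. (1 / jb k)\<^sup>2) summable_on UNIV"
proof -
  have 1: "(\<lambda>n. 1 / (1 + real n)\<^sup>2) summable_on UNIV"
    using inverse_power_summable[of 2, where 'a = real] summable_Suc_iff[of "\<lambda>n. inverse (real n ^ 2)"]
    by (subst summable_on_UNIV_nonneg_real_iff) (auto simp: inverse_eq_divide add.commute)
  have 2: "(\<lambda>k. (1 / jb k)\<^sup>2) summable_on range int"
    using 1 by (subst summable_on_reindex) (auto simp: o_def japanese_bracket_def power_divide)
  have 3: "(\<lambda>k. (1 / jb k)\<^sup>2) summable_on range (\<lambda>n. - int n)"
    using 1 by (subst summable_on_reindex) (auto simp: o_def japanese_bracket_def inj_def power_divide)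
  have "(UNIV :: int set) = range int \<union> range (\<lambda>n. - int n)"
  proof (intro equalityI subsetI)
    fix k :: int show "k \<in> range int \<union> range (\<lambda>n. - int n)"
      by (cases k rule: int_cases2) auto
  qed simp
  then show ?thesis using summable_on_union[OF 2 3] by simp
qed

text \<open>The Cauchy-Schwarz constant with which the weighted l2 norm of any order at least 1
  controls the l1 norm.\<close>

definition jb_const :: real where "jb_const = sqrt (\<Sum>\<^sub>\<infinity>k. (1 / jb k)\<^sup>2)"

lemma jb_const_nonneg [simp]: "0 \<le> jb_const"
  by (simp add: jb_const_def infsum_nonneg)

lemma weighted_l2_norm_nonneg [simp]: "0 \<le> weighted_l2_norm s a"
  by (simp add: weighted_l2_norm_def infsum_nonneg)

lemma weighted_l2_norm_sq:
  "(weighted_l2_norm s a)\<^sup>2 = (\<Sum>\<^sub>\<infinity>k. (jb k powr s * cmod (a k))\<^sup>2)"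
  by (simp add: weighted_l2_norm_def infsum_nonneg)

lemma weighted_l2_pointwise:
  assumes "weighted_l2 s a"
  shows "jb k powr s * cmod (a k) \<le> weighted_l2_norm s a"
proof -
  have "(\<Sum>j\<in>{k}. (jb j powr s * cmod (a j))\<^sup>2) \<le> (weighted_l2_norm s a)\<^sup>2"
    unfolding weighted_l2_norm_sq using assms
    by (intro finite_sum_le_infsum) (auto simp: weighted_l2_def)
  then have "(jb k powr s * cmod (a k))\<^sup>2 \<le> (weighted_l2_norm s a)\<^sup>2" by simp
  then show ?thesis by (rule power2_le_imp_le) simp
qed

lemma weighted_l2_imp_l1:
  assumes "1 \<le> s" "weighted_l2 s a"
  shows "(\<lambda>k. cmod (a k)) summable_on UNIV"
    and "(\<Sum>\<^sub>\<infinity>k. cmod (a k)) \<le> jb_const * weighted_l2_norm s a"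
proof -
  have sq: "(\<lambda>k. (jb k powr s * cmod (a k))\<^sup>2) summable_on UNIV"
    using assms by (simp add: weighted_l2_def)
  note CS = Cauchy_Schwarz_infsum[OF summable_jb sq]
  have le: "cmod (a k) \<le> \<bar>1 / jb k * (jb k powr s * cmod (a k))\<bar>" for k
  proof -
    have "jb k powr 1 \<le> jb k powr s" using assms by (intro powr_mono) auto
    then have "1 \<le> jb k powr s / jb k" by (simp add: field_simps)
    then have "1 * cmod (a k) \<le> jb k powr s / jb k * cmod (a k)" by (intro mult_right_mono) auto
    then show ?thesis by (simp add: abs_mult abs_of_pos[OF jb_pos])
  qed
  show s: "(\<lambda>k. cmod (a k)) summable_on UNIV"
    using CS(1) by (rule summable_on_comparison_test) (use le in auto)
  have "(\<Sum>\<^sub>\<infinity>k. cmod (a k)) \<le> (\<Sum>\<^sub>\<infinity>k. \<bar>1 / jb k * (jb k powr s * cmod (a k))\<bar>)"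
    using s CS(1) le by (intro infsum_mono)
  also have "\<dots> \<le> jb_const * weighted_l2_norm s a"
    using CS(2) by (simp only: jb_const_def weighted_l2_norm_def)
  finally show "(\<Sum>\<^sub>\<infinity>k. cmod (a k)) \<le> jb_const * weighted_l2_norm s a" .
qed

section \<open>Triples of frequencies and the cubic nonlinearity\<close>

lemma slot_bijs:
  fixes k :: int
  shows "bij (\<lambda>i::int\<times>int. (fst i, snd i))" "bij (\<lambda>i::int\<times>int. (snd i, fst i))"
    "bij (\<lambda>i::int\<times>int. (fst i, fst i + snd i - k))" "bij (\<lambda>i::int\<times>int. (snd i, fst i + snd i - k))"
    "bij (\<lambda>i::int\<times>int. (fst i + snd i - k, fst i))" "bij (\<lambda>i::int\<times>int. (fst i + snd i - k, snd i))"
proof -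
  show "bij (\<lambda>i::int\<times>int. (fst i, snd i))" by (simp add: bij_def inj_def)
  show "bij (\<lambda>i::int\<times>int. (snd i, fst i))"
    by (rule bij_betw_byWitness[where f' = "\<lambda>i. (snd i, fst i)"]) auto
  show "bij (\<lambda>i::int\<times>int. (fst i, fst i + snd i - k))"
    by (rule bij_betw_byWitness[where f' = "\<lambda>i. (fst i, snd i - fst i + k)"]) auto
  show "bij (\<lambda>i::int\<times>int. (snd i, fst i + snd i - k))"
    by (rule bij_betw_byWitness[where f' = "\<lambda>i. (snd i - fst i + k, fst i)"]) auto
  show "bij (\<lambda>i::int\<times>int. (fst i + snd i - k, fst i))"
    by (rule bij_betw_byWitness[where f' = "\<lambda>i. (snd i, fst i - snd i + k)"]) auto
  show "bij (\<lambda>i::int\<times>int. (fst i + snd i - k, snd i))"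
    by (rule bij_betw_byWitness[where f' = "\<lambda>i. (fst i - snd i + k, snd i)"]) auto
qed

text \<open>A pair \<open>p = (k\<^sub>1, k\<^sub>2)\<close> stands for the triple of frequencies with \<open>k = k\<^sub>1 + k\<^sub>2 - k\<^sub>3\<close>.\<close>
definition symb :: "real \<Rightarrow> real \<Rightarrow> real \<Rightarrow> int \<Rightarrow> int \<Rightarrow> complex" where
  "symb \<gamma> \<gamma>' \<Gamma> k x = \<i> * of_real \<gamma> + \<i> * of_real \<gamma>' * of_int k + of_real \<Gamma> * of_int (k - x)"

definition trip :: "(int \<Rightarrow> complex) \<Rightarrow> int \<Rightarrow> int \<times> int \<Rightarrow> complex" where
  "trip a k p = a (fst p) * a (snd p) * cnj (a (fst p + snd p - k))"

definition nonlin :: "real \<Rightarrow> real \<Rightarrow> real \<Rightarrow> (int \<Rightarrow> complex) \<Rightarrow> int \<Rightarrow> complex" where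
  "nonlin \<gamma> \<gamma>' \<Gamma> a k = of_real (1 / (2 * pi)) * (\<Sum>\<^sub>\<infinity>p. symb \<gamma> \<gamma>' \<Gamma> k (fst p) * trip a k p)"

text \<open>One summand for each choice of two slots that carry the full Sobolev weight, the third
  slot being left to the l1 norm. Whichever two frequencies of a triple are the largest, some
  summand has its weights there.\<close>

definition maj :: "real \<Rightarrow> (int \<Rightarrow> complex) \<Rightarrow> int \<Rightarrow> int \<times> int \<Rightarrow> real" where
  "maj s a k p = (let x = fst p; y = snd p; z = x + y - k in
     (jb x powr s * cmod (a x)) * (jb y powr s * cmod (a y)) * cmod (a z)
     + (jb x powr s * cmod (a x)) * (jb z powr s * cmod (a z)) * cmod (a y)
     + (jb y powr s * cmod (a y)) * (jb z powr s * cmod (a z)) * cmod (a x))"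

lemma maj_nonneg: "0 \<le> maj s a k p"
  unfolding maj_def Let_def by (intro add_nonneg_nonneg mult_nonneg_nonneg) auto

lemma maj_summable:
  assumes "1 \<le> s" "weighted_l2 s a" "weighted_l2_norm s a \<le> M"
  shows "maj s a k summable_on UNIV" "(\<Sum>\<^sub>\<infinity>p. maj s a k p) \<le> 3 * jb_const * M ^ 3"
proof -
  define D where "D j = jb j powr s * cmod (a j)" for j
  have absD: "\<bar>D j\<bar> = D j" for j by (simp add: D_def)
  have D2: "(\<lambda>j. (D j)\<^sup>2) summable_on UNIV"
    using assms by (simp add: D_def weighted_l2_def)
  have nD: "sqrt (\<Sum>\<^sub>\<infinity>j. (D j)\<^sup>2) = weighted_l2_norm s a"
    by (simp add: D_def weighted_l2_norm_def)
  note l1 = weighted_l2_imp_l1[OF assms(1,2)]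
  note T = trilinear_bound[OF D2 D2 l1(1) norm_ge_zero, unfolded absD nD]
  note T1 = T[OF slot_bijs(3)[of k] slot_bijs(4)[of k]]
  note T2 = T[OF slot_bijs(1) slot_bijs(6)[of k]]
  note T3 = T[OF slot_bijs(2) slot_bijs(5)[of k]]
  have eq: "maj s a k = (\<lambda>p. D (fst p) * D (snd p) * cmod (a (fst p + snd p - k))
      + D (fst p) * D (fst p + snd p - k) * cmod (a (snd p))
      + D (snd p) * D (fst p + snd p - k) * cmod (a (fst p)))"
    by (simp add: fun_eq_iff maj_def D_def Let_def)
  show "maj s a k summable_on UNIV"
    unfolding eq by (intro summable_on_add T1 T2 T3)
  have M: "0 \<le> weighted_l2_norm s a" by simp
  have c: "weighted_l2_norm s a * weighted_l2_norm s a * (\<Sum>\<^sub>\<infinity>k. cmod (a k)) \<le> M * M * (jb_const * M)"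
    using M assms(3) l1(2) mult_left_mono[OF assms(3) jb_const_nonneg]
    by (intro mult_mono) (auto intro!: infsum_nonneg intro: order_trans[OF M])
  have "(\<Sum>\<^sub>\<infinity>p. maj s a k p) \<le> 3 * (weighted_l2_norm s a * weighted_l2_norm s a * (\<Sum>\<^sub>\<infinity>k. cmod (a k)))"
    unfolding eq infsum_add[OF summable_on_add[OF T1(1) T2(1)] T3(1)] infsum_add[OF T1(1) T2(1)]
    using T1(2) T2(2) T3(2) by linarith
  also have "\<dots> \<le> 3 * (M * M * (jb_const * M))" using c by simp
  finally show "(\<Sum>\<^sub>\<infinity>p. maj s a k p) \<le> 3 * jb_const * M ^ 3"
    by (simp add: power3_eq_cube mult_ac)
qed

text \<open>Here \<open>K\<close> is the weight of the output frequency, \<open>P\<close> and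
  \<open>Q\<close> are those of the two largest input frequencies, and \<open>L\<close> is the size
  of the symbol. The larger of \<open>P\<close> and \<open>Q\<close> pays for
  \<open>K powr s\<close> at the price \<open>3 powr s\<close>; the smaller one still pays for one
  derivative because s is at least 1. In the second claim the smaller one is itself comparable to
  \<open>K\<close> and absorbs all of \<open>L\<close>, whence one more power of \<open>K\<close> is
  gained; 18 is 2 * 8 + 2.\<close>

lemma weight_bound:
  fixes s K P Q L :: real
  assumes s: "1 \<le> s" and K: "1 \<le> K" and P: "1 \<le> P" "1 \<le> Q" and KPQ: "K \<le> 3 * max P Q"
    and L: "L \<le> 2 * K + 2 * min P Q"
  shows "L \<le> 4 * 3 powr s * K powr (1 - s) * (P powr s * Q powr s)"
    and "K \<le> 8 * min P Q \<Longrightarrow> L \<le> 18 * 3 powr s * K powr (- s) * (P powr s * Q powr s)"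
proof -
  define mn where "mn = min P Q"
  define mx where "mx = max P Q"
  have m: "1 \<le> mn" "1 \<le> mx" "P powr s * Q powr s = mn powr s * mx powr s"
    using P by (auto simp: mn_def mx_def min_def max_def)
  have mns: "mn \<le> mn powr s" using powr_mono[of 1 s mn] m s by simp
  have "K powr s \<le> (3 * mx) powr s" using KPQ K s by (intro powr_mono2) (auto simp: mx_def)
  then have "K powr s * K powr (- s) \<le> 3 powr s * mx powr s * K powr (- s)"
    using m by (intro mult_right_mono) (auto simp: powr_mult)
  then have one: "1 \<le> 3 powr s * mx powr s * K powr (- s)"
    using K by (simp flip: powr_add)
  have mn2: "mn \<le> mn powr s * (3 powr s * mx powr s * K powr (- s))"
    using mult_mono[OF mns one] m by simp
  have "L \<le> 4 * (K * mn)"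
  proof -
    have "K + mn \<le> 2 * (K * mn)"
    proof -
      have "K * 1 \<le> K * mn" "1 * mn \<le> K * mn" using K m by (intro mult_mono; simp)+
      then show ?thesis by linarith
    qed
    then show ?thesis using L unfolding mn_def by linarith
  qed
  also have "\<dots> \<le> 4 * (K * (mn powr s * (3 powr s * mx powr s * K powr (- s))))"
    using mn2 K by (intro mult_left_mono) auto
  also have "\<dots> = 4 * 3 powr s * (K powr 1 * K powr (- s)) * (mn powr s * mx powr s)"
    using K by simp
  also have "\<dots> = 4 * 3 powr s * K powr (1 - s) * (mn powr s * mx powr s)"
    by (simp only: powr_add[symmetric]) simp
  finally show "L \<le> 4 * 3 powr s * K powr (1 - s) * (P powr s * Q powr s)" by (simp add: m)
  assume "K \<le> 8 * min P Q"
  then have "L \<le> 18 * mn" using L unfolding mn_def by linarith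
  also have "\<dots> \<le> 18 * (mn powr s * (3 powr s * mx powr s * K powr (- s)))" using mn2 by simp
  finally show "L \<le> 18 * 3 powr s * K powr (- s) * (P powr s * Q powr s)" by (simp add: m mult_ac)
qed

lemma maj_lower:
  fixes c L :: real
  assumes "z = x + y - k" "0 \<le> c"
    and "L \<le> c * (jb x powr s * jb y powr s) \<or> L \<le> c * (jb x powr s * jb z powr s) \<or>
         L \<le> c * (jb y powr s * jb z powr s)"
  shows "L * (cmod (a x) * cmod (a y) * cmod (a z)) \<le> c * maj s a k (x, y)"
proof -
  define t where "t = cmod (a x) * cmod (a y) * cmod (a z)"
  have t: "0 \<le> t" by (simp add: t_def)
  have m: "maj s a k (x, y) = (jb x powr s * jb y powr s) * t + (jb x powr s * jb z powr s) * t
      + (jb y powr s * jb z powr s) * t"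
    using assms(1) by (simp add: maj_def Let_def t_def mult_ac)
  have p: "0 \<le> (jb x powr s * jb y powr s) * t" "0 \<le> (jb x powr s * jb z powr s) * t"
      "0 \<le> (jb y powr s * jb z powr s) * t" using t by auto
  from assms(3) have "L * t \<le> c * (jb x powr s * jb y powr s) * t \<or> L * t \<le> c * (jb x powr s * jb z powr s) * t
      \<or> L * t \<le> c * (jb y powr s * jb z powr s) * t"
    using t by (meson mult_right_mono)
  then show ?thesis
    unfolding t_def[symmetric] m
    using p[THEN mult_left_mono[OF _ assms(2)]] by (auto simp: algebra_simps)
qed

lemma symb_bound:
  "cmod (symb \<gamma> \<gamma>' \<Gamma> k x) \<le> (\<bar>\<gamma>\<bar> + \<bar>\<gamma>'\<bar> + \<bar>\<Gamma>\<bar>) * (jb k + \<bar>of_int (k - x)\<bar>)"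
proof -
  have "cmod (symb \<gamma> \<gamma>' \<Gamma> k x) \<le> \<bar>\<gamma>\<bar> + \<bar>\<gamma>'\<bar> * \<bar>of_int k\<bar> + \<bar>\<Gamma>\<bar> * \<bar>of_int (k - x)\<bar>"
    unfolding symb_def
    by (rule order_trans[OF norm_triangle_ineq add_mono[OF order_trans[OF norm_triangle_ineq]]])
       (simp_all add: norm_mult flip: of_int_diff)
  also have "\<dots> \<le> (\<bar>\<gamma>\<bar> + \<bar>\<gamma>'\<bar> + \<bar>\<Gamma>\<bar>) * (jb k + \<bar>of_int (k - x)\<bar>)"
    by (simp add: japanese_bracket_def algebra_simps)
  finally show ?thesis .
qed

text \<open>The pair \<open>P\<close>, \<open>Q\<close> consists of the two largest of the three
  frequencies. Then k = x + y - z gives the factor 3, and k - x = y - z allows \<open>L\<close> to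
  be estimated by k and the smaller member of the pair. If some two of the three frequencies exceed
  |k| / 8 in modulus, so do both members of the pair.\<close>

lemma triple_weight_bound:
  assumes s: "1 \<le> s" and z: "z = x + y - k"
  defines "L \<equiv> jb k + \<bar>of_int (k - x)\<bar>"
  shows "L * (cmod (a x) * cmod (a y) * cmod (a z)) \<le> 4 * 3 powr s * jb k powr (1 - s) * maj s a k (x, y)"
    and "\<lbrakk>(\<bar>k\<bar> < 8 * \<bar>x\<bar> \<and> \<bar>k\<bar> < 8 * \<bar>y\<bar>) \<or> (\<bar>k\<bar> < 8 * \<bar>x\<bar> \<and> \<bar>k\<bar> < 8 * \<bar>z\<bar>) \<or> (\<bar>k\<bar> < 8 * \<bar>y\<bar> \<and> \<bar>k\<bar> < 8 * \<bar>z\<bar>)\<rbrakk>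
      \<Longrightarrow> L * (cmod (a x) * cmod (a y) * cmod (a z)) \<le> 18 * 3 powr s * jb k powr (- s) * maj s a k (x, y)"
      (is "?hi \<Longrightarrow> _")
proof -
  define r :: "int \<Rightarrow> real" where "r = of_int"
  have rk: "r k = r x + r y - r z" using z by (simp add: r_def)
  have j: "jb i = 1 + \<bar>r i\<bar>" for i by (simp add: japanese_bracket_def r_def)
  have Lr: "L = 1 + \<bar>r k\<bar> + \<bar>r k - r x\<bar>" by (simp add: L_def j r_def)
  have hi: "1 + \<bar>r k\<bar> \<le> 8 * (1 + \<bar>r i\<bar>)" if "\<bar>k\<bar> < 8 * \<bar>i\<bar>" for i
  proof -
    have "real_of_int \<bar>k\<bar> \<le> real_of_int (8 * \<bar>i\<bar>)" using that by (subst of_int_le_iff) simp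
    then show ?thesis unfolding r_def by simp
  qed
  have core: "\<exists>P Q. (P, Q) \<in> {(x, y), (x, z), (y, z)} \<and> jb k \<le> 3 * max (jb P) (jb Q) \<and>
      L \<le> 2 * jb k + 2 * min (jb P) (jb Q) \<and> (?hi \<longrightarrow> jb k \<le> 8 * min (jb P) (jb Q))"
  proof -
    consider "\<bar>r z\<bar> \<le> \<bar>r x\<bar>" "\<bar>r z\<bar> \<le> \<bar>r y\<bar>" | "\<bar>r y\<bar> \<le> \<bar>r x\<bar>" "\<bar>r y\<bar> \<le> \<bar>r z\<bar>"
      | "\<bar>r x\<bar> \<le> \<bar>r y\<bar>" "\<bar>r x\<bar> \<le> \<bar>r z\<bar>" by linarith
    then show ?thesis
    proof cases
      case 1
      have "jb k \<le> 8 * min (jb x) (jb y)" if ?hi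
        using that 1 hi[of x] hi[of y] hi[of z] unfolding j by (auto simp: min_def)
      moreover have "jb k \<le> 3 * max (jb x) (jb y)" "L \<le> 2 * jb k + 2 * min (jb x) (jb y)"
        using 1 rk unfolding j Lr max_def min_def by (simp_all split: if_splits; linarith)+
      ultimately show ?thesis by blast
    next
      case 2
      have "jb k \<le> 8 * min (jb x) (jb z)" if ?hi
        using that 2 hi[of x] hi[of y] hi[of z] unfolding j by (auto simp: min_def)
      moreover have "jb k \<le> 3 * max (jb x) (jb z)" "L \<le> 2 * jb k + 2 * min (jb x) (jb z)"
        using 2 rk unfolding j Lr max_def min_def by (simp_all split: if_splits; linarith)+
      ultimately show ?thesis by blast
    next
      case 3
      have "jb k \<le> 8 * min (jb y) (jb z)" if ?hi
        using that 3 hi[of x] hi[of y] hi[of z] unfolding j by (auto simp: min_def)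
      moreover have "jb k \<le> 3 * max (jb y) (jb z)" "L \<le> 2 * jb k + 2 * min (jb y) (jb z)"
        using 3 rk unfolding j Lr max_def min_def by (simp_all split: if_splits; linarith)+
      ultimately show ?thesis by blast
    qed
  qed
  then obtain P Q where PQ: "(P, Q) \<in> {(x, y), (x, z), (y, z)}" "jb k \<le> 3 * max (jb P) (jb Q)"
      "L \<le> 2 * jb k + 2 * min (jb P) (jb Q)" "?hi \<longrightarrow> jb k \<le> 8 * min (jb P) (jb Q)"
    by blast
  note wb = weight_bound[OF s jb_ge_1 jb_ge_1 jb_ge_1 PQ(2,3)]
  show "L * (cmod (a x) * cmod (a y) * cmod (a z)) \<le> 4 * 3 powr s * jb k powr (1 - s) * maj s a k (x, y)"
    by (rule maj_lower[OF z]) (use PQ(1) wb(1) in auto)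
  assume ?hi
  then show "L * (cmod (a x) * cmod (a y) * cmod (a z)) \<le> 18 * 3 powr s * jb k powr (- s) * maj s a k (x, y)"
    using PQ(4) by (intro maj_lower[OF z]) (use PQ(1) wb(2) in auto)
qed

lemma symb_trip_bound:
  fixes a :: "int \<Rightarrow> complex" and \<gamma> \<gamma>' \<Gamma> :: real
  assumes s: "1 \<le> s"
  defines "G \<equiv> \<bar>\<gamma>\<bar> + \<bar>\<gamma>'\<bar> + \<bar>\<Gamma>\<bar>"
  shows "cmod (symb \<gamma> \<gamma>' \<Gamma> k (fst p) * trip a k p) \<le> G * (4 * 3 powr s * jb k powr (1 - s) * maj s a k p)"
    and "\<lbrakk>x = fst p; y = snd p; z = x + y - k; (\<bar>k\<bar> < 8 * \<bar>x\<bar> \<and> \<bar>k\<bar> < 8 * \<bar>y\<bar>) \<or> (\<bar>k\<bar> < 8 * \<bar>x\<bar> \<and> \<bar>k\<bar> < 8 * \<bar>z\<bar>) \<or> (\<bar>k\<bar> < 8 * \<bar>y\<bar> \<and> \<bar>k\<bar> < 8 * \<bar>z\<bar>)\<rbrakk>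
      \<Longrightarrow> cmod (symb \<gamma> \<gamma>' \<Gamma> k (fst p) * trip a k p) \<le> G * (18 * 3 powr s * jb k powr (- s) * maj s a k p)"
proof -
  have G: "0 \<le> G" by (simp add: G_def)
  have "cmod (symb \<gamma> \<gamma>' \<Gamma> k (fst p) * trip a k p) \<le> G * (jb k + \<bar>of_int (k - fst p)\<bar>) *
      (cmod (a (fst p)) * cmod (a (snd p)) * cmod (a (fst p + snd p - k)))"
    unfolding norm_mult trip_def complex_mod_cnj G_def by (intro mult_right_mono symb_bound) auto
  then have 1: "cmod (symb \<gamma> \<gamma>' \<Gamma> k (fst p) * trip a k p) \<le> G * ((jb k + \<bar>of_int (k - fst p)\<bar>) *
      (cmod (a (fst p)) * cmod (a (snd p)) * cmod (a (fst p + snd p - k))))"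
    by (simp only: mult.assoc)
  note T = triple_weight_bound[OF s refl, where x = "fst p" and y = "snd p" and k = k and a = a]
  show "cmod (symb \<gamma> \<gamma>' \<Gamma> k (fst p) * trip a k p) \<le> G * (4 * 3 powr s * jb k powr (1 - s) * maj s a k p)"
    using 1 mult_left_mono[OF T(1) G] by simp
  assume "x = fst p" "y = snd p" "z = x + y - k" "(\<bar>k\<bar> < 8 * \<bar>x\<bar> \<and> \<bar>k\<bar> < 8 * \<bar>y\<bar>) \<or> (\<bar>k\<bar> < 8 * \<bar>x\<bar> \<and> \<bar>k\<bar> < 8 * \<bar>z\<bar>) \<or> (\<bar>k\<bar> < 8 * \<bar>y\<bar> \<and> \<bar>k\<bar> < 8 * \<bar>z\<bar>)"
  then show "cmod (symb \<gamma> \<gamma>' \<Gamma> k (fst p) * trip a k p) \<le> G * (18 * 3 powr s * jb k powr (- s) * maj s a k p)"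
    using 1 mult_left_mono[OF T(2) G] by simp
qed

lemma nonlin_summable:
  assumes "1 \<le> s" "weighted_l2 s a"
  shows "(\<lambda>p. cmod (symb \<gamma> \<gamma>' \<Gamma> k (fst p) * trip a k p)) summable_on UNIV"
  by (rule Infinite_Sum.abs_summable_on_comparison_test'[OF _ symb_trip_bound(1)[OF assms(1)]])
     (intro summable_on_cmult_right maj_summable(1)[OF assms order_refl])

text \<open>The loss of one derivative is harmless: the bound serves for the error terms of the
  normal form, whose denominators regain it.\<close>

lemma nonlin_bound:
  assumes "1 \<le> s" "weighted_l2 s a" "weighted_l2_norm s a \<le> M"
  shows "cmod (nonlin \<gamma> \<gamma>' \<Gamma> a k) \<le>
    (\<bar>\<gamma>\<bar> + \<bar>\<gamma>'\<bar> + \<bar>\<Gamma>\<bar>) * (4 * 3 powr s * (3 * jb_const * M ^ 3)) * jb k powr (1 - s)"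
proof -
  define G where "G = \<bar>\<gamma>\<bar> + \<bar>\<gamma>'\<bar> + \<bar>\<Gamma>\<bar>"
  have G: "0 \<le> G" by (simp add: G_def)
  note ms = maj_summable[OF assms, of k]
  have "cmod (\<Sum>\<^sub>\<infinity>p. symb \<gamma> \<gamma>' \<Gamma> k (fst p) * trip a k p) \<le> (\<Sum>\<^sub>\<infinity>p. G * (4 * 3 powr s * jb k powr (1 - s) * maj s a k p))"
    by (rule norm_infsum_le[OF has_sum_infsum has_sum_infsum])
       (use symb_trip_bound(1)[OF assms(1)] Infinite_Sum.abs_summable_summable[OF nonlin_summable[OF assms(1,2)]]
          in \<open>auto simp: G_def intro!: summable_on_cmult_right ms(1)\<close>)
  also have "\<dots> = G * (4 * 3 powr s * jb k powr (1 - s)) * (\<Sum>\<^sub>\<infinity>p. maj s a k p)"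
    by (simp add: infsum_cmult_right' mult.assoc)
  also have "\<dots> \<le> G * (4 * 3 powr s * jb k powr (1 - s)) * (3 * jb_const * M ^ 3)"
    using G by (intro mult_left_mono ms(2)) auto
  finally have 1: "cmod (\<Sum>\<^sub>\<infinity>p. symb \<gamma> \<gamma>' \<Gamma> k (fst p) * trip a k p)
    \<le> G * (4 * 3 powr s * (3 * jb_const * M ^ 3)) * jb k powr (1 - s)" by (simp add: mult_ac)
  have "cmod (of_real (1 / (2 * pi))) \<le> 1"
    unfolding norm_of_real using pi_gt3 by simp
  then have "cmod (nonlin \<gamma> \<gamma>' \<Gamma> a k) \<le> 1 * cmod (\<Sum>\<^sub>\<infinity>p. symb \<gamma> \<gamma>' \<Gamma> k (fst p) * trip a k p)"
    unfolding nonlin_def norm_mult by (intro mult_right_mono) auto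
  then show ?thesis using 1 unfolding G_def by simp
qed

section \<open>Triples with a single high frequency\<close>

definition low :: "int \<Rightarrow> int set" where "low k = {- (k div 8)..k div 8}"

lemma finite_low [simp]: "finite (low k)"
  by (simp add: low_def)

lemma low_iff: "0 < k \<Longrightarrow> x \<in> low k \<longleftrightarrow> 8 * \<bar>x\<bar> \<le> k"
  unfolding low_def by (auto simp: abs_le_iff)

lemma zero_in_low: "0 < k \<Longrightarrow> 0 \<in> low k"
  by (simp add: low_iff)

text \<open>The triples in which \<open>k\<^sub>2\<close>, resp. \<open>k\<^sub>1\<close>, is the only high frequency; \<open>low k \<times> low k\<close>
  consists of those in which \<open>k\<^sub>3\<close> is.\<close>
definition high2 :: "int \<Rightarrow> (int \<times> int) set" where
  "high2 k = (\<lambda>(x, z). (x, k - x + z)) ` (low k \<times> low k)"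

definition high1 :: "int \<Rightarrow> (int \<times> int) set" where
  "high1 k = (\<lambda>(y, z). (k - y + z, y)) ` (low k \<times> low k)"

lemma high_iff:
  "(x, y) \<in> high2 k \<longleftrightarrow> x \<in> low k \<and> x + y - k \<in> low k"
  "(x, y) \<in> high1 k \<longleftrightarrow> y \<in> low k \<and> x + y - k \<in> low k"
proof -
  have "(x, y) \<in> high2 k" if "x \<in> low k" "x + y - k \<in> low k"
    unfolding high2_def by (rule image_eqI[of _ _ "(x, x + y - k)"]) (use that in auto)
  then show "(x, y) \<in> high2 k \<longleftrightarrow> x \<in> low k \<and> x + y - k \<in> low k"
    by (auto simp: high2_def)
  have "(x, y) \<in> high1 k" if "y \<in> low k" "x + y - k \<in> low k"
    unfolding high1_def by (rule image_eqI[of _ _ "(y, x + y - k)"]) (use that in auto)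
  then show "(x, y) \<in> high1 k \<longleftrightarrow> y \<in> low k \<and> x + y - k \<in> low k"
    by (auto simp: high1_def)
qed

text \<open>The relation k = x + y - z excludes this, since 3/8 < 1. It makes the three families of
  triples with one high frequency disjoint.\<close>

lemma not_all_low:
  assumes "0 < k" "x \<in> low k" "y \<in> low k" "x + y - k \<in> low k"
  shows False
proof -
  have "8 * \<bar>x\<bar> \<le> k" "8 * \<bar>y\<bar> \<le> k" "8 * \<bar>x + y - k\<bar> \<le> k" using assms by (simp_all add: low_iff)
  then have "8 * x \<le> k" "8 * y \<le> k" "- (8 * (x + y - k)) \<le> k"
    using abs_ge_self[of x] abs_ge_self[of y] abs_ge_minus_self[of "x + y - k"] by simp_all
  then show False using assms(1) by simp
qed

lemma finite_high [simp]: "finite (high1 k)" "finite (high2 k)"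
  by (simp_all add: high1_def high2_def)

text \<open>The full double sum is at most (b 0 + \<delta>)^2. Removing the term at the origin
  leaves 2 (b 0) \<delta> + \<delta>^2, which is at most 5 \<delta>.\<close>

lemma low_sum_bounds:
  fixes b :: "int \<Rightarrow> real"
  assumes k: "0 < k" and b: "\<And>j. 0 \<le> b j" and "b 0 \<le> 2" and d: "0 \<le> \<delta>" "\<delta> \<le> 1"
    and small: "\<And>F. finite F \<Longrightarrow> 0 \<notin> F \<Longrightarrow> sum b F \<le> \<delta>"
  shows "(\<Sum>p\<in>low k \<times> low k - {(0, 0)}. b (fst p) * b (snd p)) \<le> 5 * \<delta>"
proof -
  have 0: "(0, 0) \<in> low k \<times> low k" using k by (simp add: zero_in_low)
  have "sum b (low k) = b 0 + sum b (low k - {0})"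
    using zero_in_low[OF k] by (subst sum.remove[of _ 0]) auto
  also have "\<dots> \<le> b 0 + \<delta>" using small[of "low k - {0}"] by simp
  finally have 1: "sum b (low k) \<le> b 0 + \<delta>" .
  have "(\<Sum>p\<in>low k \<times> low k. b (fst p) * b (snd p)) = sum b (low k) * sum b (low k)"
    by (simp add: sum_product sum.cartesian_product case_prod_beta)
  also have "\<dots> \<le> (b 0 + \<delta>) * (b 0 + \<delta>)"
    using 1 b d by (intro mult_mono) (auto intro!: sum_nonneg add_nonneg_nonneg)
  finally have 2: "(\<Sum>p\<in>low k \<times> low k. b (fst p) * b (snd p)) \<le> (b 0 + \<delta>) * (b 0 + \<delta>)" .
  have 3: "(\<Sum>p\<in>low k \<times> low k. b (fst p) * b (snd p)) =
      b 0 * b 0 + (\<Sum>p\<in>low k \<times> low k - {(0, 0)}. b (fst p) * b (snd p))"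
    using 0 by (subst sum.remove[of _ "(0, 0)"]) auto
  have "b 0 * \<delta> \<le> 2 * \<delta>" "\<delta> * \<delta> \<le> 1 * \<delta>" using assms by (intro mult_right_mono; simp)+
  with 2 3 show ?thesis by (simp add: algebra_simps)
qed

lemma symb_le_lin:
  assumes "0 < k" "8 * \<bar>i\<bar> \<le> 9 * k" "k - x = i"
  shows "cmod (symb \<gamma> \<gamma>' \<Gamma> k x) \<le> 2 * (\<bar>\<gamma>\<bar> + \<bar>\<gamma>'\<bar> + \<bar>\<Gamma>\<bar>) * of_int k"
proof -
  have i: "8 * \<bar>real_of_int i\<bar> \<le> 9 * of_int k"
  proof -
    have "real_of_int (8 * \<bar>i\<bar>) \<le> real_of_int (9 * k)" using assms(2) by (subst of_int_le_iff)
    then show ?thesis by simp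
  qed
  have k: "1 \<le> real_of_int k" using assms(1) by linarith
  have "cmod (symb \<gamma> \<gamma>' \<Gamma> k x) \<le> \<bar>\<gamma>\<bar> + \<bar>\<gamma>'\<bar> * \<bar>of_int k\<bar> + \<bar>\<Gamma>\<bar> * \<bar>of_int i\<bar>"
    unfolding symb_def assms(3)
    by (rule order_trans[OF norm_triangle_ineq add_mono[OF order_trans[OF norm_triangle_ineq]]])
       (simp_all add: norm_mult)
  also have "\<dots> \<le> \<bar>\<gamma>\<bar> * (2 * of_int k) + \<bar>\<gamma>'\<bar> * (2 * of_int k) + \<bar>\<Gamma>\<bar> * (2 * of_int k)"
    using k i by (intro add_mono mult_left_mono mult_left_le) (auto simp: mult_le_cancel_left1)
  finally show ?thesis by (simp add: algebra_simps)
qed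

text \<open>The low pair (0, 0) produces a multiple of \<open>c k\<close> itself, while every other
  low pair contains a nonzero mode and thereby costs a factor \<delta>. The bound \<open>W\<close>
  concerns \<open>c\<close> at frequencies within k/4 of k.\<close>

lemma single_high_bound:
  fixes a c :: "int \<Rightarrow> complex" and m :: "int \<times> int \<Rightarrow> complex"
  assumes k: "0 < k" and a0: "cmod (a 0) \<le> 2" and d: "0 \<le> \<delta>" "\<delta> \<le> 1" and W: "0 \<le> W" and C: "0 \<le> C"
    and small: "\<And>F. finite F \<Longrightarrow> 0 \<notin> F \<Longrightarrow> (\<Sum>j\<in>F. cmod (a j)) \<le> \<delta>"
    and m: "\<And>p. p \<in> low k \<times> low k \<Longrightarrow> cmod (m p) \<le> C"
    and c: "\<And>p. p \<in> low k \<times> low k \<Longrightarrow> cmod (c (k - fst p + snd p)) \<le> W"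
  shows "cmod ((\<Sum>p\<in>low k \<times> low k. m p * (a (fst p) * cnj (a (snd p)) * c (k - fst p + snd p)))
    - m (0, 0) * (of_real ((cmod (a 0))\<^sup>2) * c k)) \<le> C * W * (5 * \<delta>)"
proof -
  let ?f = "\<lambda>p. m p * (a (fst p) * cnj (a (snd p)) * c (k - fst p + snd p))"
  have 0: "(0, 0) \<in> low k \<times> low k" using k by (simp add: zero_in_low)
  have "sum ?f (low k \<times> low k) = ?f (0, 0) + sum ?f (low k \<times> low k - {(0, 0)})"
    using 0 by (subst sum.remove[of _ "(0, 0)"]) auto
  also have "?f (0, 0) = m (0, 0) * (of_real ((cmod (a 0))\<^sup>2) * c k)"
    unfolding complex_norm_square by (simp add: mult_ac)
  finally have "cmod (sum ?f (low k \<times> low k) - m (0, 0) * (of_real ((cmod (a 0))\<^sup>2) * c k))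
      = cmod (sum ?f (low k \<times> low k - {(0, 0)}))" by simp
  also have "\<dots> \<le> (\<Sum>p\<in>low k \<times> low k - {(0, 0)}. C * W * (cmod (a (fst p)) * cmod (a (snd p))))"
  proof (rule sum_norm_le)
    fix p assume p: "p \<in> low k \<times> low k - {(0, 0)}"
    have "cmod (?f p) = (cmod (m p) * cmod (c (k - fst p + snd p))) * (cmod (a (fst p)) * cmod (a (snd p)))"
      by (simp add: norm_mult mult_ac)
    also have "\<dots> \<le> (C * W) * (cmod (a (fst p)) * cmod (a (snd p)))"
      using p C W by (intro mult_right_mono mult_mono m c) auto
    finally show "cmod (?f p) \<le> C * W * (cmod (a (fst p)) * cmod (a (snd p)))" .
  qed
  also have "\<dots> = C * W * (\<Sum>p\<in>low k \<times> low k - {(0, 0)}. cmod (a (fst p)) * cmod (a (snd p)))"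
    by (simp add: sum_distrib_left)
  also have "\<dots> \<le> C * W * (5 * \<delta>)"
    using C W low_sum_bounds[OF k norm_ge_zero a0 d small] by (intro mult_left_mono) auto
  finally show ?thesis .
qed

text \<open>The sum over pairs is cut into four pieces. In \<open>high2\<close> and
  \<open>high1\<close> the terms with two zero modes form the multiplier of \<open>a k\<close>;
  since \<open>symb \<gamma> \<gamma>' \<Gamma> k 0 + symb \<gamma> \<gamma>' \<Gamma> k k\<close>
  has real part \<Gamma> k, this multiplier is the source of the damping. The piece over
  \<open>low k \<times> low k\<close> is kept exactly, for the normal form. In the remaining triples
  two frequencies exceed k/8 in modulus, and the stronger bound of \<open>symb_trip_bound\<close>
  applies. The constant 20 is 2 * 2 * 5: two families, symbols of size 2 G k, and 5 \<delta> from
  \<open>single_high_bound\<close>.\<close>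

lemma nonlin_decomposition:
  fixes a :: "int \<Rightarrow> complex" and \<gamma> \<gamma>' \<Gamma> :: real
  assumes s: "1 \<le> s" "weighted_l2 s a" "weighted_l2_norm s a \<le> M"
    and k: "0 < k" and a0: "cmod (a 0) \<le> 2" and d: "0 \<le> \<delta>" "\<delta> \<le> 1"
    and small: "\<And>F. finite F \<Longrightarrow> 0 \<notin> F \<Longrightarrow> (\<Sum>j\<in>F. cmod (a j)) \<le> \<delta>"
    and W: "\<And>y. 3 * k \<le> 4 * y \<Longrightarrow> 4 * y \<le> 5 * k \<Longrightarrow> cmod (a y) \<le> W"
  defines "G \<equiv> \<bar>\<gamma>\<bar> + \<bar>\<gamma>'\<bar> + \<bar>\<Gamma>\<bar>"
  shows "cmod (nonlin \<gamma> \<gamma>' \<Gamma> a k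
      - of_real (1 / (2 * pi)) * of_real ((cmod (a 0))\<^sup>2) * (symb \<gamma> \<gamma>' \<Gamma> k 0 + symb \<gamma> \<gamma>' \<Gamma> k k) * a k
      - of_real (1 / (2 * pi)) * (\<Sum>p\<in>low k \<times> low k. symb \<gamma> \<gamma>' \<Gamma> k (fst p) * trip a k p))
    \<le> 1 / (2 * pi) * (20 * G * of_int k * W * \<delta>
        + G * (18 * 3 powr s * (3 * jb_const * M ^ 3)) * jb k powr (- s))"
proof -
  have G: "0 \<le> G" by (simp add: G_def)
  have W0: "0 \<le> W" using W[of k] k by (force intro: order_trans[OF norm_ge_zero])
  let ?f = "\<lambda>p. symb \<gamma> \<gamma>' \<Gamma> k (fst p) * trip a k p"
  define S where "S = high2 k \<union> high1 k \<union> (low k \<times> low k)"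
  have finS: "finite S" by (simp add: S_def)
  have sum_abs: "?f summable_on UNIV"
    by (rule Infinite_Sum.abs_summable_summable[OF nonlin_summable[OF s(1,2)]])
  have lowD: "8 * \<bar>x\<bar> \<le> k" if "x \<in> low k" for x using that low_iff[OF k] by blast
  have high_or_low: "i \<in> low k \<or> \<bar>k\<bar> < 8 * \<bar>i\<bar>" for i
    using k low_iff[OF k, of i] by linarith
  have disj1: "high2 k \<inter> high1 k = {}"
    by (auto simp: high_iff dest: not_all_low[OF k])
  have disj2: "(high2 k \<union> high1 k) \<inter> (low k \<times> low k) = {}"
    by (auto simp: high_iff dest: not_all_low[OF k])
  have split: "infsum ?f UNIV = sum ?f (high2 k) + sum ?f (high1 k) + sum ?f (low k \<times> low k) + infsum ?f (- S)"
  proof -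
    have "infsum ?f UNIV = infsum ?f S + infsum ?f (UNIV - S)"
      using sum_abs finS by (subst infsum_Diff) auto
    also have "infsum ?f S = sum ?f S" using finS by simp
    also have "sum ?f S = sum ?f (high2 k) + sum ?f (high1 k) + sum ?f (low k \<times> low k)"
      unfolding S_def using disj1 disj2 by (simp add: sum.union_disjoint)
    finally show ?thesis by (simp add: Compl_eq_Diff_UNIV)
  qed
  have h2: "cmod (sum ?f (high2 k) - symb \<gamma> \<gamma>' \<Gamma> k 0 * (of_real ((cmod (a 0))\<^sup>2) * a k)) \<le> 2 * G * of_int k * W * (5 * \<delta>)"
  proof -
    have "sum ?f (high2 k) = (\<Sum>p\<in>low k \<times> low k. symb \<gamma> \<gamma>' \<Gamma> k (fst p) *
        (a (fst p) * cnj (a (snd p)) * a (k - fst p + snd p)))"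
      unfolding high2_def by (subst sum.reindex) (auto simp: inj_on_def trip_def mult_ac intro!: sum.cong)
    moreover have "cmod (symb \<gamma> \<gamma>' \<Gamma> k (fst p)) \<le> 2 * G * of_int k" if "p \<in> low k \<times> low k" for p
      unfolding G_def by (rule symb_le_lin[OF k _ refl]) (use that lowD[of "fst p"] in auto)
    moreover have "cmod (a (k - fst p + snd p)) \<le> W" if "p \<in> low k \<times> low k" for p
      using that lowD[of "fst p"] lowD[of "snd p"] by (intro W) auto
    ultimately show ?thesis
      using single_high_bound[OF k a0 d W0 _ small, where c = a and m = "\<lambda>p. symb \<gamma> \<gamma>' \<Gamma> k (fst p)"
          and C = "2 * G * of_int k"] G k by simp
  qed
  have h1: "cmod (sum ?f (high1 k) - symb \<gamma> \<gamma>' \<Gamma> k k * (of_real ((cmod (a 0))\<^sup>2) * a k)) \<le> 2 * G * of_int k * W * (5 * \<delta>)"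
  proof -
    have "sum ?f (high1 k) = (\<Sum>p\<in>low k \<times> low k. symb \<gamma> \<gamma>' \<Gamma> k (k - fst p + snd p) *
        (a (fst p) * cnj (a (snd p)) * a (k - fst p + snd p)))"
      unfolding high1_def by (subst sum.reindex) (auto simp: inj_on_def trip_def mult_ac intro!: sum.cong)
    moreover have "cmod (symb \<gamma> \<gamma>' \<Gamma> k (k - fst p + snd p)) \<le> 2 * G * of_int k" if "p \<in> low k \<times> low k" for p
      unfolding G_def by (rule symb_le_lin[OF k _ refl])
        (use that lowD[of "fst p"] lowD[of "snd p"] in \<open>auto simp: abs_if split: if_splits\<close>)
    moreover have "cmod (a (k - fst p + snd p)) \<le> W" if "p \<in> low k \<times> low k" for p
      using that lowD[of "fst p"] lowD[of "snd p"] by (intro W) auto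
    ultimately show ?thesis
      using single_high_bound[OF k a0 d W0 _ small, where c = a
          and m = "\<lambda>p. symb \<gamma> \<gamma>' \<Gamma> k (k - fst p + snd p)" and C = "2 * G * of_int k"] G k by simp
  qed
  have rest: "cmod (infsum ?f (- S)) \<le> G * (18 * 3 powr s * (3 * jb_const * M ^ 3)) * jb k powr (- s)"
  proof -
    note ms = maj_summable[OF s, of k]
    have msS: "(\<lambda>p. G * (18 * 3 powr s * jb k powr (- s) * maj s a k p)) summable_on - S"
      by (intro summable_on_cmult_right summable_on_subset_banach[OF ms(1)]) auto
    have "cmod (infsum ?f (- S)) \<le> (\<Sum>\<^sub>\<infinity>p\<in>- S. G * (18 * 3 powr s * jb k powr (- s) * maj s a k p))"
    proof (rule norm_infsum_le[OF has_sum_infsum has_sum_infsum])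
      show "?f summable_on - S" by (rule summable_on_subset_banach[OF sum_abs]) auto
      fix p assume p: "p \<in> - S"
      obtain x y where xy: "p = (x, y)" by force
      have "\<not> (x \<in> low k \<and> x + y - k \<in> low k)" "\<not> (y \<in> low k \<and> x + y - k \<in> low k)"
          "\<not> (x \<in> low k \<and> y \<in> low k)"
        using p by (auto simp: S_def xy high_iff)
      then have hi: "(\<bar>k\<bar> < 8 * \<bar>x\<bar> \<and> \<bar>k\<bar> < 8 * \<bar>y\<bar>) \<or> (\<bar>k\<bar> < 8 * \<bar>x\<bar> \<and> \<bar>k\<bar> < 8 * \<bar>x + y - k\<bar>) \<or>
          (\<bar>k\<bar> < 8 * \<bar>y\<bar> \<and> \<bar>k\<bar> < 8 * \<bar>x + y - k\<bar>)"
        using high_or_low[of x] high_or_low[of y] high_or_low[of "x + y - k"] by blast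
      have "x = fst p" "y = snd p" by (simp_all add: xy)
      from symb_trip_bound(2)[OF s(1) this refl hi]
      show "cmod (?f p) \<le> G * (18 * 3 powr s * jb k powr (- s) * maj s a k p)"
        unfolding G_def .
    qed (rule msS)
    also have "\<dots> \<le> (\<Sum>\<^sub>\<infinity>p. G * (18 * 3 powr s * jb k powr (- s) * maj s a k p))"
      using G by (intro infsum_mono2[OF msS] summable_on_cmult_right ms(1)) (auto simp: maj_nonneg)
    also have "\<dots> = G * (18 * 3 powr s * jb k powr (- s)) * (\<Sum>\<^sub>\<infinity>p. maj s a k p)"
      by (simp add: infsum_cmult_right' mult.assoc)
    also have "\<dots> \<le> G * (18 * 3 powr s * jb k powr (- s)) * (3 * jb_const * M ^ 3)"
      using G by (intro mult_left_mono ms(2)) auto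
    finally show ?thesis by (simp add: mult_ac)
  qed
  define X where "X = sum ?f (high2 k) - symb \<gamma> \<gamma>' \<Gamma> k 0 * (of_real ((cmod (a 0))\<^sup>2) * a k)"
  define Y where "Y = sum ?f (high1 k) - symb \<gamma> \<gamma>' \<Gamma> k k * (of_real ((cmod (a 0))\<^sup>2) * a k)"
  define Z where "Z = infsum ?f (- S)"
  have "nonlin \<gamma> \<gamma>' \<Gamma> a k
      - of_real (1 / (2 * pi)) * of_real ((cmod (a 0))\<^sup>2) * (symb \<gamma> \<gamma>' \<Gamma> k 0 + symb \<gamma> \<gamma>' \<Gamma> k k) * a k
      - of_real (1 / (2 * pi)) * sum ?f (low k \<times> low k) = of_real (1 / (2 * pi)) * (X + Y + Z)"
    unfolding nonlin_def split X_def Y_def Z_def by (simp only: algebra_simps)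
  moreover have "cmod (of_real (1 / (2 * pi)) * (X + Y + Z)) \<le> 1 / (2 * pi) * (cmod X + cmod Y + cmod Z)"
    unfolding norm_mult norm_of_real
    by (intro mult_mono) (auto intro: order_trans[OF norm_triangle_ineq add_right_mono[OF norm_triangle_ineq]])
  moreover have "1 / (2 * pi) * (cmod X + cmod Y + cmod Z) \<le> 1 / (2 * pi) * (20 * G * of_int k * W * \<delta>
        + G * (18 * 3 powr s * (3 * jb_const * M ^ 3)) * jb k powr (- s))"
    using h1 h2 rest unfolding X_def[symmetric] Y_def[symmetric] Z_def[symmetric]
    by (intro mult_left_mono) auto
  ultimately show ?thesis by simp
qed

section \<open>Decay of the positive frequencies\<close>

text \<open>Where |z| exceeds w, the difference |z|^2 - w^2 is nondecreasing: the growth rate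
  \<open>c\<close> of z outweighs the forcing and the growth of w, which are each allowed
  \<open>c / 2\<close>. An excess at some time would hence persist up to T, against the terminal
  condition. In other words, growth forwards in time is used as damping from T backwards.\<close>

lemma barrier:
  fixes z lam E :: "real \<Rightarrow> complex" and w w' :: "real \<Rightarrow> real"
  assumes z: "\<And>t. t \<in> {0..T} \<Longrightarrow> (z has_vector_derivative (lam t * z t + E t)) (at t within {0..T})"
    and w: "\<And>t. t \<in> {0..T} \<Longrightarrow> (w has_real_derivative w' t) (at t within {0..T})"
    and w0: "\<And>t. t \<in> {0..T} \<Longrightarrow> 0 < w t"
    and lam: "\<And>t. t \<in> {0..T} \<Longrightarrow> c \<le> Re (lam t)" and c: "0 \<le> c"
    and w': "\<And>t. t \<in> {0..T} \<Longrightarrow> w' t \<le> c / 2 * w t"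
    and E: "\<And>t. t \<in> {0..T} \<Longrightarrow> cmod (E t) \<le> c / 2 * w t"
    and T: "cmod (z T) \<le> w T"
    and t: "t \<in> {0..T}"
  shows "cmod (z t) \<le> w t"
proof (rule ccontr)
  assume neg: "\<not> cmod (z t) \<le> w t"
  define h where "h \<tau> = (cmod (z \<tau>))\<^sup>2 - (w \<tau>)\<^sup>2" for \<tau>
  define h' where "h' \<tau> = 2 * Re (cnj (z \<tau>) * (lam \<tau> * z \<tau> + E \<tau>)) - 2 * w \<tau> * w' \<tau>" for \<tau>
  have dh: "(h has_real_derivative h' \<tau>) (at \<tau> within {0..T})" if "\<tau> \<in> {0..T}" for \<tau>
  proof -
    note zR = bounded_linear.has_vector_derivative[OF bounded_linear_Re z[OF that], folded has_real_derivative_iff_has_vector_derivative]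
    note zI = bounded_linear.has_vector_derivative[OF bounded_linear_Im z[OF that], folded has_real_derivative_iff_has_vector_derivative]
    show ?thesis
      unfolding h_def h'_def cmod_power2
      by (rule derivative_eq_intros zR zI w[OF that] refl)+ (simp add: algebra_simps power2_eq_square)
  qed
  have h_pos: "0 < h \<tau> \<longleftrightarrow> w \<tau> < cmod (z \<tau>)" if "\<tau> \<in> {0..T}" for \<tau>
    using w0[OF that] power2_less_imp_less[of "w \<tau>" "cmod (z \<tau>)"] power_strict_mono[of "w \<tau>" "cmod (z \<tau>)" 2]
    by (auto simp: h_def)
  have h'_nonneg: "0 \<le> h' \<tau>" if \<tau>: "\<tau> \<in> {0..T}" and "0 < h \<tau>" for \<tau>
  proof -
    define r where "r = cmod (z \<tau>)"
    have r: "w \<tau> \<le> r" using h_pos[OF \<tau>] that by (simp add: r_def)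
    have wp: "0 < w \<tau>" by (rule w0[OF \<tau>])
    have "Re (cnj (z \<tau>) * (lam \<tau> * z \<tau> + E \<tau>)) = Re (lam \<tau>) * r\<^sup>2 + Re (cnj (z \<tau>) * E \<tau>)"
      unfolding r_def cmod_power2 by (simp add: algebra_simps power2_eq_square)
    moreover have "c * r\<^sup>2 \<le> Re (lam \<tau>) * r\<^sup>2" using lam[OF \<tau>] by (intro mult_right_mono) auto
    moreover have "- (r * (c / 2 * w \<tau>)) \<le> Re (cnj (z \<tau>) * E \<tau>)"
    proof -
      have "\<bar>Re (cnj (z \<tau>) * E \<tau>)\<bar> \<le> r * cmod (E \<tau>)"
        using abs_Re_le_cmod[of "cnj (z \<tau>) * E \<tau>"] by (simp add: norm_mult r_def)
      also have "\<dots> \<le> r * (c / 2 * w \<tau>)" using E[OF \<tau>] by (intro mult_left_mono) (auto simp: r_def)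
      finally show ?thesis by linarith
    qed
    moreover have "w \<tau> * w' \<tau> \<le> w \<tau> * (c / 2 * w \<tau>)" using w'[OF \<tau>] wp by (intro mult_left_mono) auto
    ultimately have "2 * (c * r\<^sup>2) - 2 * (r * (c / 2 * w \<tau>)) - 2 * (w \<tau> * (c / 2 * w \<tau>)) \<le> h' \<tau>"
      unfolding h'_def by linarith
    moreover have "0 \<le> c * ((r - w \<tau>) * r + (r\<^sup>2 - (w \<tau>)\<^sup>2))"
      using c r wp power_mono[of "w \<tau>" r 2] by (intro mult_nonneg_nonneg add_nonneg_nonneg) auto
    ultimately show ?thesis by (simp add: algebra_simps power2_eq_square)
  qed
  have cont: "continuous_on {0..T} h"
    using dh by (meson DERIV_continuous continuous_on_eq_continuous_within)
  \<comment> \<open>\<open>Inf S\<close> is the first time after t at which the excess is gone; h is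
    positive before it and therefore cannot decrease to a value that is at most 0.\<close>
  define S where "S = {\<tau> \<in> {t..T}. h \<tau> \<le> 0}"
  have Sne: "T \<in> S" using t T power_mono[OF T, of 2] by (auto simp: S_def h_def)
  have "closed S"
    unfolding S_def using t by (intro continuous_on_closed_Collect_le continuous_on_subset[OF cont]) auto
  moreover have bb: "bdd_below S" by (auto simp: S_def)
  ultimately have \<sigma>: "Inf S \<in> S" using Sne by (intro closed_contains_Inf) auto
  define \<sigma> where "\<sigma> = Inf S"
  have ht: "0 < h t" using neg h_pos[OF t] by simp
  have \<sigma>S: "h \<sigma> \<le> 0" "t \<le> \<sigma>" "\<sigma> \<le> T" using \<sigma> by (auto simp: S_def \<sigma>_def)
  have "t < \<sigma>" using \<sigma>S ht by (cases "t = \<sigma>") auto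
  moreover have "0 < h \<tau>" if "t < \<tau>" "\<tau> < \<sigma>" for \<tau>
  proof (rule ccontr)
    assume "\<not> 0 < h \<tau>"
    then have "\<tau> \<in> S" using that \<sigma>S by (auto simp: S_def)
    then show False using cInf_lower[OF _ bb] that by (force simp: \<sigma>_def)
  qed
  ultimately have "h t \<le> h \<sigma>"
  proof (intro DERIV_nonneg_imp_increasing_open[of t \<sigma> h])
    fix \<tau> assume \<tau>: "t < \<tau>" "\<tau> < \<sigma>" and pos: "\<And>\<tau>. t < \<tau> \<Longrightarrow> \<tau> < \<sigma> \<Longrightarrow> 0 < h \<tau>"
    have "\<tau> \<in> {0..T}" "\<tau> \<in> interior {0..T}" using \<tau> t \<sigma>S by auto
    then show "\<exists>y. (h has_real_derivative y) (at \<tau>) \<and> 0 \<le> y"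
      using dh[of \<tau>] h'_nonneg[of \<tau>] pos[OF \<tau>] by (metis at_within_interior)
  qed (use t \<sigma>S in \<open>auto intro: continuous_on_subset[OF cont]\<close>)
  then show False using ht \<sigma>S by simp
qed

text \<open>The denominator contains the resonance function
  \<open>2 (k - k\<^sub>1) (k - k\<^sub>2) = k\<^sup>2 - k\<^sub>1\<^sup>2 - k\<^sub>2\<^sup>2 + k\<^sub>3\<^sup>2\<close>.\<close>
definition nf_coeff :: "real \<Rightarrow> real \<Rightarrow> real \<Rightarrow> real \<Rightarrow> int \<Rightarrow> int \<times> int \<Rightarrow> complex" where
  "nf_coeff \<alpha> \<gamma> \<gamma>' \<Gamma> k p = \<i> * of_real (1 / (2 * pi)) * symb \<gamma> \<gamma>' \<Gamma> k (fst p)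
      / (of_real \<alpha> * of_int (2 * (k - fst p) * (k - snd p)))"

text \<open>The Leibniz rule for \<open>trip\<close>. Because \<open>b\<close> is a separate
  argument, it may stand for the whole right-hand side of the equation or for its nonlinear part
  alone.\<close>

definition trip_deriv :: "(int \<Rightarrow> complex) \<Rightarrow> (int \<Rightarrow> complex) \<Rightarrow> int \<Rightarrow> int \<times> int \<Rightarrow> complex" where
  "trip_deriv a b k p = b (fst p) * a (snd p) * cnj (a (fst p + snd p - k))
      + a (fst p) * b (snd p) * cnj (a (fst p + snd p - k))
      + a (fst p) * a (snd p) * cnj (b (fst p + snd p - k))"

lemma low_distance:
  assumes "0 < k" "p \<in> low k \<times> low k"
  shows "7 * k \<le> 8 * (k - fst p)" "7 * k \<le> 8 * (k - snd p)" "k \<le> 2 * \<bar>fst p + snd p - k\<bar>"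
proof -
  have "8 * \<bar>fst p\<bar> \<le> k" "8 * \<bar>snd p\<bar> \<le> k" using assms by (auto simp: low_iff)
  then have "8 * fst p \<le> k" "8 * snd p \<le> k" 
    using abs_ge_self[of "fst p"] abs_ge_self[of "snd p"] by simp_all
  then show "7 * k \<le> 8 * (k - fst p)" "7 * k \<le> 8 * (k - snd p)" "k \<le> 2 * \<bar>fst p + snd p - k\<bar>"
    using assms(1) by simp_all
qed

text \<open>The symbol is of size k, while the resonance function is at least k^2: both differences
  are at least 7k/8, and 2 * (7/8)^2 > 1. The net gain is one power of k.\<close>

lemma nf_coeff_bound:
  assumes k: "0 < k" and p: "p \<in> low k \<times> low k" and \<alpha>: "\<alpha> \<noteq> 0"
  shows "cmod (nf_coeff \<alpha> \<gamma> \<gamma>' \<Gamma> k p) \<le> 2 * (\<bar>\<gamma>\<bar> + \<bar>\<gamma>'\<bar> + \<bar>\<Gamma>\<bar>) / \<bar>\<alpha>\<bar> / of_int k"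
proof -
  define G where "G = \<bar>\<gamma>\<bar> + \<bar>\<gamma>'\<bar> + \<bar>\<Gamma>\<bar>"
  have G: "0 \<le> G" by (simp add: G_def)
  note ld = low_distance[OF k p]
  have r: "7 * real_of_int k \<le> 8 * (of_int k - of_int (fst p))" "7 * real_of_int k \<le> 8 * (of_int k - of_int (snd p))"
    using ld(1,2)[THEN of_int_le_iff[where 'a = real, THEN iffD2]] by simp_all
  have k': "0 < real_of_int k" using k by simp
  have "(7 / 8 * real_of_int k) * (7 / 8 * real_of_int k) \<le> (of_int k - of_int (fst p)) * (of_int k - of_int (snd p))"
    using r k' by (intro mult_mono) auto
  moreover have "(real_of_int k)\<^sup>2 \<le> 2 * ((7 / 8 * real_of_int k) * (7 / 8 * real_of_int k))"
    by (simp add: power2_eq_square)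
  ultimately have "(real_of_int k)\<^sup>2 \<le> 2 * ((of_int k - of_int (fst p)) * (of_int k - of_int (snd p)))" by linarith
  then have Phi: "(real_of_int k)\<^sup>2 \<le> real_of_int (2 * (k - fst p) * (k - snd p))"
    by (simp only: of_int_mult of_int_diff of_int_numeral mult.assoc)
  have s: "cmod (symb \<gamma> \<gamma>' \<Gamma> k (fst p)) \<le> 2 * G * of_int k"
    unfolding G_def using p low_iff[OF k, of "fst p"]
    by (intro symb_le_lin[OF k _ refl]) (auto simp: abs_if split: if_splits)
  have "cmod (nf_coeff \<alpha> \<gamma> \<gamma>' \<Gamma> k p) = (1 / (2 * pi)) * cmod (symb \<gamma> \<gamma>' \<Gamma> k (fst p))
      / (\<bar>\<alpha>\<bar> * \<bar>of_int (2 * (k - fst p) * (k - snd p))\<bar>)"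
    unfolding nf_coeff_def norm_divide norm_mult norm_of_real norm_of_int by simp
  also have "\<dots> \<le> 1 * (2 * G * of_int k) / (\<bar>\<alpha>\<bar> * (real_of_int k)\<^sup>2)"
    using s G k' \<alpha> Phi pi_gt3 by (intro frac_le mult_mono) auto
  also have "\<dots> = 2 * G / \<bar>\<alpha>\<bar> / of_int k" using k' \<alpha> by (simp add: field_simps power2_eq_square)
  finally show ?thesis by (simp add: G_def)
qed

lemma jb_powr_le:
  assumes "0 < k" "k \<le> 2 * \<bar>j\<bar>" "0 \<le> s"
  shows "jb j powr (- s) \<le> 2 powr s * real_of_int k powr (- s)"
proof -
  have "real_of_int k \<le> real_of_int (2 * \<bar>j\<bar>)" using assms by (subst of_int_le_iff)
  then have "real_of_int k / 2 \<le> jb j" by (simp add: japanese_bracket_def)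
  then have "jb j powr (- s) \<le> (real_of_int k / 2) powr (- s)"
    using assms by (intro powr_mono2') auto
  also have "\<dots> = 2 powr s * real_of_int k powr (- s)"
    using assms by (simp add: powr_divide powr_minus field_simps)
  finally show ?thesis .
qed

lemma trip_sum_bound:
  fixes u v w :: "int \<Rightarrow> complex" and b :: "int \<times> int \<Rightarrow> complex"
  assumes "\<And>p. p \<in> low k \<times> low k \<Longrightarrow> cmod (b p) \<le> B" and "\<And>p. p \<in> low k \<times> low k \<Longrightarrow> cmod (w (fst p + snd p - k)) \<le> W"
    and "(\<Sum>j\<in>low k. cmod (u j)) \<le> U" "(\<Sum>j\<in>low k. cmod (v j)) \<le> V" and "0 \<le> B" "0 \<le> W"
  shows "cmod (\<Sum>p\<in>low k \<times> low k. b p * (u (fst p) * v (snd p) * w (fst p + snd p - k))) \<le> B * W * (U * V)"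
proof -
  have "cmod (\<Sum>p\<in>low k \<times> low k. b p * (u (fst p) * v (snd p) * w (fst p + snd p - k)))
      \<le> (\<Sum>p\<in>low k \<times> low k. B * W * (cmod (u (fst p)) * cmod (v (snd p))))"
  proof (rule sum_norm_le)
    fix p assume p: "p \<in> low k \<times> low k"
    have "cmod (b p * (u (fst p) * v (snd p) * w (fst p + snd p - k))) =
      (cmod (b p) * cmod (w (fst p + snd p - k))) * (cmod (u (fst p)) * cmod (v (snd p)))"
      by (simp add: norm_mult mult_ac)
    also have "\<dots> \<le> (B * W) * (cmod (u (fst p)) * cmod (v (snd p)))"
      using p assms by (intro mult_right_mono mult_mono) auto
    finally show "cmod (b p * (u (fst p) * v (snd p) * w (fst p + snd p - k))) \<le> B * W * (cmod (u (fst p)) * cmod (v (snd p)))" .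
  qed
  also have "\<dots> = B * W * ((\<Sum>j\<in>low k. cmod (u j)) * (\<Sum>j\<in>low k. cmod (v j)))"
  proof -
    have "(\<Sum>p\<in>low k \<times> low k. cmod (u (fst p)) * cmod (v (snd p))) =
        (\<Sum>j\<in>low k. cmod (u j)) * (\<Sum>j\<in>low k. cmod (v j))"
      by (simp add: sum_product sum.cartesian_product case_prod_beta)
    then show ?thesis by (simp only: sum_distrib_left[symmetric])
  qed
  also have "\<dots> \<le> B * W * (U * V)"
    using assms by (intro mult_left_mono mult_mono) (auto intro!: sum_nonneg order_trans[OF sum_nonneg assms(3)])
  finally show ?thesis .
qed

text \<open>The gain 1/k of \<open>nf_coeff\<close> multiplies a high conjugated factor of size
  k^(-s). In the second bound the nonlinearity replaces either a low factor, where a uniform bound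
  is summed over at most 2k low frequencies, or the high factor, where it costs one derivative. In
  both cases precisely the power gained is spent.\<close>

lemma normal_form_bounds:
  fixes \<alpha> \<gamma> \<gamma>' \<Gamma> s M :: real
  assumes s: "1 \<le> s" and \<alpha>: "\<alpha> \<noteq> 0" and M: "0 \<le> M"
  obtains C where "0 \<le> C"
    "\<And>a k. weighted_l2 s a \<Longrightarrow> weighted_l2_norm s a \<le> M \<Longrightarrow> 0 < k \<Longrightarrow>
      cmod (\<Sum>p\<in>low k \<times> low k. nf_coeff \<alpha> \<gamma> \<gamma>' \<Gamma> k p * trip a k p) \<le> C * of_int k powr (- s) / of_int k"
    "\<And>a k. weighted_l2 s a \<Longrightarrow> weighted_l2_norm s a \<le> M \<Longrightarrow> 0 < k \<Longrightarrow>
      cmod (\<Sum>p\<in>low k \<times> low k. nf_coeff \<alpha> \<gamma> \<gamma>' \<Gamma> k p * trip_deriv a (nonlin \<gamma> \<gamma>' \<Gamma> a) k p)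
      \<le> C * of_int k powr (- s)"
proof -
  define B where "B = 2 * (\<bar>\<gamma>\<bar> + \<bar>\<gamma>'\<bar> + \<bar>\<Gamma>\<bar>) / \<bar>\<alpha>\<bar>"
  define L where "L = jb_const * M"
  define N where "N = (\<bar>\<gamma>\<bar> + \<bar>\<gamma>'\<bar> + \<bar>\<Gamma>\<bar>) * (4 * 3 powr s * (3 * jb_const * M ^ 3))"
  define C1 where "C1 = B * (M * 2 powr s) * (L * L)"
  define C2 where "C2 = 2 * (B * (M * 2 powr s) * (2 * N * L)) + B * (N * 2 powr s) * (L * L)"
  have nn: "0 \<le> B" "0 \<le> L" "0 \<le> N" using M by (auto simp: B_def L_def N_def)
  have C: "0 \<le> C1" "0 \<le> C2" using nn M by (auto simp: C1_def C2_def)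
  have both: "cmod (\<Sum>p\<in>low k \<times> low k. nf_coeff \<alpha> \<gamma> \<gamma>' \<Gamma> k p * trip a k p) \<le> C1 * of_int k powr (- s) / of_int k"
    "cmod (\<Sum>p\<in>low k \<times> low k. nf_coeff \<alpha> \<gamma> \<gamma>' \<Gamma> k p * trip_deriv a (nonlin \<gamma> \<gamma>' \<Gamma> a) k p) \<le> C2 * of_int k powr (- s)"
    if a: "weighted_l2 s a" "weighted_l2_norm s a \<le> M" and k: "0 < k" for a k
  proof -
    define b where "b = nf_coeff \<alpha> \<gamma> \<gamma>' \<Gamma> k"
    define \<kappa> where "\<kappa> = real_of_int k"
    have \<kappa>: "1 \<le> \<kappa>" using k by (simp add: \<kappa>_def)
    have b: "cmod (b p) \<le> B / \<kappa>" if "p \<in> low k \<times> low k" for p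
      using nf_coeff_bound[OF k that \<alpha>] by (simp add: b_def B_def \<kappa>_def)
    have aj: "cmod (a j) \<le> M * jb j powr (- s)" for j
    proof -
      have "0 < jb j powr s" by simp
      then show ?thesis using order_trans[OF weighted_l2_pointwise[OF a(1), of j] a(2)]
        by (simp add: powr_minus_divide pos_le_divide_eq mult.commute)
    qed
    have az: "cmod (a (fst p + snd p - k)) \<le> M * 2 powr s * \<kappa> powr (- s)" if "p \<in> low k \<times> low k" for p
    proof -
      have "M * jb (fst p + snd p - k) powr (- s) \<le> M * (2 powr s * \<kappa> powr (- s))"
        unfolding \<kappa>_def using s M by (intro mult_left_mono jb_powr_le[OF k low_distance(3)[OF k that]]) auto
      then show ?thesis using aj[of "fst p + snd p - k"] by (simp add: mult.assoc)
    qed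
    have Nj: "cmod (nonlin \<gamma> \<gamma>' \<Gamma> a j) \<le> N * jb j powr (- (s - 1))" for j
      using nonlin_bound[OF s a, of \<gamma> \<gamma>' \<Gamma> j] by (simp add: N_def)
    have Nj1: "cmod (nonlin \<gamma> \<gamma>' \<Gamma> a j) \<le> N" for j
    proof -
      have "jb j powr (- (s - 1)) \<le> jb j powr 0" using s by (intro powr_mono) auto
      then have "N * jb j powr (- (s - 1)) \<le> N * 1" using nn by (intro mult_left_mono) auto
      then show ?thesis using Nj[of j] by simp
    qed
    have Nz: "cmod (nonlin \<gamma> \<gamma>' \<Gamma> a (fst p + snd p - k)) \<le> N * 2 powr s * (\<kappa> * \<kappa> powr (- s))" if "p \<in> low k \<times> low k" for p
    proof -
      have "jb (fst p + snd p - k) powr (- (s - 1)) \<le> 2 powr (s - 1) * \<kappa> powr (- (s - 1))"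
        unfolding \<kappa>_def using s by (intro jb_powr_le[OF k low_distance(3)[OF k that]]) auto
      also have "\<dots> \<le> 2 powr s * (\<kappa> powr 1 * \<kappa> powr (- s))"
        unfolding powr_add[symmetric] using \<kappa> by (intro mult_mono powr_mono) auto
      finally have "N * jb (fst p + snd p - k) powr (- (s - 1)) \<le> N * (2 powr s * (\<kappa> powr 1 * \<kappa> powr (- s)))"
        using nn by (intro mult_left_mono)
      then show ?thesis using Nj[of "fst p + snd p - k"] \<kappa> by (simp add: mult.assoc)
    qed
    have aL: "(\<Sum>j\<in>low k. cmod (a j)) \<le> L"
    proof -
      have "(\<Sum>j\<in>low k. cmod (a j)) \<le> (\<Sum>\<^sub>\<infinity>j. cmod (a j))"
        by (intro finite_sum_le_infsum weighted_l2_imp_l1(1)[OF s a(1)]) auto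
      also have "\<dots> \<le> L" unfolding L_def
        by (rule order_trans[OF weighted_l2_imp_l1(2)[OF s a(1)] mult_left_mono[OF a(2)]]) simp
      finally show ?thesis .
    qed
    have NL: "(\<Sum>j\<in>low k. cmod (nonlin \<gamma> \<gamma>' \<Gamma> a j)) \<le> 2 * N * \<kappa>"
    proof -
      have "(\<Sum>j\<in>low k. cmod (nonlin \<gamma> \<gamma>' \<Gamma> a j)) \<le> of_nat (card (low k)) * N"
        by (rule sum_bounded_above) (rule Nj1)
      also have "real (card (low k)) \<le> 2 * \<kappa>"
      proof -
        have "int (card (low k)) \<le> 2 * k" using k by (simp add: low_def)
        then have "real_of_int (int (card (low k))) \<le> real_of_int (2 * k)" by (subst of_int_le_iff)
        then show ?thesis by (simp add: \<kappa>_def)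
      qed
      finally show ?thesis using nn by (simp add: mult_right_mono mult_ac)
    qed
    have B0: "0 \<le> B / \<kappa>" using nn \<kappa> by simp
    have "cmod (\<Sum>p\<in>low k \<times> low k. b p * trip a k p) \<le> B / \<kappa> * (M * 2 powr s * \<kappa> powr (- s)) * (L * L)"
      unfolding trip_def
      by (rule trip_sum_bound[where w = "\<lambda>j. cnj (a j)"]) (use b az aL B0 M in auto)
    also have "\<dots> = C1 * \<kappa> powr (- s) / \<kappa>" by (simp add: C1_def)
    finally show "cmod (\<Sum>p\<in>low k \<times> low k. nf_coeff \<alpha> \<gamma> \<gamma>' \<Gamma> k p * trip a k p) \<le> C1 * of_int k powr (- s) / of_int k"
      by (simp add: b_def \<kappa>_def)
    define n where "n = nonlin \<gamma> \<gamma>' \<Gamma> a"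
    define X where "X = (\<Sum>p\<in>low k \<times> low k. b p * (n (fst p) * a (snd p) * cnj (a (fst p + snd p - k))))"
    define Y where "Y = (\<Sum>p\<in>low k \<times> low k. b p * (a (fst p) * n (snd p) * cnj (a (fst p + snd p - k))))"
    define Z where "Z = (\<Sum>p\<in>low k \<times> low k. b p * (a (fst p) * a (snd p) * cnj (n (fst p + snd p - k))))"
    have "cmod X \<le> B / \<kappa> * (M * 2 powr s * \<kappa> powr (- s)) * ((2 * N * \<kappa>) * L)"
      unfolding X_def by (rule trip_sum_bound[where w = "\<lambda>j. cnj (a j)"]) (use b az aL B0 M NL in \<open>auto simp: n_def\<close>)
    moreover have "cmod Y \<le> B / \<kappa> * (M * 2 powr s * \<kappa> powr (- s)) * (L * (2 * N * \<kappa>))"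
      unfolding Y_def by (rule trip_sum_bound[where w = "\<lambda>j. cnj (a j)"]) (use b az aL B0 M NL in \<open>auto simp: n_def\<close>)
    moreover have "cmod Z \<le> B / \<kappa> * (N * 2 powr s * (\<kappa> * \<kappa> powr (- s))) * (L * L)"
      unfolding Z_def by (rule trip_sum_bound[where w = "\<lambda>j. cnj (n j)"]) (use b Nz aL B0 nn \<kappa> in \<open>auto simp: n_def\<close>)
    moreover have "cmod (X + Y + Z) \<le> cmod X + cmod Y + cmod Z"
      by (rule order_trans[OF norm_triangle_ineq add_right_mono[OF norm_triangle_ineq]])
    moreover have "B / \<kappa> * (M * 2 powr s * \<kappa> powr (- s)) * ((2 * N * \<kappa>) * L) = B * (M * 2 powr s) * (2 * N * L) * \<kappa> powr (- s)"
      "B / \<kappa> * (M * 2 powr s * \<kappa> powr (- s)) * (L * (2 * N * \<kappa>)) = B * (M * 2 powr s) * (2 * N * L) * \<kappa> powr (- s)"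
      "B / \<kappa> * (N * 2 powr s * (\<kappa> * \<kappa> powr (- s))) * (L * L) = B * (N * 2 powr s) * (L * L) * \<kappa> powr (- s)"
      using \<kappa> by simp_all
    moreover have "C2 * \<kappa> powr (- s) = B * (M * 2 powr s) * (2 * N * L) * \<kappa> powr (- s)
       + B * (M * 2 powr s) * (2 * N * L) * \<kappa> powr (- s) + B * (N * 2 powr s) * (L * L) * \<kappa> powr (- s)"
      unfolding C2_def by (simp only: distrib_right mult_2)
    ultimately have "cmod (X + Y + Z) \<le> C2 * \<kappa> powr (- s)" by linarith
    moreover have "(\<Sum>p\<in>low k \<times> low k. b p * trip_deriv a n k p) = X + Y + Z"
      by (simp add: X_def Y_def Z_def trip_deriv_def distrib_left sum.distrib)
    ultimately show "cmod (\<Sum>p\<in>low k \<times> low k. nf_coeff \<alpha> \<gamma> \<gamma>' \<Gamma> k p * trip_deriv a (nonlin \<gamma> \<gamma>' \<Gamma> a) k p) \<le> C2 * of_int k powr (- s)"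
      unfolding b_def[symmetric] n_def[symmetric] \<kappa>_def[symmetric] by simp
  qed
  show ?thesis
  proof (rule that[of "C1 + C2"])
    fix a k assume a: "weighted_l2 s a" "weighted_l2_norm s a \<le> M" and k: "0 < (k::int)"
    have "C1 * of_int k powr (- s) / of_int k \<le> (C1 + C2) * of_int k powr (- s) / of_int k"
      "C2 * of_int k powr (- s) \<le> (C1 + C2) * of_int k powr (- s)"
      using C k by (intro divide_right_mono mult_right_mono; simp)+
    then show "cmod (\<Sum>p\<in>low k \<times> low k. nf_coeff \<alpha> \<gamma> \<gamma>' \<Gamma> k p * trip a k p) \<le> (C1 + C2) * of_int k powr (- s) / of_int k"
      "cmod (\<Sum>p\<in>low k \<times> low k. nf_coeff \<alpha> \<gamma> \<gamma>' \<Gamma> k p * trip_deriv a (nonlin \<gamma> \<gamma>' \<Gamma> a) k p) \<le> (C1 + C2) * of_int k powr (- s)"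
      using both[OF a k] by linarith+
  qed (use C in simp)
qed

lemma trip_derivative:
  fixes a :: "real \<Rightarrow> int \<Rightarrow> complex"
  assumes "\<And>k. ((\<lambda>t. a t k) has_vector_derivative b k) (at t within S)"
  shows "((\<lambda>t. trip (a t) k p) has_vector_derivative trip_deriv (a t) b k p) (at t within S)"
proof -
  have c: "((\<lambda>t. cnj (a t j)) has_vector_derivative cnj (b j)) (at t within S)" for j
    by (rule bounded_linear.has_vector_derivative[OF bounded_linear_cnj assms])
  show ?thesis
    unfolding trip_def
    by (rule has_vector_derivative_eq_rhs[OF has_vector_derivative_mult[OF has_vector_derivative_mult[OF assms assms] c]])
       (simp add: trip_deriv_def algebra_simps)
qed

text \<open>The correction term is chosen so that its time derivative cancels the contribution of the
  triples in which only the conjugated frequency is high.\<close>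
lemma nf_coeff_cancels:
  assumes "0 < k" "p \<in> low k \<times> low k" "\<alpha> \<noteq> 0"
  shows "nf_coeff \<alpha> \<gamma> \<gamma>' \<Gamma> k p * trip_deriv a (\<lambda>j. - \<i> * of_real \<alpha> * (of_int j)\<^sup>2 * a j + n j) k p
    = - \<i> * of_real \<alpha> * (of_int k)\<^sup>2 * (nf_coeff \<alpha> \<gamma> \<gamma>' \<Gamma> k p * trip a k p)
      - of_real (1 / (2 * pi)) * (symb \<gamma> \<gamma>' \<Gamma> k (fst p) * trip a k p)
      + nf_coeff \<alpha> \<gamma> \<gamma>' \<Gamma> k p * trip_deriv a n k p"
proof -
  obtain x y where p: "p = (x, y)" by force
  define b where "b = nf_coeff \<alpha> \<gamma> \<gamma>' \<Gamma> k p"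
  define \<Phi> :: complex where "\<Phi> = of_int (2 * (k - x) * (k - y))"
  have "k - x \<noteq> 0" "k - y \<noteq> 0" using low_distance(1,2)[OF assms(1,2)] assms(1) by (auto simp: p)
  then have "of_real \<alpha> * \<Phi> \<noteq> 0" using assms(3) by (simp add: \<Phi>_def flip: of_int_diff)
  moreover have "b = \<i> * of_real (1 / (2 * pi)) * symb \<gamma> \<gamma>' \<Gamma> k x / (of_real \<alpha> * \<Phi>)"
    by (simp only: b_def nf_coeff_def p \<Phi>_def fst_conv snd_conv)
  ultimately have 1: "b * (\<i> * (of_real \<alpha> * \<Phi>)) = - of_real (1 / (2 * pi)) * symb \<gamma> \<gamma>' \<Gamma> k x"
    by (simp add: mult_ac)
  have 2: "\<Phi> = (of_int k)\<^sup>2 - (of_int x)\<^sup>2 - (of_int y)\<^sup>2 + (of_int (x + y - k))\<^sup>2"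
    by (simp add: \<Phi>_def algebra_simps power2_eq_square)
  have "b * trip_deriv a (\<lambda>j. - \<i> * of_real \<alpha> * (of_int j)\<^sup>2 * a j + n j) k p
    = - \<i> * of_real \<alpha> * (of_int k)\<^sup>2 * (b * trip a k p) + (b * (\<i> * (of_real \<alpha> * \<Phi>))) * trip a k p
      + b * trip_deriv a n k p"
    unfolding 2 by (simp add: p trip_deriv_def trip_def) (simp add: algebra_simps)
  then show ?thesis
    unfolding 1 by (simp add: b_def p)
qed

text \<open>Meant for the barrier of the next lemma, with \<open>C\<close> the power of the
  frequency, \<open>c\<close> proportional to the frequency, \<open>B\<close> its reciprocal and
  \<open>e\<close> the parameter \<epsilon> of the bootstrap. The profile 1 / (1 + c (T - t)) solves
  y' = c y^2.\<close>

lemma weight_derivative: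
  fixes C A c T B e t :: real
  assumes "1 + c * (T - t) \<noteq> 0"
  shows "((\<lambda>t. C * (A * (1 / (1 + c * (T - t)) + B) + e) / 2) has_real_derivative
    C * (A * (c / (1 + c * (T - t))\<^sup>2)) / 2) (at t within S)"
proof -
  have "((\<lambda>t. 1 / (1 + c * (T - t))) has_real_derivative c / (1 + c * (T - t))\<^sup>2) (at t within S)"
    using assms by (auto intro!: derivative_eq_intros simp: power2_eq_square)
  note d = DERIV_cdivide[OF DERIV_cmult[OF DERIV_add[OF DERIV_cmult[OF DERIV_add[OF this DERIV_const]] DERIV_const]]]
  show ?thesis by (rule DERIV_cong[OF d]) simp
qed

text \<open>The forcing of mode k contains modes near k, which are at first controlled by the a
  priori bound only; hence an iteration. The assumed bound is k^(-s) (A g + \<epsilon>). The damping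
  gives half of it for the corrected mode \<open>z = a + Z\<close>. Removing \<open>Z\<close>, which
  is at most half of the part with A g, restores A g in full but leaves \<epsilon> / 2. In the limit
  \<epsilon> disappears, and at time 0 the profile \<open>g\<close> is of order 1/k.\<close>

lemma positive_frequency_decay:
  fixes a :: "real \<Rightarrow> int \<Rightarrow> complex" and \<alpha> \<gamma> \<gamma>' \<Gamma> s \<delta> M T :: real
  assumes \<alpha>: "\<alpha> \<noteq> 0" and \<Gamma>: "0 < \<Gamma>" and s: "1 \<le> s" and T: "0 < T"
    and wl: "\<And>t. t \<in> {0..T} \<Longrightarrow> weighted_l2 s (a t)" "\<And>t. t \<in> {0..T} \<Longrightarrow> weighted_l2_norm s (a t) \<le> M"
    and der: "\<And>t k. t \<in> {0..T} \<Longrightarrow> ((\<lambda>t. a t k) has_vector_derivative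
        (- \<i> * of_real \<alpha> * (of_int k)\<^sup>2 * a t k + nonlin \<gamma> \<gamma>' \<Gamma> (a t) k)) (at t within {0..T})"
    and a0: "\<And>t. t \<in> {0..T} \<Longrightarrow> 1 / 2 \<le> cmod (a t 0)" "\<And>t. t \<in> {0..T} \<Longrightarrow> cmod (a t 0) \<le> 2"
    and \<delta>: "0 \<le> \<delta>" "\<delta> \<le> 1" "\<delta> * (640 * (\<bar>\<gamma>\<bar> + \<bar>\<gamma>'\<bar> + \<bar>\<Gamma>\<bar>) * 2 powr (s + 1)) \<le> \<Gamma>"
    and small: "\<And>t F. t \<in> {0..T} \<Longrightarrow> finite F \<Longrightarrow> 0 \<notin> F \<Longrightarrow> (\<Sum>j\<in>F. cmod (a t j)) \<le> \<delta>"
  shows "\<exists>C. \<forall>k>0. cmod (a 0 k) \<le> C * of_int k powr (- s - 1)"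
proof -
  define G where "G = \<bar>\<gamma>\<bar> + \<bar>\<gamma>'\<bar> + \<bar>\<Gamma>\<bar>"
  \<comment> \<open>Not the circle constant but the prefactor of \<open>nonlin\<close>.\<close>
  define \<pi> where "\<pi> = 1 / (2 * pi)"
  have G: "0 \<le> G" by (simp add: G_def)
  have \<pi>: "0 < \<pi>" "\<pi> \<le> 1" using pi_gt3 by (auto simp: \<pi>_def)
  have M: "0 \<le> M" using wl(2)[of 0] T by (auto intro: order_trans[OF weighted_l2_norm_nonneg])
  obtain CZ where CZ: "0 \<le> CZ"
    "\<And>a k. weighted_l2 s a \<Longrightarrow> weighted_l2_norm s a \<le> M \<Longrightarrow> 0 < k \<Longrightarrow>
      cmod (\<Sum>p\<in>low k \<times> low k. nf_coeff \<alpha> \<gamma> \<gamma>' \<Gamma> k p * trip a k p) \<le> CZ * of_int k powr (- s) / of_int k"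
    "\<And>a k. weighted_l2 s a \<Longrightarrow> weighted_l2_norm s a \<le> M \<Longrightarrow> 0 < k \<Longrightarrow>
      cmod (\<Sum>p\<in>low k \<times> low k. nf_coeff \<alpha> \<gamma> \<gamma>' \<Gamma> k p * trip_deriv a (nonlin \<gamma> \<gamma>' \<Gamma> a) k p)
      \<le> CZ * of_int k powr (- s)"
    using normal_form_bounds[OF s \<alpha> M, of \<gamma> \<gamma>' \<Gamma>] by blast
  define Cst where "Cst = \<pi> * (G * (18 * 3 powr s * (3 * jb_const * M ^ 3)))"
  \<comment> \<open>Three errors of size k^(-s): the triples with two high frequencies, the
    nonlinear part of the derivative of \<open>Z\<close>, and \<open>\<mu> t * Z t\<close>, where
    \<mu> is at most 16 G k and \<open>Z\<close> at most CZ k^(-s) / k.\<close>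
  define C4 where "C4 = Cst + CZ + 16 * G * CZ"
  \<comment> \<open>With |a t 0|^2 at least 1/4, the number \<open>c0 * k\<close> is a lower bound
    for the growth rate of mode k.\<close>
  define c0 where "c0 = \<pi> * \<Gamma> / 4"
  \<comment> \<open>The first summand serves the terminal condition at T, where g is at least 1, and
    the removal of \<open>Z\<close>; the second one serves the forcing of size C4 k^(-s).\<close>
  define A where "A = 2 * (M + CZ) + 8 * C4 / c0"
  \<comment> \<open>The added 1/k is a floor: damping at rate c0 k cannot bring a forcing of size
    k^(-s) below a multiple of k^(-s) / k.\<close>
  define g where "g k t = 1 / (1 + c0 / 2 * of_int k * (T - t)) + 1 / of_int k" for k :: int and t :: real
  have Cst: "0 \<le> Cst" using M G \<pi> by (simp add: Cst_def)
  have C4: "0 \<le> C4" using Cst CZ(1) G by (simp add: C4_def)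
  have c0: "0 < c0" using \<pi> \<Gamma> by (simp add: c0_def)
  have A: "2 * (M + CZ) \<le> A" "8 * C4 / c0 \<le> A" "0 \<le> A"
    using M CZ(1) C4 c0 by (simp_all add: A_def)
  have A8: "8 * C4 \<le> c0 * A" using A(2) c0 by (simp add: field_simps)
  have g_pos: "1 / of_int k \<le> g k t" "0 < 1 / real_of_int k" if "0 < k" "t \<in> {0..T}" for k t
  proof -
    have "0 \<le> 1 / (1 + c0 / 2 * of_int k * (T - t))"
      using that c0 by (intro divide_nonneg_nonneg add_nonneg_nonneg mult_nonneg_nonneg) auto
    then show "1 / of_int k \<le> g k t" "0 < 1 / real_of_int k" using that by (simp_all add: g_def)
  qed
  text \<open>Bootstrap: the a priori bound is \<open>P M\<close>, and each step halves \<open>\<epsilon>\<close> while \<open>A\<close> is kept.\<close>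
  define P where "P \<epsilon> \<longleftrightarrow> (\<forall>k>0. \<forall>t\<in>{0..T}. cmod (a t k) \<le> of_int k powr (- s) * (A * g k t + \<epsilon>))" for \<epsilon>
  have base: "cmod (a t k) \<le> M * of_int k powr (- s)" if "0 < k" "t \<in> {0..T}" for k t
  proof -
    have "jb k powr s * cmod (a t k) \<le> M"
      by (rule order_trans[OF weighted_l2_pointwise[OF wl(1)] wl(2)]) (use that in auto)
    moreover have "of_int k powr s \<le> jb k powr s"
      using that s by (intro powr_mono2) (auto simp: japanese_bracket_def)
    ultimately have "of_int k powr s * cmod (a t k) \<le> M"
      by (meson dual_order.trans mult_right_mono norm_ge_zero)
    then show ?thesis using that by (simp add: powr_minus_divide pos_le_divide_eq mult.commute)
  qed
  have step: "P (\<epsilon> / 2)" if P: "P \<epsilon>" and \<epsilon>: "0 \<le> \<epsilon>" for \<epsilon>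
    unfolding P_def
  proof (intro allI impI)
    fix k :: int assume k: "0 < k"
    define \<kappa> where "\<kappa> = real_of_int k"
    have \<kappa>: "1 \<le> \<kappa>" using k by (simp add: \<kappa>_def)
    define Z where "Z t = (\<Sum>p\<in>low k \<times> low k. nf_coeff \<alpha> \<gamma> \<gamma>' \<Gamma> k p * trip (a t) k p)" for t
    define R where "R t = (\<Sum>p\<in>low k \<times> low k. nf_coeff \<alpha> \<gamma> \<gamma>' \<Gamma> k p *
      trip_deriv (a t) (nonlin \<gamma> \<gamma>' \<Gamma> (a t)) k p)" for t
    define B where "B t = of_real \<pi> * (\<Sum>p\<in>low k \<times> low k. symb \<gamma> \<gamma>' \<Gamma> k (fst p) * trip (a t) k p)" for t
    define \<mu> where "\<mu> t = of_real \<pi> * of_real ((cmod (a t 0))\<^sup>2) * (symb \<gamma> \<gamma>' \<Gamma> k 0 + symb \<gamma> \<gamma>' \<Gamma> k k)" for t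
    define lam where "lam t = - \<i> * of_real \<alpha> * (of_int k)\<^sup>2 + \<mu> t" for t
    \<comment> \<open>Determined by z' = lam z + E: differentiating \<open>Z\<close> replaces the
      sum \<open>B\<close> by \<open>R\<close>, and writing \<mu> z in place of \<mu> a leaves -
      \<mu> Z.\<close>
    define E where "E t = (nonlin \<gamma> \<gamma>' \<Gamma> (a t) k - \<mu> t * a t k - B t) + R t - \<mu> t * Z t" for t
    define z where "z t = a t k + Z t" for t
    define w where "w t = \<kappa> powr (- s) * (A * g k t + \<epsilon>) / 2" for t
    define w' where "w' t = \<kappa> powr (- s) * (A * (c0 / 2 * \<kappa> / (1 + c0 / 2 * \<kappa> * (T - t))\<^sup>2)) / 2" for t
    have Ag: "A / \<kappa> \<le> A * g k t" if "t \<in> {0..T}" for t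
      using mult_left_mono[OF g_pos(1)[OF k that] A(3)] by (simp add: \<kappa>_def)
    have Zb: "cmod (Z t) \<le> CZ * \<kappa> powr (- s) / \<kappa>" if "t \<in> {0..T}" for t
      unfolding Z_def \<kappa>_def by (rule CZ(2)[OF wl(1,2)[OF that] k])
    have den: "1 \<le> 1 + c0 / 2 * \<kappa> * (T - t)" if "t \<in> {0..T}" for t
      using that c0 \<kappa> by auto
    have wpos: "0 \<le> A * g k t + \<epsilon>" if "t \<in> {0..T}" for t
      using Ag[OF that] A(3) \<kappa> \<epsilon> by (meson add_nonneg_nonneg divide_nonneg_nonneg order_trans zero_le_one)
    have "cmod (a t k) \<le> \<kappa> powr (- s) * (A * g k t + \<epsilon> / 2)" if t: "t \<in> {0..T}" for t
    \<comment> \<open>The barrier has to be strictly positive, hence the separate treatment of a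
      degenerate case; there M = 0, and the modes vanish.\<close>
    proof (cases "A = 0")
      case True
      then have "M = 0" using A(1) M CZ(1) by simp
      then show ?thesis using base[OF k t] True \<epsilon> by simp
    next
      case False
      then have A0: "0 < A" using A(3) by simp
      have "cmod (z t) \<le> w t"
      proof (rule barrier[where z = z and w = w and T = T and t = t and lam = lam and E = E and w' = w' and c = "c0 * \<kappa>"])
        fix t assume t: "t \<in> {0..T}"
        have "(Z has_vector_derivative (\<Sum>p\<in>low k \<times> low k. nf_coeff \<alpha> \<gamma> \<gamma>' \<Gamma> k p * trip_deriv (a t)
            (\<lambda>j. - \<i> * of_real \<alpha> * (of_int j)\<^sup>2 * a t j + nonlin \<gamma> \<gamma>' \<Gamma> (a t) j) k p)) (at t within {0..T})"
          unfolding Z_def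
          by (intro has_vector_derivative_sum has_vector_derivative_mult_right trip_derivative der t)
        also have "(\<Sum>p\<in>low k \<times> low k. nf_coeff \<alpha> \<gamma> \<gamma>' \<Gamma> k p * trip_deriv (a t)
            (\<lambda>j. - \<i> * of_real \<alpha> * (of_int j)\<^sup>2 * a t j + nonlin \<gamma> \<gamma>' \<Gamma> (a t) j) k p)
          = - \<i> * of_real \<alpha> * (of_int k)\<^sup>2 * Z t - B t + R t"
          unfolding Z_def B_def R_def \<pi>_def sum_distrib_left sum_subtractf[symmetric] sum.distrib[symmetric]
          by (rule sum.cong[OF refl nf_coeff_cancels[OF k _ \<alpha>]])
        finally have z': "(z has_vector_derivative (- \<i> * of_real \<alpha> * (of_int k)\<^sup>2 * a t k + nonlin \<gamma> \<gamma>' \<Gamma> (a t) k)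
            + (- \<i> * of_real \<alpha> * (of_int k)\<^sup>2 * Z t - B t + R t)) (at t within {0..T})"
          unfolding z_def by (intro has_vector_derivative_add der t)
        have alg: "(q * x + n) + (q * y - b + r) = (q + m) * (x + y) + ((n - m * x - b) + r - m * y)"
          for q x n y b r m :: complex
          by (simp add: algebra_simps)
        show "(z has_vector_derivative (lam t * z t + E t)) (at t within {0..T})"
          using z' unfolding lam_def z_def E_def by (rule has_vector_derivative_eq_rhs) (rule alg)
        show "(w has_real_derivative w' t) (at t within {0..T})"
          unfolding w_def w'_def g_def \<kappa>_def[symmetric]
          by (rule weight_derivative) (use den[OF t] in simp)
        have "0 < A * g k t" using A0 less_le_trans[OF g_pos(2,1)[OF k t]] by (intro mult_pos_pos) auto
        then show "0 < w t" using \<kappa> \<epsilon> by (simp add: w_def add_pos_nonneg)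
        \<comment> \<open>The derivative of the profile is c0 \<kappa> / 2 times its square, and the
          profile is at most 1.\<close>
        show "w' t \<le> c0 * \<kappa> / 2 * w t"
        proof -
          define d where "d = 1 + c0 / 2 * \<kappa> * (T - t)"
          have d: "1 \<le> d" using den[OF t] by (simp add: d_def)
          have "1 / d\<^sup>2 \<le> 1 / d" using d by (simp add: power2_eq_square field_simps)
          also have "\<dots> \<le> g k t" using \<kappa> by (simp add: g_def d_def \<kappa>_def)
          finally have "A * (1 / d\<^sup>2) \<le> A * g k t" using A(3) by (rule mult_left_mono)
          then have "A * (1 / d\<^sup>2) \<le> A * g k t + \<epsilon>" using \<epsilon> by linarith
          then have "(\<kappa> powr (- s) * (c0 * \<kappa> / 2) / 2) * (A * (1 / d\<^sup>2)) \<le> (\<kappa> powr (- s) * (c0 * \<kappa> / 2) / 2) * (A * g k t + \<epsilon>)"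
            using c0 \<kappa> by (intro mult_left_mono) auto
          then show ?thesis unfolding w'_def w_def d_def[symmetric] by (simp add: mult_ac)
        qed
        have \<rho>: "1 / 4 \<le> (cmod (a t 0))\<^sup>2" "(cmod (a t 0))\<^sup>2 \<le> 4"
          using power_mono[OF a0(1)[OF t], of 2] power_mono[OF a0(2)[OF t], of 2] by (simp_all add: power2_eq_square)
        have "Re (lam t) = \<pi> * (cmod (a t 0))\<^sup>2 * (\<Gamma> * \<kappa>)"
          by (simp add: lam_def \<mu>_def symb_def \<kappa>_def power2_eq_square)
        moreover have "\<pi> * (1 / 4) * (\<Gamma> * \<kappa>) \<le> \<pi> * (cmod (a t 0))\<^sup>2 * (\<Gamma> * \<kappa>)"
          using \<rho> \<pi> \<Gamma> \<kappa> by (intro mult_right_mono mult_left_mono) auto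
        ultimately show "c0 * \<kappa> \<le> Re (lam t)" by (simp add: c0_def)
        define Q where "Q = \<kappa> powr (- s) * (A * g k t + \<epsilon>)"
        have Q: "0 \<le> Q" using wpos[OF t] by (simp add: Q_def)
        \<comment> \<open>The assumed bound at a neighbour y of k: from k \<le> 2 y the power of the
          frequency costs \<open>2 powr s\<close> and the profile a factor 2.\<close>
        have W: "cmod (a t y) \<le> 2 powr (s + 1) * Q" if y: "3 * k \<le> 4 * y" "4 * y \<le> 5 * k" for y
        proof -
          have y0: "0 < y" using y k by linarith
          have ky: "k \<le> 2 * y" using y k by linarith
          then have ky': "\<kappa> \<le> 2 * of_int y" unfolding \<kappa>_def by (metis of_int_le_iff of_int_mult of_int_numeral)
          have yr: "1 \<le> real_of_int y" using y0 by simp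
          have "cmod (a t y) \<le> of_int y powr (- s) * (A * g y t + \<epsilon>)"
            using P y0 t by (auto simp: P_def)
          also have "\<dots> \<le> (2 powr s * \<kappa> powr (- s)) * (2 * (A * g k t + \<epsilon>))"
          proof (rule mult_mono)
            have "of_int y powr (- s) \<le> (\<kappa> / 2) powr (- s)" using ky' \<kappa> s by (intro powr_mono2') auto
            then show "of_int y powr (- s) \<le> 2 powr s * \<kappa> powr (- s)"
              using \<kappa> by (simp add: powr_divide powr_minus field_simps)
            define X where "X = c0 / 2 * \<kappa> * (T - t)"
            define Y where "Y = c0 / 2 * of_int y * (T - t)"
            have "X \<le> c0 / 2 * (2 * of_int y) * (T - t)"
              unfolding X_def using ky' c0 t by (intro mult_right_mono mult_left_mono) auto
            then have "X \<le> 2 * Y" by (simp add: Y_def)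
            moreover have "1 \<le> 1 + X" using den[OF t] by (simp add: X_def)
            ultimately have "1 / (1 + Y) \<le> 2 * (1 / (1 + X))" by (simp add: field_simps)
            then have "1 / (1 + c0 / 2 * of_int y * (T - t)) \<le> 2 * (1 / (1 + c0 / 2 * \<kappa> * (T - t)))"
              by (simp only: X_def Y_def)
            moreover have "1 / of_int y \<le> 2 * (1 / \<kappa>)" using ky' \<kappa> yr by (simp add: field_simps)
            ultimately have "g y t \<le> 2 * g k t" by (simp add: g_def \<kappa>_def)
            then have "A * g y t \<le> A * (2 * g k t)" using A(3) by (intro mult_left_mono)
            then show "A * g y t + \<epsilon> \<le> 2 * (A * g k t + \<epsilon>)" using \<epsilon> by simp
            show "0 \<le> A * g y t + \<epsilon>"
              using less_le_trans[OF g_pos(2,1)[OF y0 t]] A(3) \<epsilon>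
              by (intro add_nonneg_nonneg mult_nonneg_nonneg) auto
          qed auto
          also have "\<dots> = 2 powr (s + 1) * Q" by (simp add: Q_def powr_add)
          finally show ?thesis .
        qed
        have "cmod (nonlin \<gamma> \<gamma>' \<Gamma> (a t) k - \<mu> t * a t k - B t)
          \<le> \<pi> * (20 * G * \<kappa> * (2 powr (s + 1) * Q) * \<delta> + G * (18 * 3 powr s * (3 * jb_const * M ^ 3)) * jb k powr (- s))"
          unfolding \<mu>_def B_def \<pi>_def \<kappa>_def G_def
          by (rule nonlin_decomposition[OF s wl(1,2)[OF t] k a0(2)[OF t] \<delta>(1,2) small[OF t] W])
        also have "\<dots> = \<pi> * (20 * G * \<kappa> * (2 powr (s + 1) * Q) * \<delta>) + Cst * jb k powr (- s)"
          by (simp add: Cst_def algebra_simps)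
        also have "\<dots> \<le> c0 * \<kappa> / 8 * Q + Cst * \<kappa> powr (- s)"
        proof (intro add_mono mult_left_mono Cst)
          \<comment> \<open>Here c0 / 8 is \<pi> \<Gamma> / 32, and 640 = 20 * 32, which is the
            origin of the constant in the smallness condition on \<delta>.\<close>
          have "(\<pi> * \<kappa> * Q / 32) * (\<delta> * (640 * G * 2 powr (s + 1))) \<le> (\<pi> * \<kappa> * Q / 32) * \<Gamma>"
            using \<delta>(3) \<pi> \<kappa> Q unfolding G_def by (intro mult_left_mono) auto
          then show "\<pi> * (20 * G * \<kappa> * (2 powr (s + 1) * Q) * \<delta>) \<le> c0 * \<kappa> / 8 * Q"
            by (simp add: c0_def mult_ac)
          show "jb k powr (- s) \<le> \<kappa> powr (- s)"
            using \<kappa> s by (intro powr_mono2') (auto simp: \<kappa>_def japanese_bracket_def)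
        qed
        finally have e1: "cmod (nonlin \<gamma> \<gamma>' \<Gamma> (a t) k - \<mu> t * a t k - B t) \<le> c0 * \<kappa> / 8 * Q + Cst * \<kappa> powr (- s)" .
        have e2: "cmod (R t) \<le> CZ * \<kappa> powr (- s)"
          unfolding R_def \<kappa>_def by (rule CZ(3)[OF wl(1,2)[OF t] k])
        have e3: "cmod (\<mu> t * Z t) \<le> 16 * G * CZ * \<kappa> powr (- s)"
        proof -
          have "cmod (symb \<gamma> \<gamma>' \<Gamma> k 0) \<le> 2 * G * \<kappa>" "cmod (symb \<gamma> \<gamma>' \<Gamma> k k) \<le> 2 * G * \<kappa>"
            unfolding G_def \<kappa>_def using k by (intro symb_le_lin[OF k _ refl]; simp)+
          then have "cmod (symb \<gamma> \<gamma>' \<Gamma> k 0 + symb \<gamma> \<gamma>' \<Gamma> k k) \<le> 4 * G * \<kappa>"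
            by (intro order_trans[OF norm_triangle_ineq]) linarith
          moreover have "cmod (of_real \<pi> * of_real ((cmod (a t 0))\<^sup>2)) \<le> 1 * 4"
            unfolding norm_mult norm_of_real using \<pi> \<rho> by (intro mult_mono) auto
          ultimately have "cmod (\<mu> t) \<le> 1 * 4 * (4 * G * \<kappa>)"
            unfolding \<mu>_def norm_mult[of "of_real \<pi> * _"] using G \<kappa> by (intro mult_mono) auto
          then have "cmod (\<mu> t * Z t) \<le> (16 * G * \<kappa>) * (CZ * \<kappa> powr (- s) / \<kappa>)"
            unfolding norm_mult using Zb[OF t] G \<kappa> by (intro mult_mono) auto
          then show ?thesis using \<kappa> by simp
        qed
        \<comment> \<open>By the floor in g and the choice of A. Together with the equal amount
          spent on the neighbouring modes this makes up the budget
          \<open>c0 * \<kappa> / 2 * w t\<close>, since w is Q / 2.\<close>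
        have "C4 * \<kappa> powr (- s) \<le> c0 * \<kappa> / 8 * Q"
        proof -
          have "(c0 * \<kappa> / 8 * \<kappa> powr (- s)) * (A / \<kappa>) \<le> (c0 * \<kappa> / 8 * \<kappa> powr (- s)) * (A * g k t + \<epsilon>)"
            using c0 \<kappa> Ag[OF t] \<epsilon> by (intro mult_left_mono) auto
          moreover have "(c0 * \<kappa> / 8 * \<kappa> powr (- s)) * (A / \<kappa>) = (c0 * A / 8) * \<kappa> powr (- s)" using \<kappa> by simp
          moreover have "C4 * \<kappa> powr (- s) \<le> (c0 * A / 8) * \<kappa> powr (- s)" using A8 by (intro mult_right_mono) auto
          ultimately show ?thesis by (simp add: Q_def mult_ac)
        qed
        moreover have "cmod (E t) \<le> cmod (nonlin \<gamma> \<gamma>' \<Gamma> (a t) k - \<mu> t * a t k - B t) + cmod (R t) + cmod (\<mu> t * Z t)"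
          unfolding E_def by (rule order_trans[OF norm_triangle_ineq4 add_right_mono[OF norm_triangle_ineq]])
        ultimately show "cmod (E t) \<le> c0 * \<kappa> / 2 * w t"
          using e1 e2 e3 unfolding w_def Q_def[symmetric] C4_def by (simp add: algebra_simps)
      next
        show "cmod (z T) \<le> w T"
        proof -
          have TT: "T \<in> {0..T}" using T by simp
          have "CZ * \<kappa> powr (- s) / \<kappa> \<le> CZ * \<kappa> powr (- s)"
          proof -
            have "CZ * \<kappa> powr (- s) / \<kappa> \<le> CZ * \<kappa> powr (- s) / 1"
              using \<kappa> CZ(1) by (intro divide_left_mono) auto
            then show ?thesis by simp
          qed
          then have "cmod (z T) \<le> (M + CZ) * \<kappa> powr (- s)"
            unfolding z_def distrib_right using base[OF k TT] Zb[OF TT]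
            by (intro order_trans[OF norm_triangle_ineq] add_mono) (auto simp: \<kappa>_def)
          also have "\<dots> \<le> (A / 2) * \<kappa> powr (- s)" using A(1) by (intro mult_right_mono) auto
          also have "\<dots> \<le> ((A * g k T + \<epsilon>) / 2) * \<kappa> powr (- s)"
          proof -
            have "A * 1 \<le> A * g k T" using \<kappa> A(3) by (intro mult_left_mono) (auto simp: g_def \<kappa>_def)
            then show ?thesis using \<epsilon> by (intro mult_right_mono) auto
          qed
          finally show ?thesis by (simp add: w_def mult_ac)
        qed
      qed (use t c0 \<kappa> in auto)
      moreover have "cmod (a t k) \<le> cmod (z t) + cmod (Z t)"
        using norm_triangle_ineq4[of "z t" "Z t"] by (simp add: z_def)
      \<comment> \<open>Removing the correction costs at most half of the term with A g; so
        \<open>A\<close> returns to its old value while \<epsilon> has been halved.\<close>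
      moreover have "2 * (CZ * \<kappa> powr (- s) / \<kappa>) \<le> \<kappa> powr (- s) * (A * g k t)"
      proof -
        have "\<kappa> powr (- s) * (2 * CZ / \<kappa>) \<le> \<kappa> powr (- s) * (A / \<kappa>)"
          using A(1) M \<kappa> by (intro mult_left_mono divide_right_mono) auto
        also have "\<dots> \<le> \<kappa> powr (- s) * (A * g k t)" using Ag[OF t] by (intro mult_left_mono) auto
        finally show ?thesis by (simp add: mult_ac)
      qed
      moreover have "\<kappa> powr (- s) * (A * g k t + \<epsilon>) = \<kappa> powr (- s) * (A * g k t) + \<kappa> powr (- s) * \<epsilon>"
        "\<kappa> powr (- s) * (A * g k t + \<epsilon> / 2) = \<kappa> powr (- s) * (A * g k t) + \<kappa> powr (- s) * (\<epsilon> / 2)"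
        by (rule distrib_left)+
      moreover have "\<kappa> powr (- s) * (\<epsilon> / 2) = \<kappa> powr (- s) * \<epsilon> / 2" by simp
      ultimately show ?thesis using Zb[OF t] unfolding w_def by linarith
    qed
    then show "\<forall>t\<in>{0..T}. cmod (a t k) \<le> of_int k powr (- s) * (A * g k t + \<epsilon> / 2)"
      by (simp add: \<kappa>_def)
  qed
  have P: "P (M / 2 ^ n)" for n
  proof (induction n)
    case 0
    show ?case unfolding P_def
    proof (intro allI impI ballI)
      fix k :: int and t assume k: "0 < k" and t: "t \<in> {0..T}"
      have "0 \<le> A * g k t" using less_le_trans[OF g_pos(2,1)[OF k t]] A(3) by (intro mult_nonneg_nonneg) auto
      then have "of_int k powr (- s) * M \<le> of_int k powr (- s) * (A * g k t + M / 2 ^ 0)"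
        by (intro mult_left_mono) auto
      then show "cmod (a t k) \<le> of_int k powr (- s) * (A * g k t + M / 2 ^ 0)"
        using base[OF k t] by (simp add: mult.commute)
    qed
  next
    case (Suc n)
    then show ?case using step[of "M / 2 ^ n"] M by (simp add: mult.commute)
  qed
  have "cmod (a 0 k) \<le> A * (2 / (c0 * T) + 1) * of_int k powr (- s - 1)" if k: "0 < k" for k
  proof -
    have "(\<lambda>n. M / 2 ^ n) \<longlonglongrightarrow> 0"
      by (rule LIMSEQ_divide_realpow_zero) simp
    then have "(\<lambda>n. of_int k powr (- s) * (A * g k 0 + M / 2 ^ n)) \<longlonglongrightarrow> of_int k powr (- s) * (A * g k 0 + 0)"
      by (intro tendsto_intros)
    then have le: "cmod (a 0 k) \<le> of_int k powr (- s) * (A * g k 0 + 0)"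
      by (rule LIMSEQ_le_const) (use P k T in \<open>auto simp: P_def\<close>)
    have gle: "g k 0 \<le> (2 / (c0 * T) + 1) / of_int k"
    proof -
      have "1 / (1 + c0 / 2 * of_int k * (T - 0)) \<le> 1 / (c0 / 2 * of_int k * T)"
        using k c0 T by (intro divide_left_mono) (auto intro!: mult_pos_pos add_pos_pos)
      also have "\<dots> = 2 / (c0 * T) / of_int k" by simp
      finally show ?thesis unfolding g_def add_divide_distrib by simp
    qed
    note le also have "of_int k powr (- s) * (A * g k 0 + 0) \<le> of_int k powr (- s) * (A * ((2 / (c0 * T) + 1) / of_int k))"
      using mult_left_mono[OF mult_left_mono[OF gle A(3)], of "of_int k powr (- s)"] by simp
    also have "\<dots> = A * (2 / (c0 * T) + 1) * of_int k powr (- s - 1)"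
      using k by (simp add: powr_diff)
    finally show ?thesis .
  qed
  then show ?thesis by blast
qed

section \<open>Fourier series on the torus\<close>

abbreviation tor :: "real measure" where "tor \<equiv> lebesgue_on {0..2 * pi}"

abbreviation ek :: "int \<Rightarrow> real \<Rightarrow> complex" where "ek k x \<equiv> exp (\<i> * of_int k * of_real x)"

lemma torus_integral_eq: "torus_integral f = integral\<^sup>L tor f"
  by (simp add: torus_integral_def set_lebesgue_integral_def integral_restrict_space)

lemma set_integrable_tor:
  fixes f :: "real \<Rightarrow> 'a::{banach, second_countable_topology}"
  shows "set_integrable lebesgue {0..2 * pi} f \<longleftrightarrow> integrable tor f"
  by (simp add: set_integrable_def integrable_restrict_space)

lemma AE_tor: "(AE x in tor. P x) \<longleftrightarrow> (AE x in lebesgue. x \<in> {0..2 * pi} \<longrightarrow> P x)"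
  by (simp add: AE_restrict_space_iff)

lemma norm_ek [simp]: "cmod (ek k x) = 1"
  by (simp add: norm_exp_eq_Re)

lemma ek_add: "ek (j + k) x = ek j x * ek k x"
  by (simp add: algebra_simps exp_add)

lemma ek_2pi: "ek k (2 * pi) = 1"
proof -
  have "Re (\<i> * of_int k * of_real (2 * pi)) = 0" "Im (\<i> * of_int k * of_real (2 * pi)) = of_int (2 * k) * pi"
    by simp_all
  then show ?thesis using exp_eq_1 by blast
qed

lemma ek_periodic: "ek k (x + 2 * pi) = ek k x"
proof -
  have "\<i> * of_int k * of_real (x + 2 * pi) = \<i> * of_int k * of_real x + \<i> * of_int k * of_real (2 * pi)"
    by (simp add: algebra_simps)
  then show ?thesis by (simp only: exp_add ek_2pi mult_1_right)
qed

lemma ek_minus_eq: "exp (- (\<i> * of_int k * of_real x)) = ek (- k) x"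
  by simp

lemma cnj_ek: "cnj (ek k x) = ek (- k) x"
  by (simp add: exp_cnj)

lemma measurable_tor_continuous: "continuous_on UNIV f \<Longrightarrow> f \<in> borel_measurable tor"
  for f :: "real \<Rightarrow> 'a::euclidean_space"
  by (intro continuous_imp_measurable_on_sets_lebesgue) (auto intro: continuous_on_subset)

lemma continuous_ek: "continuous_on S (ek k)"
  by (intro continuous_intros)

lemma measurable_ek [measurable]: "ek k \<in> borel_measurable tor"
  by (intro measurable_tor_continuous continuous_ek)

lemma finite_measure_tor: "finite_measure tor"
  by (rule finite_measureI) (simp add: emeasure_restrict_space)

lemma integrable_mult_bounded:
  fixes f g :: "'a \<Rightarrow> complex"
  assumes "integrable M f" "g \<in> borel_measurable M" "AE x in M. cmod (g x) \<le> B"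
  shows "integrable M (\<lambda>x. g x * f x)"
proof (rule Bochner_Integration.integrable_bound)
  show "integrable M (\<lambda>x. of_real B * f x)" using assms(1) by simp
  show "(\<lambda>x. g x * f x) \<in> borel_measurable M" using assms by measurable
  show "AE x in M. cmod (g x * f x) \<le> cmod (of_real B * f x)"
    using assms(3) by eventually_elim (auto simp: norm_mult intro!: mult_right_mono)
qed

lemma integrable_ek_mult: "integrable tor f \<Longrightarrow> integrable tor (\<lambda>x. ek k x * f x)"
  by (rule integrable_mult_bounded[where B = 1]) auto

section \<open>Uniqueness of Fourier coefficients\<close>

definition null_spectrum :: "(real \<Rightarrow> complex) \<Rightarrow> bool" where
  "null_spectrum f \<longleftrightarrow> integrable tor f \<and> (\<forall>k. integral\<^sup>L tor (\<lambda>x. ek k x * f x) = 0)"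

lemma null_spectrum_ek: "null_spectrum f \<Longrightarrow> null_spectrum (\<lambda>x. ek j x * f x)"
proof -
  have "ek k x * (ek j x * f x) = ek (k + j) x * f x" for k x by (subst ek_add) (rule mult.assoc[symmetric])
  then show "null_spectrum f \<Longrightarrow> null_spectrum (\<lambda>x. ek j x * f x)"
    unfolding null_spectrum_def by (simp only: integrable_ek_mult) simp
qed

lemma null_spectrum_add: "null_spectrum f \<Longrightarrow> null_spectrum g \<Longrightarrow> null_spectrum (\<lambda>x. f x + g x)"
  by (auto simp: null_spectrum_def integrable_ek_mult distrib_left)

lemma null_spectrum_cmult: "null_spectrum f \<Longrightarrow> null_spectrum (\<lambda>x. c * f x)"
  by (auto simp: null_spectrum_def integrable_ek_mult mult.left_commute[of _ c])

text \<open>A real linear functional of \<open>cis x\<close> is a combination of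
  \<open>ek 1 x\<close> and \<open>ek (- 1) x\<close>, and multiplication by a mode merely shifts
  the spectrum. Since the induction is over all \<open>f\<close>, a product is treated one factor at
  a time.\<close>

lemma null_spectrum_polynomial:
  assumes "real_polynomial_function p" "null_spectrum f"
  shows "null_spectrum (\<lambda>x. of_real (p (cis x)) * f x)"
  using assms
proof (induction arbitrary: f rule: real_polynomial_function.induct)
  case (linear p)
  interpret bounded_linear p by fact
  have "of_real (p (cis x)) * f x =
    (of_real (p 1) - \<i> * of_real (p \<i>)) / 2 * (ek 1 x * f x) + (of_real (p 1) + \<i> * of_real (p \<i>)) / 2 * (ek (- 1) x * f x)" for x
  proof -
    have "cis x = cos x *\<^sub>R 1 + sin x *\<^sub>R \<i>" by (simp add: complex_eq_iff)
    then have "p (cis x) = cos x * p 1 + sin x * p \<i>" by (simp only: add scaleR) simp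
    moreover have "ek 1 x = of_real (cos x) + \<i> * of_real (sin x)" "ek (- 1) x = of_real (cos x) - \<i> * of_real (sin x)"
      by (simp_all add: exp_Euler exp_minus_Euler flip: cos_of_real sin_of_real)
    ultimately show ?thesis by (simp only:) (simp add: field_simps)
  qed
  then show ?case
    using null_spectrum_add[OF null_spectrum_cmult[OF null_spectrum_ek[OF linear.prems, of 1]]
        null_spectrum_cmult[OF null_spectrum_ek[OF linear.prems, of "-1"]]]
    by presburger
next
  case (const c)
  then show ?case by (intro null_spectrum_cmult)
next
  case (add p q)
  then show ?case using null_spectrum_add[OF add.IH] by (simp add: distrib_right)
next
  case (mult p q)
  then show ?case by (simp add: mult.assoc)
qed

text \<open>By Stone-Weierstrass, \<open>h\<close> is uniformly within any \<open>e\<close> of a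
  polynomial on the circle; polynomials integrate to zero against f, and the error is at most
  \<open>e\<close> times the L1 norm of f.\<close>

lemma null_spectrum_continuous:
  assumes h: "continuous_on (sphere 0 1) (h :: complex \<Rightarrow> real)" and f: "null_spectrum f"
  shows "integral\<^sup>L tor (\<lambda>x. of_real (h (cis x)) * f x) = 0"
proof -
  have fi: "integrable tor f" using f by (simp add: null_spectrum_def)
  have hc: "continuous_on UNIV (\<lambda>x. h (cis x))"
    by (rule continuous_on_compose2[OF h]) (auto intro!: continuous_intros)
  have "cmod (integral\<^sup>L tor (\<lambda>x. of_real (h (cis x)) * f x)) \<le> e * integral\<^sup>L tor (\<lambda>x. cmod (f x))" if e: "0 < e" for e
  proof -
    obtain p where p: "real_polynomial_function p" "\<And>z. z \<in> sphere 0 1 \<Longrightarrow> \<bar>h z - p z\<bar> < e"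
      using Stone_Weierstrass_real_polynomial_function[OF compact_sphere h e] by blast
    have pi: "null_spectrum (\<lambda>x. of_real (p (cis x)) * f x)" by (rule null_spectrum_polynomial[OF p(1) f])
    then have p0: "integral\<^sup>L tor (\<lambda>x. of_real (p (cis x)) * f x) = 0" "integrable tor (\<lambda>x. of_real (p (cis x)) * f x)"
      unfolding null_spectrum_def by (auto dest: spec[of _ 0])
    have pc: "continuous_on UNIV (\<lambda>x. p (cis x))"
      by (rule continuous_on_compose2[OF continuous_real_polymonial_function[OF p(1), THEN continuous_at_imp_continuous_on[OF ballI], of UNIV]])
         (auto intro!: continuous_intros)
    have b: "cmod (of_real (h (cis x) - p (cis x))) \<le> e" for x
      unfolding norm_of_real using p(2)[of "cis x"] by simp
    have di: "integrable tor (\<lambda>x. of_real (h (cis x) - p (cis x)) * f x)"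
      by (rule integrable_mult_bounded[OF fi, where B = e])
         (use b in \<open>auto intro!: measurable_tor_continuous continuous_intros hc pc simp del: of_real_diff\<close>)
    have "integral\<^sup>L tor (\<lambda>x. of_real (h (cis x)) * f x)
      = integral\<^sup>L tor (\<lambda>x. of_real (h (cis x) - p (cis x)) * f x + of_real (p (cis x)) * f x)"
      by (simp add: algebra_simps)
    also have "\<dots> = integral\<^sup>L tor (\<lambda>x. of_real (h (cis x) - p (cis x)) * f x)"
      by (simp only: Bochner_Integration.integral_add[OF di p0(2)] p0(1)) simp
    also have "cmod \<dots> \<le> integral\<^sup>L tor (\<lambda>x. cmod (of_real (h (cis x) - p (cis x)) * f x))"
      by (rule integral_norm_bound)
    also have "\<dots> \<le> integral\<^sup>L tor (\<lambda>x. e * cmod (f x))"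
      by (rule integral_mono[OF integrable_norm[OF di]])
        (use fi b in \<open>auto simp: norm_mult intro!: mult_right_mono simp del: of_real_diff\<close>)
    also have "\<dots> = e * integral\<^sup>L tor (\<lambda>x. cmod (f x))" by simp
    finally show ?thesis .
  qed note le = this
  define J where "J = integral\<^sup>L tor (\<lambda>x. cmod (f x))"
  have J: "0 \<le> J" unfolding J_def by simp
  have "cmod (integral\<^sup>L tor (\<lambda>x. of_real (h (cis x)) * f x)) \<le> 0 + d" if d: "0 < d" for d
  proof -
    have "d / (J + 1) * J \<le> d" using d J by (simp add: field_simps)
    then show ?thesis using le[of "d / (J + 1)"] d J unfolding J_def[symmetric] by simp
  qed
  then have "cmod (integral\<^sup>L tor (\<lambda>x. of_real (h (cis x)) * f x)) \<le> 0" by (rule field_le_epsilon)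
  then show ?thesis by simp
qed

definition clamp1 :: "real \<Rightarrow> real" where "clamp1 y = max (-1) (min 1 y)"

lemma clamp1_abs: "\<bar>clamp1 y\<bar> \<le> 1"
  by (auto simp: clamp1_def)

lemma continuous_clamp1: "continuous_on S clamp1"
  unfolding clamp1_def by (intro continuous_intros)

text \<open>The factor vanishing at the point 1 makes a continuous function of the angle continuous on the circle.\<close>
lemma null_spectrum_cutoff:
  assumes g: "continuous_on UNIV (g :: real \<Rightarrow> real)" and f: "null_spectrum f"
  shows "integral\<^sup>L tor (\<lambda>x. of_real (min 1 (real n * cmod (1 - cis x)) * clamp1 (g x)) * f x) = 0"
proof -
  define h where "h z = min 1 (real n * cmod (1 - z)) * clamp1 (g (Arg2pi z))" for z
  have "continuous (at z within sphere 0 1) h" if z: "z \<in> sphere 0 1" for z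
  proof (cases "z = 1")
    case True
    have "(h \<longlongrightarrow> 0) (at 1 within sphere 0 1)"
    proof (rule Lim_null_comparison)
      show "\<forall>\<^sub>F z in at 1 within sphere 0 1. norm (h z) \<le> real n * cmod (1 - z)"
      proof (intro always_eventually allI)
        fix z have "\<bar>min 1 (real n * cmod (1 - z))\<bar> * \<bar>clamp1 (g (Arg2pi z))\<bar> \<le> (real n * cmod (1 - z)) * 1"
          using clamp1_abs by (intro mult_mono) auto
        then show "norm (h z) \<le> real n * cmod (1 - z)" by (simp add: h_def abs_mult)
      qed
      have "((\<lambda>z. real n * cmod (1 - z)) \<longlongrightarrow> real n * cmod (1 - 1)) (at 1 within sphere 0 1)"
        by (intro tendsto_intros)
      then show "((\<lambda>z::complex. real n * cmod (1 - z)) \<longlongrightarrow> 0) (at 1 within sphere 0 1)" by simp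
    qed
    moreover have "h 1 = 0" by (simp add: h_def)
    ultimately show ?thesis using True by (simp add: continuous_within)
  next
    case False
    \<comment> \<open>On the circle the branch cut of \<open>Arg2pi\<close> is met at the point 1
      alone.\<close>
    have "z \<notin> \<real>\<^sub>\<ge>\<^sub>0"
    proof
      assume "z \<in> \<real>\<^sub>\<ge>\<^sub>0"
      then obtain r where "z = of_real r" "0 \<le> r" by (auto simp: nonneg_Reals_def)
      then show False using z False by simp
    qed
    then have A: "isCont Arg2pi z" by (rule continuous_at_Arg2pi)
    have "isCont (\<lambda>z. clamp1 (g (Arg2pi z))) z"
    proof (rule isCont_o2[where f = "\<lambda>z. g (Arg2pi z)" and g = clamp1, OF isCont_o2[where g = g, OF A]])
      show "isCont g (Arg2pi z)" using g by (simp add: continuous_on_eq_continuous_at)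
      show "isCont clamp1 (g (Arg2pi z))" using continuous_clamp1[of UNIV] by (simp add: continuous_on_eq_continuous_at)
    qed
    then have "isCont h z" unfolding h_def by (intro continuous_intros)
    then show ?thesis by (rule continuous_at_imp_continuous_at_within)
  qed
  then have hc: "continuous_on (sphere 0 1) h" by (simp add: continuous_on_eq_continuous_within)
  have "integral\<^sup>L tor (\<lambda>x. of_real (min 1 (real n * cmod (1 - cis x)) * clamp1 (g x)) * f x)
    = integral\<^sup>L tor (\<lambda>x. of_real (h (cis x)) * f x)"
  proof (rule Bochner_Integration.integral_cong[OF refl])
    fix x assume "x \<in> space tor"
    then have x: "0 \<le> x" "x \<le> 2 * pi" by auto
    show "of_real (min 1 (real n * cmod (1 - cis x)) * clamp1 (g x)) * f x = of_real (h (cis x)) * f x"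
    proof (cases "x = 2 * pi")
      case True
      then show ?thesis by (simp add: h_def)
    next
      case False
      have "Arg2pi (cis x) = x"
        by (rule Arg2pi_unique[of 1]) (use x False in \<open>auto simp: cis_conv_exp\<close>)
      then show ?thesis by (simp add: h_def)
    qed
  qed
  also have "\<dots> = 0" by (rule null_spectrum_continuous[OF hc f])
  finally show ?thesis .
qed

text \<open>A measurable function is almost everywhere the limit of continuous ones. Clamping keeps
  these dominated, and the factor that makes them continuous on the circle tends to 1 away from the
  two endpoints, so dominated convergence applies.\<close>

lemma null_spectrum_measurable:
  assumes r: "r \<in> borel_measurable tor" "\<And>x. \<bar>r x\<bar> \<le> (1::real)" and f: "null_spectrum f"
  shows "integral\<^sup>L tor (\<lambda>x. of_real (r x) * f x) = 0"
proof -
  have "r measurable_on {0..2 * pi}"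
    using r(1) by (subst measurable_on_iff_borel_measurable) auto
  then obtain N g where N: "negligible N" and g: "\<And>n::nat. continuous_on UNIV (g n)"
    and lim: "\<And>x. x \<notin> N \<Longrightarrow> (\<lambda>n. g n x) \<longlonglongrightarrow> (if x \<in> {0..2 * pi} then r x else 0)"
    unfolding measurable_on_def by blast
  have fi: "integrable tor f" using f by (simp add: null_spectrum_def)
  define h where "h n x = min 1 (real n * cmod (1 - cis x)) * clamp1 (g n x)" for n x
  have hb: "\<bar>h n x\<bar> \<le> 1" for n x
    using mult_mono[of "\<bar>min 1 (real n * cmod (1 - cis x))\<bar>" 1 "\<bar>clamp1 (g n x)\<bar>" 1] clamp1_abs
    by (auto simp: h_def abs_mult)
  have hm: "h n \<in> borel_measurable tor" for n
    unfolding h_def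
    by (intro measurable_tor_continuous continuous_intros continuous_on_compose2[OF continuous_clamp1[of UNIV]] g) auto
  have "(\<lambda>n. integral\<^sup>L tor (\<lambda>x. of_real (h n x) * f x)) \<longlonglongrightarrow> integral\<^sup>L tor (\<lambda>x. of_real (r x) * f x)"
  proof (rule integral_dominated_convergence[where w = "\<lambda>x. cmod (f x)"])
    show "(\<lambda>x. of_real (r x) * f x) \<in> borel_measurable tor" "\<And>n. (\<lambda>x. of_real (h n x) * f x) \<in> borel_measurable tor"
      using r(1) hm fi by measurable
    show "integrable tor (\<lambda>x. cmod (f x))" using fi by simp
    show "AE x in tor. cmod (of_real (h n x) * f x) \<le> cmod (f x)" for n
      using hb[of n] by (auto simp: norm_mult intro!: mult_left_le_one_le)
    have "AE x in lebesgue. x \<notin> N \<union> {0, 2 * pi}"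
      using N by (intro AE_not_in) (auto simp: negligible_iff_null_sets[symmetric] intro!: negligible_Un)
    then show "AE x in tor. (\<lambda>n. of_real (h n x) * f x) \<longlonglongrightarrow> of_real (r x) * f x"
      unfolding AE_tor
    proof (eventually_elim, intro impI)
      fix x assume x: "x \<notin> N \<union> {0, 2 * pi}" "x \<in> {0..2 * pi}"
      have "cis x \<noteq> 1"
      proof
        assume "cis x = 1"
        then have "cos x = 1" by (simp add: complex_eq_iff)
        then obtain m :: int where m: "x = of_int m * 2 * pi" using cos_one_2pi_int[of x] by auto
        have "0 < x" "x < 2 * pi" using x by auto
        then have "0 < real_of_int m * (2 * pi)" "real_of_int m * (2 * pi) < 1 * (2 * pi)"
          using m by simp_all
        then have "0 < real_of_int m" "real_of_int m < 1"
          by (simp_all add: zero_less_mult_iff mult_less_cancel_right)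
        then show False by simp
      qed
      then have p: "0 < cmod (1 - cis x)" by simp
      have "\<forall>\<^sub>F n in sequentially. 1 \<le> real n * cmod (1 - cis x)"
        using p by real_asymp
      then have e: "\<forall>\<^sub>F n in sequentially. clamp1 (g n x) = h n x"
        by eventually_elim (simp add: h_def)
      have "(\<lambda>n. clamp1 (g n x)) \<longlonglongrightarrow> clamp1 (r x)"
        using lim[of x] x continuous_clamp1[of UNIV]
        by (intro isCont_tendsto_compose[of _ clamp1]) (auto simp: continuous_on_eq_continuous_at)
      moreover have "clamp1 (r x) = r x" using r(2)[of x] by (simp add: clamp1_def)
      ultimately have "(\<lambda>n. h n x) \<longlonglongrightarrow> r x" using e by (simp add: Lim_transform_eventually)
      then show "(\<lambda>n. of_real (h n x) * f x) \<longlonglongrightarrow> of_real (r x) * f x" by (intro tendsto_intros)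
    qed
  qed
  moreover have "integral\<^sup>L tor (\<lambda>x. of_real (h n x) * f x) = 0" for n
    unfolding h_def by (rule null_spectrum_cutoff[OF g f])
  ultimately show ?thesis by (simp add: LIMSEQ_const_iff)
qed

text \<open>Integration against the conjugate of the sign of f, with real and imaginary parts taken
  separately, yields the L1 norm of f.\<close>

lemma null_spectrum_imp_zero:
  assumes f: "null_spectrum f"
  shows "AE x in tor. f x = 0"
proof -
  have fi [measurable]: "integrable tor f" using f by (simp add: null_spectrum_def)
  define c where "c x = cnj (sgn (f x))" for x
  have [measurable]: "(\<lambda>x. cnj (f x)) \<in> borel_measurable tor"
    by (rule borel_measurable_continuous_on[where f = cnj])
       (use fi in \<open>auto intro: continuous_intros\<close>)
  have cm [measurable]: "c \<in> borel_measurable tor"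
    unfolding c_def sgn_div_norm complex_cnj_scaleR using fi by measurable
  have cb: "cmod (c x) \<le> 1" for x by (simp add: c_def norm_sgn)
  have R: "integral\<^sup>L tor (\<lambda>x. of_real (Re (c x)) * f x) = 0"
    by (rule null_spectrum_measurable[OF _ _ f]) (use cm order_trans[OF abs_Re_le_cmod cb] in auto)
  have I: "integral\<^sup>L tor (\<lambda>x. of_real (Im (c x)) * f x) = 0"
    by (rule null_spectrum_measurable[OF _ _ f]) (use cm order_trans[OF abs_Im_le_cmod cb] in auto)
  have i1: "integrable tor (\<lambda>x. of_real (Re (c x)) * f x)" "integrable tor (\<lambda>x. of_real (Im (c x)) * f x)"
    by (rule integrable_mult_bounded[OF fi, where B = 1],
        use cm order_trans[OF abs_Re_le_cmod cb] order_trans[OF abs_Im_le_cmod cb] in auto)+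
  have "of_real (cmod (f x)) = of_real (Re (c x)) * f x + \<i> * (of_real (Im (c x)) * f x)" for x
  proof -
    have "of_real (cmod (f x)) = c x * f x"
    proof (cases "f x = 0")
      case False
      have "c x * f x = cnj (f x) * f x / of_real (cmod (f x))"
        by (simp add: c_def sgn_div_norm scaleR_conv_of_real divide_inverse mult_ac)
      also have "cnj (f x) * f x = of_real (cmod (f x)) * of_real (cmod (f x))"
        by (metis complex_norm_square mult.commute of_real_power power2_eq_square)
      finally show ?thesis using False by simp
    qed simp
    also have "\<dots> = (of_real (Re (c x)) + \<i> * of_real (Im (c x))) * f x" by (simp flip: complex_eq)
    finally show ?thesis by (simp add: algebra_simps)
  qed
  then have "integral\<^sup>L tor (\<lambda>x. of_real (cmod (f x)) :: complex) = 0"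
    using i1 R I by simp
  then have "integral\<^sup>L tor (\<lambda>x. cmod (f x)) = 0"
    by (metis integral_complex_of_real of_real_eq_0_iff)
  then show ?thesis
    using fi by (subst (asm) integral_nonneg_eq_0_iff_AE) auto
qed

section \<open>Fourier inversion and convolution\<close>

lemma fourier_coeff_eq:
  "fourier_coeff f k = of_real (1 / sqrt (2 * pi)) * integral\<^sup>L tor (\<lambda>x. ek (- k) x * f x)"
  unfolding fourier_coeff_def torus_integral_eq ek_minus_eq ..

lemma sqrt_2pi: "of_real (sqrt (2 * pi)) * of_real (1 / sqrt (2 * pi)) = (1 :: complex)"
  unfolding of_real_mult[symmetric] by simp

lemma integral_ek_eq_fourier_coeff:
  "integral\<^sup>L tor (\<lambda>x. ek k x * f x) = of_real (sqrt (2 * pi)) * fourier_coeff f (- k)"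
  unfolding fourier_coeff_eq mult.assoc[symmetric] sqrt_2pi by simp

lemma integral_ek: "integral\<^sup>L tor (ek k) = (if k = 0 then of_real (2 * pi) else 0)"
proof -
  have i: "ek k absolutely_integrable_on {0..2 * pi}"
    by (rule absolutely_integrable_continuous_real[OF continuous_ek])
  have eq: "integral\<^sup>L tor (ek k) = integral {0..2 * pi} (ek k)"
    using set_lebesgue_integral_eq_integral(2)[OF i]
    by (simp add: torus_integral_def flip: torus_integral_eq)
  show ?thesis
  proof (cases "k = 0")
    case True
    then show ?thesis unfolding eq by (simp add: scaleR_conv_of_real)
  next
    case False
    have d: "((\<lambda>x. ek k x / (\<i> * of_int k)) has_vector_derivative ek k x) (at x within {0..2 * pi})" for x
      by (rule has_vector_derivative_real_field[of "\<lambda>z. exp (\<i> * of_int k * z) / (\<i> * of_int k)"])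
         (use False in \<open>auto intro!: derivative_eq_intros\<close>)
    have "(ek k has_integral (ek k (2 * pi) / (\<i> * of_int k) - ek k 0 / (\<i> * of_int k))) {0..2 * pi}"
      by (rule fundamental_theorem_of_calculus) (use d in auto)
    then show ?thesis using False by (simp add: eq integral_unique ek_2pi del: of_real_mult)
  qed
qed

text \<open>The integers are enumerated by \<open>int_decode\<close>, so that termwise integration
  of ordinary series is available; the n-th term is dominated by a summable constant times
  |h|.\<close>

lemma integral_trig_series:
  fixes c :: "int \<Rightarrow> complex"
  assumes c: "(\<lambda>k. cmod (c k)) summable_on UNIV" and h: "integrable tor h"
  shows "integrable tor (\<lambda>x. (\<Sum>\<^sub>\<infinity>k. c k * ek k x) * h x)"
    and "((\<lambda>k. c k * integral\<^sup>L tor (\<lambda>x. ek k x * h x)) has_sum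
          integral\<^sup>L tor (\<lambda>x. (\<Sum>\<^sub>\<infinity>k. c k * ek k x) * h x)) UNIV"
proof -
  define f where "f n x = c (int_decode n) * (ek (int_decode n) x * h x)" for n x
  have cs: "summable (\<lambda>n. cmod (c (int_decode n)))"
    using summable_on_reindex_bij_betw[OF bij_int_decode, of "\<lambda>k. cmod (c k)"] c
    by (simp add: summable_on_UNIV_nonneg_real_iff)
  have nf: "cmod (f n x) = cmod (c (int_decode n)) * cmod (h x)" for n x
    by (simp add: f_def norm_mult)
  have fi: "integrable tor (f n)" for n
    unfolding f_def by (intro integrable_mult_right integrable_ek_mult h)
  have fs: "summable (\<lambda>n. cmod (f n x))" for x
    unfolding nf by (intro summable_mult2 cs)
  have fis: "summable (\<lambda>n. \<integral>x. cmod (f n x) \<partial>tor)"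
    unfolding nf by (simp add: summable_mult2 cs)
  have eq: "(\<Sum>n. f n x) = (\<Sum>\<^sub>\<infinity>k. c k * ek k x) * h x" for x
  proof -
    have "(\<lambda>k. cmod (c k * ek k x)) summable_on UNIV" using c by (simp only: norm_mult norm_ek mult_1_right)
    then have "((\<lambda>k. c k * ek k x) has_sum (\<Sum>\<^sub>\<infinity>k. c k * ek k x)) UNIV"
      by (rule has_sum_infsum[OF Infinite_Sum.abs_summable_summable])
    then have "((\<lambda>n. c (int_decode n) * ek (int_decode n) x) has_sum (\<Sum>\<^sub>\<infinity>k. c k * ek k x)) UNIV"
      using has_sum_reindex_bij_betw[OF bij_int_decode, of "\<lambda>k. c k * ek k x"] by simp
    from has_sum_imp_sums[OF has_sum_cmult_left[OF this, of "h x"]]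
    show ?thesis by (simp add: f_def sums_iff mult.assoc)
  qed
  note S = integrable_suminf[of tor f, OF fi AE_I2[OF fs] fis] sums_integral[of tor f, OF fi AE_I2[OF fs] fis]
  show "integrable tor (\<lambda>x. (\<Sum>\<^sub>\<infinity>k. c k * ek k x) * h x)" using S(1) by (simp only: eq)
  have "summable (\<lambda>n. cmod (integral\<^sup>L tor (f n)))"
    by (rule summable_comparison_test'[OF fis]) (use integral_norm_bound in auto)
  from norm_summable_imp_has_sum[OF this S(2)]
  have "((\<lambda>n. integral\<^sup>L tor (f n)) has_sum integral\<^sup>L tor (\<lambda>x. (\<Sum>\<^sub>\<infinity>k. c k * ek k x) * h x)) UNIV"
    by (simp only: eq)
  moreover have "integral\<^sup>L tor (f n) = c (int_decode n) * integral\<^sup>L tor (\<lambda>x. ek (int_decode n) x * h x)" for n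
    unfolding f_def[abs_def] by simp
  ultimately show "((\<lambda>k. c k * integral\<^sup>L tor (\<lambda>x. ek k x * h x)) has_sum
          integral\<^sup>L tor (\<lambda>x. (\<Sum>\<^sub>\<infinity>k. c k * ek k x) * h x)) UNIV"
    using has_sum_reindex_bij_betw[OF bij_int_decode, of "\<lambda>k. c k * integral\<^sup>L tor (\<lambda>x. ek k x * h x)"] by simp
qed

lemma trig_series_integral:
  fixes c :: "int \<Rightarrow> complex"
  assumes c: "(\<lambda>k. cmod (c k)) summable_on UNIV"
  shows "integrable tor (\<lambda>x. \<Sum>\<^sub>\<infinity>k. c k * ek k x)"
    and "integral\<^sup>L tor (\<lambda>x. ek j x * (\<Sum>\<^sub>\<infinity>k. c k * ek k x)) = of_real (2 * pi) * c (- j)"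
    and "fourier_coeff (\<lambda>x. \<Sum>\<^sub>\<infinity>k. c k * ek k x) j = of_real (sqrt (2 * pi)) * c j"
proof -
  interpret finite_measure tor by (rule finite_measure_tor)
  show "integrable tor (\<lambda>x. \<Sum>\<^sub>\<infinity>k. c k * ek k x)"
    using integral_trig_series(1)[OF c, of "\<lambda>x. 1"] by simp
  show *: "integral\<^sup>L tor (\<lambda>x. ek j x * (\<Sum>\<^sub>\<infinity>k. c k * ek k x)) = of_real (2 * pi) * c (- j)" for j
  proof -
    have "integrable tor (ek j)" using integrable_ek_mult[of "\<lambda>x. 1" j] by simp
    from integral_trig_series(2)[OF c this]
    have "((\<lambda>k. c k * integral\<^sup>L tor (ek (k + j))) has_sum integral\<^sup>L tor (\<lambda>x. (\<Sum>\<^sub>\<infinity>k. c k * ek k x) * ek j x)) UNIV"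
      by (simp only: ek_add)
    moreover have "((\<lambda>k. c k * integral\<^sup>L tor (ek (k + j))) has_sum of_real (2 * pi) * c (- j)) UNIV"
    proof (rule has_sum_finite_neutralI[of "{- j}"])
      show "c k * integral\<^sup>L tor (ek (k + j)) = 0" if "k \<in> UNIV - {- j}" for k
        unfolding integral_ek using that by auto
      show "of_real (2 * pi) * c (- j) = (\<Sum>k\<in>{- j}. c k * integral\<^sup>L tor (ek (k + j)))"
        unfolding integral_ek by simp
    qed auto
    ultimately show ?thesis by (simp add: has_sum_unique mult.commute)
  qed
  show "fourier_coeff (\<lambda>x. \<Sum>\<^sub>\<infinity>k. c k * ek k x) j = of_real (sqrt (2 * pi)) * c j"
  proof -
    have "1 / sqrt (2 * pi) * (2 * pi) = sqrt (2 * pi)" using real_div_sqrt[of "2 * pi"] by simp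
    then have "(of_real (1 / sqrt (2 * pi)) * of_real (2 * pi) :: complex) = of_real (sqrt (2 * pi))"
      by (simp only: of_real_mult[symmetric])
    then show ?thesis
      by (simp only: fourier_coeff_eq * mult.assoc[symmetric] minus_minus)
  qed
qed

text \<open>The function and its series have the same Fourier coefficients, so that their difference
  has null spectrum.\<close>

lemma fourier_inversion:
  assumes f: "integrable tor f" and l1: "(\<lambda>k. cmod (fourier_coeff f k)) summable_on UNIV"
  shows "AE x in tor. f x = (\<Sum>\<^sub>\<infinity>k. (of_real (1 / sqrt (2 * pi)) * fourier_coeff f k) * ek k x)"
proof -
  define c where "c k = of_real (1 / sqrt (2 * pi)) * fourier_coeff f k" for k
  have c: "(\<lambda>k. cmod (c k)) summable_on UNIV"
    unfolding c_def norm_mult by (intro summable_on_cmult_right l1)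
  note S = trig_series_integral[OF c]
  have "null_spectrum (\<lambda>x. f x - (\<Sum>\<^sub>\<infinity>k. c k * ek k x))"
    unfolding null_spectrum_def
  proof (intro conjI allI)
    fix j
    have "integral\<^sup>L tor (\<lambda>x. ek j x * (f x - (\<Sum>\<^sub>\<infinity>k. c k * ek k x)))
      = integral\<^sup>L tor (\<lambda>x. ek j x * f x) - integral\<^sup>L tor (\<lambda>x. ek j x * (\<Sum>\<^sub>\<infinity>k. c k * ek k x))"
      unfolding right_diff_distrib by (intro Bochner_Integration.integral_diff integrable_ek_mult f S)
    also have "\<dots> = of_real (sqrt (2 * pi)) * fourier_coeff f (- j) - of_real (2 * pi) * c (- j)"
      by (simp only: S integral_ek_eq_fourier_coeff)
    also have "of_real (2 * pi) = (of_real (sqrt (2 * pi)) * of_real (sqrt (2 * pi)) :: complex)"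
      by (simp flip: of_real_mult)
    finally show "integral\<^sup>L tor (\<lambda>x. ek j x * (f x - (\<Sum>\<^sub>\<infinity>k. c k * ek k x))) = 0"
      by (simp add: c_def)
  qed (use f S in auto)
  from null_spectrum_imp_zero[OF this] show ?thesis by (simp add: c_def)
qed

text \<open>The factor \<open>f\<close> is replaced by its absolutely convergent series, which is
  integrated termwise against \<open>g\<close>. In this asymmetric form the result applies to a
  product in which \<open>g\<close> is |u|^2.\<close>

lemma fourier_coeff_mult:
  assumes f: "integrable tor f" and l1: "(\<lambda>k. cmod (fourier_coeff f k)) summable_on UNIV" and g: "integrable tor g"
  shows "integrable tor (\<lambda>x. f x * g x)"
    and "((\<lambda>j. fourier_coeff f j * fourier_coeff g (k - j)) has_sum
          of_real (sqrt (2 * pi)) * fourier_coeff (\<lambda>x. f x * g x) k) UNIV"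
proof -
  define c where "c k = of_real (1 / sqrt (2 * pi)) * fourier_coeff f k" for k
  have c: "(\<lambda>k. cmod (c k)) summable_on UNIV"
    unfolding c_def norm_mult by (intro summable_on_cmult_right l1)
  have ae: "AE x in tor. f x = (\<Sum>\<^sub>\<infinity>k. c k * ek k x)"
    using fourier_inversion[OF f l1] by (simp only: c_def)
  have m: "f \<in> borel_measurable tor" "g \<in> borel_measurable tor" using f g by auto
  have gk: "integrable tor (\<lambda>x. ek (- k) x * g x)" for k by (rule integrable_ek_mult[OF g])
  note S = integral_trig_series[OF c]
  have ae': "AE x in tor. (\<Sum>\<^sub>\<infinity>k. c k * ek k x) * g x = f x * g x" using ae by eventually_elim simp
  show fg: "integrable tor (\<lambda>x. f x * g x)"
    using integrable_cong_AE_imp[OF S(1)[OF g] _ ae'] m by simp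
  have "of_real (sqrt (2 * pi)) * fourier_coeff (\<lambda>x. f x * g x) k = integral\<^sup>L tor (\<lambda>x. ek (- k) x * (f x * g x))"
    using integral_ek_eq_fourier_coeff[of "- k"] by simp
  also have "\<dots> = integral\<^sup>L tor (\<lambda>x. (\<Sum>\<^sub>\<infinity>k. c k * ek k x) * (ek (- k) x * g x))"
  proof (rule integral_cong_AE)
    show "(\<lambda>x. (\<Sum>\<^sub>\<infinity>k. c k * ek k x) * (ek (- k) x * g x)) \<in> borel_measurable tor"
      using S(1)[OF gk] by auto
    show "AE x in tor. ek (- k) x * (f x * g x) = (\<Sum>\<^sub>\<infinity>k. c k * ek k x) * (ek (- k) x * g x)"
      using ae by eventually_elim (simp add: mult_ac)
  qed (use m in measurable)
  finally have "of_real (sqrt (2 * pi)) * fourier_coeff (\<lambda>x. f x * g x) k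
     = integral\<^sup>L tor (\<lambda>x. (\<Sum>\<^sub>\<infinity>k. c k * ek k x) * (ek (- k) x * g x))" .
  moreover have "c j * integral\<^sup>L tor (\<lambda>x. ek j x * (ek (- k) x * g x)) = fourier_coeff f j * fourier_coeff g (k - j)" for j
  proof -
    have "ek j x * (ek (- k) x * g x) = ek (j - k) x * g x" for x
      using ek_add[of j "- k" x] by (simp only: mult.assoc diff_conv_add_uminus)
    then have "integral\<^sup>L tor (\<lambda>x. ek j x * (ek (- k) x * g x)) = of_real (sqrt (2 * pi)) * fourier_coeff g (- (j - k))"
      by (simp only: integral_ek_eq_fourier_coeff)
    then show ?thesis using sqrt_2pi by (simp add: c_def mult_ac)
  qed
  ultimately show "((\<lambda>j. fourier_coeff f j * fourier_coeff g (k - j)) has_sum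
          of_real (sqrt (2 * pi)) * fourier_coeff (\<lambda>x. f x * g x) k) UNIV"
    using S(2)[OF gk, of k] by simp
qed

lemma fourier_coeff_cnj: "fourier_coeff (\<lambda>x. cnj (f x)) k = cnj (fourier_coeff f (- k))"
proof -
  have "integral\<^sup>L tor (\<lambda>x. ek (- k) x * cnj (f x)) = integral\<^sup>L tor (\<lambda>x. cnj (ek k x * f x))"
    by (simp only: complex_cnj_mult cnj_ek)
  also have "\<dots> = cnj (integral\<^sup>L tor (\<lambda>x. ek k x * f x))"     by (rule integral_bounded_linear'[OF bounded_linear_cnj bounded_linear_cnj]) simp
  finally show ?thesis by (simp add: fourier_coeff_eq)
qed

lemma HsD:
  assumes "f \<in> Hs s" "1 \<le> s"
  shows "integrable tor f" "integrable tor (\<lambda>x. (cmod (f x))\<^sup>2)" "weighted_l2 s (fourier_coeff f)"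
    "(\<lambda>k. cmod (fourier_coeff f k)) summable_on UNIV"
proof -
  interpret finite_measure tor by (rule finite_measure_tor)
  show f2: "integrable tor (\<lambda>x. (cmod (f x))\<^sup>2)" and wl: "weighted_l2 s (fourier_coeff f)"
    using assms(1) by (auto simp: Hs_def set_integrable_tor)
  have m: "f \<in> borel_measurable tor"
    using assms(1) by (auto simp: Hs_def intro: measurable_restrict_space1)
  show "integrable tor f"
  proof (rule Bochner_Integration.integrable_bound[where f = "\<lambda>x. 1 + (cmod (f x))\<^sup>2", OF _ m])
    show "integrable tor (\<lambda>x. 1 + (cmod (f x))\<^sup>2)"
      by (rule Bochner_Integration.integrable_add[OF integrable_const f2])
    have "r \<le> 1 + r\<^sup>2" for r :: real
    proof -
      have "0 \<le> r\<^sup>2" "2 * r \<le> 1 + r\<^sup>2" using sum_squares_bound[of 1 r] by simp_all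
      then show ?thesis by linarith
    qed
    then show "AE x in tor. cmod (f x) \<le> norm (1 + (cmod (f x))\<^sup>2)" by simp
  qed
  show "(\<lambda>k. cmod (fourier_coeff f k)) summable_on UNIV"
    by (rule weighted_l2_imp_l1(1)[OF assms(2) wl])
qed

section \<open>The cubic terms of the equation in Fourier variables\<close>

lemma trip_summable:
  assumes "1 \<le> s" "weighted_l2 s a"
  shows "trip a k summable_on UNIV" "(\<lambda>p. of_int (k - fst p) * trip a k p) summable_on UNIV"
proof -
  \<comment> \<open>Special parameters reduce the symbol to a constant, and further below to k - x,
    so that both claims are instances of \<open>nonlin_summable\<close>.\<close>
  have "symb 1 0 0 k x = \<i>" for x by (simp add: symb_def)
  then have "(\<lambda>p. cmod (trip a k p)) summable_on UNIV"
    using nonlin_summable[OF assms, of 1 0 0 k] by (simp only: norm_mult norm_ii mult_1)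
  then show "trip a k summable_on UNIV" by (rule Infinite_Sum.abs_summable_summable)
  have "symb 0 0 1 k x = of_int (k - x)" for x by (simp add: symb_def)
  then show "(\<lambda>p. of_int (k - fst p) * trip a k p) summable_on UNIV"
    using Infinite_Sum.abs_summable_summable[OF nonlin_summable[OF assms, of 0 0 1 k]] by (simp only:)
qed

lemma infsum_pairs:
  fixes f :: "'a \<times> 'b \<Rightarrow> 'c::banach"
  assumes "f summable_on UNIV"
  shows "(\<Sum>\<^sub>\<infinity>x. \<Sum>\<^sub>\<infinity>y. f (x, y)) = infsum f UNIV"
  using infsum_Sigma_banach[of f UNIV "\<lambda>_. UNIV"] assms by simp

abbreviation abs_sq :: "(real \<Rightarrow> complex) \<Rightarrow> real \<Rightarrow> complex" where
  "abs_sq u \<equiv> \<lambda>x. of_real ((cmod (u x))\<^sup>2)"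

lemma abs_sq_integrable:
  assumes u: "u \<in> Hs s" and s: "1 \<le> s"
  shows "integrable tor (abs_sq u)"
  using HsD(2)[OF u s] by (simp only: integrable_of_real)

lemma fourier_coeff_abs_sq:
  assumes u: "u \<in> Hs s" and s: "1 \<le> s"
  shows "(\<Sum>\<^sub>\<infinity>y. fourier_coeff u y * cnj (fourier_coeff u (y - l)))
    = of_real (sqrt (2 * pi)) * fourier_coeff (abs_sq u) l"
proof -
  have "fourier_coeff (\<lambda>x. cnj (u x)) (l - y) = cnj (fourier_coeff u (y - l))" for y
    by (simp add: fourier_coeff_cnj)
  moreover have "u x * cnj (u x) = abs_sq u x" for x by (rule complex_norm_square[symmetric])
  ultimately show ?thesis
    using fourier_coeff_mult(2)[OF HsD(1,4)[OF u s], of "\<lambda>x. cnj (u x)" l] HsD(1)[OF u s]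
    by (simp only: infsumI complex_integrable_cnj)
qed

text \<open>The convolution theorem is used twice, for u and its conjugate and then for u and |u|^2;
  each use contributes a factor sqrt (2 pi). Absolute summability merges the iterated sum into one
  over pairs.\<close>

lemma cubic_fourier:
  assumes u: "u \<in> Hs s" and s: "1 \<le> s"
  shows "integrable tor (\<lambda>x. abs_sq u x * u x)"
    "of_real (2 * pi) * fourier_coeff (\<lambda>x. abs_sq u x * u x) k = infsum (trip (fourier_coeff u) k) UNIV"
proof -
  note M = fourier_coeff_mult[OF HsD(1,4)[OF u s] abs_sq_integrable[OF u s]]
  show "integrable tor (\<lambda>x. abs_sq u x * u x)" using M(1) by (simp only: mult.commute)
  have "infsum (trip (fourier_coeff u) k) UNIV = (\<Sum>\<^sub>\<infinity>x. \<Sum>\<^sub>\<infinity>y. trip (fourier_coeff u) k (x, y))"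
    by (rule infsum_pairs[OF trip_summable(1)[OF s HsD(3)[OF u s]], symmetric])
  also have "\<dots> = (\<Sum>\<^sub>\<infinity>x. fourier_coeff u x * (\<Sum>\<^sub>\<infinity>y. fourier_coeff u y * cnj (fourier_coeff u (y - (k - x)))))"
    by (simp add: trip_def infsum_cmult_right' mult.assoc algebra_simps)
  also have "\<dots> = (\<Sum>\<^sub>\<infinity>x. of_real (sqrt (2 * pi)) * (fourier_coeff u x * fourier_coeff (abs_sq u) (k - x)))"
    by (simp only: fourier_coeff_abs_sq[OF u s] mult.left_commute)
  also have "\<dots> = of_real (sqrt (2 * pi)) * (of_real (sqrt (2 * pi)) * fourier_coeff (\<lambda>x. u x * abs_sq u x) k)"
    by (simp only: infsum_cmult_right' infsumI[OF M(2)])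
  also have "\<dots> = of_real (2 * pi) * fourier_coeff (\<lambda>x. abs_sq u x * u x) k"
    by (simp add: mult.commute[of "u _"] mult.assoc[symmetric] of_real_mult[symmetric] del: of_real_mult)
  finally show "of_real (2 * pi) * fourier_coeff (\<lambda>x. abs_sq u x * u x) k = infsum (trip (fourier_coeff u) k) UNIV" ..
qed

text \<open>If x is the frequency of the undifferentiated factor u, then |u|^2 has frequency k - x
  and its derivative contributes i (k - x). This is the origin of the term with \<Gamma> in
  \<open>symb\<close>. The number \<theta> will be the value of a cut-off in time.\<close>

lemma duality_fourier:
  assumes u: "u \<in> Hs s" and s: "1 \<le> s"
  shows "of_real (sqrt (2 * pi)) * duality_pairing (distr_deriv (distr_of (abs_sq u))) (\<lambda>x. u x * (\<theta> * exp (- (\<i> * of_int k * of_real x))))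
    = \<theta> * \<i> * (\<Sum>\<^sub>\<infinity>p. of_int (k - fst p) * trip (fourier_coeff u) k p)"
proof -
  have c: "fourier_coeff (\<lambda>x. u x * (\<theta> * exp (- (\<i> * of_int k * of_real x)))) (- l) = \<theta> * fourier_coeff u (k - l)" for l
  proof -
    have "ek l x * (u x * (\<theta> * exp (- (\<i> * of_int k * of_real x)))) = \<theta> * (ek (- (k - l)) x * u x)" for x
    proof -
      have *: "ek (- (k - l)) x = ek l x * exp (- (\<i> * of_int k * of_real x))"
        by (subst ek_minus_eq, subst ek_add[symmetric]) simp
      show ?thesis unfolding * by (simp only: mult_ac)
    qed
    then show ?thesis by (simp only: fourier_coeff_eq minus_minus integral_mult_right_zero mult.left_commute)
  qed
  have "of_real (sqrt (2 * pi)) * duality_pairing (distr_deriv (distr_of (abs_sq u))) (\<lambda>x. u x * (\<theta> * exp (- (\<i> * of_int k * of_real x))))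
    = of_real (sqrt (2 * pi)) * (\<Sum>\<^sub>\<infinity>l. \<i> * of_int l * fourier_coeff (abs_sq u) l * (\<theta> * fourier_coeff u (k - l)))"
    unfolding duality_pairing_def distr_coeff_distr_deriv c ..
  also have "(\<Sum>\<^sub>\<infinity>l. \<i> * of_int l * fourier_coeff (abs_sq u) l * (\<theta> * fourier_coeff u (k - l)))
      = (\<Sum>\<^sub>\<infinity>x. \<i> * of_int (k - x) * fourier_coeff (abs_sq u) (k - x) * (\<theta> * fourier_coeff u x))"
  proof -
    have "bij_betw (\<lambda>x. k - x) UNIV UNIV" by (rule bij_betw_byWitness[where f' = "\<lambda>x. k - x"]) auto
    from infsum_reindex_bij_betw[OF this, of "\<lambda>l. \<i> * of_int l * fourier_coeff (abs_sq u) l * (\<theta> * fourier_coeff u (k - l))"]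
    show ?thesis by simp
  qed
  also have "of_real (sqrt (2 * pi)) * \<dots>
      = (\<Sum>\<^sub>\<infinity>x. \<theta> * \<i> * (of_int (k - x) * (fourier_coeff u x * (of_real (sqrt (2 * pi)) * fourier_coeff (abs_sq u) (k - x)))))"
    unfolding infsum_cmult_right'[symmetric] by (simp only: mult_ac)
  also have "\<dots> = (\<Sum>\<^sub>\<infinity>x. \<theta> * \<i> * (\<Sum>\<^sub>\<infinity>y. of_int (k - x) * trip (fourier_coeff u) k (x, y)))"
  proof -
    have "of_int (k - x) * (fourier_coeff u x * (\<Sum>\<^sub>\<infinity>y. fourier_coeff u y * cnj (fourier_coeff u (y - (k - x))))) = (\<Sum>\<^sub>\<infinity>y. of_int (k - x) * trip (fourier_coeff u) k (x, y))" for x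
      unfolding infsum_cmult_right'[symmetric] trip_def by (simp add: algebra_simps)
    then show ?thesis by (simp only: fourier_coeff_abs_sq[OF u s])
  qed
  also have "\<dots> = \<theta> * \<i> * (\<Sum>\<^sub>\<infinity>x. \<Sum>\<^sub>\<infinity>y. of_int (k - x) * trip (fourier_coeff u) k (x, y))"
    by (rule infsum_cmult_right')
  also have "(\<Sum>\<^sub>\<infinity>x. \<Sum>\<^sub>\<infinity>y. of_int (k - x) * trip (fourier_coeff u) k (x, y)) = (\<Sum>\<^sub>\<infinity>p. of_int (k - fst p) * trip (fourier_coeff u) k p)"
    using infsum_pairs[OF trip_summable(2)[OF s HsD(3)[OF u s], of k]] by simp
  finally show ?thesis .
qed

section \<open>From weak solutions to the Fourier modes\<close>

text \<open>For p = 1 this is the standard smooth function exp (-1/x). The polynomial makes the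
  family closed under differentiation, so that one lemma yields derivatives of every order.\<close>

definition flat :: "real poly \<Rightarrow> real \<Rightarrow> real" where
  "flat p x = (if 0 < x then poly p (1 / x) * exp (- (1 / x)) else 0)"

lemma poly_exp_tendsto_0: "((\<lambda>y. poly p y * exp (- y)) \<longlongrightarrow> 0) at_top" for p :: "real poly"
proof -
  have "((\<lambda>y. \<Sum>i\<le>degree p. coeff p i * (y ^ i / exp y)) \<longlongrightarrow> (\<Sum>i\<le>degree p. coeff p i * 0)) at_top"
    by (intro tendsto_intros tendsto_power_div_exp_0)
  moreover have "(\<Sum>i\<le>degree p. coeff p i * (y ^ i / exp y)) = poly p y * exp (- y)" for y
    by (simp add: poly_altdef sum_distrib_right exp_minus field_simps sum_divide_distrib)
  ultimately show ?thesis by simp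
qed

text \<open>With y = 1/x the chain rule gives the factor - y^2, which accounts for
  \<open>[:0, 0, 1:]\<close>. At the origin the difference quotient from the right is again a
  polynomial in y times exp (-y), hence tends to 0.\<close>

lemma flat_has_derivative:
  "(flat p has_real_derivative flat ([:0, 0, 1:] * (p - pderiv p)) x) (at x)"
proof -
  consider "x < 0" | "x = 0" | "0 < x" by linarith
  then show ?thesis
  proof cases
    case 1
    have "((\<lambda>x. 0) has_real_derivative 0) (at x)" by simp
    then have "(flat p has_real_derivative 0) (at x)"
      by (rule has_field_derivative_transform_within_open[of _ _ _ "{..<0}"]) (use 1 in \<open>auto simp: flat_def\<close>)
    then show ?thesis using 1 by (simp add: flat_def)
  next
    case 3
    have i: "((\<lambda>x. 1 / x) has_real_derivative - ((1 / x) * (1 / x))) (at x)"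
      using 3 by (auto intro!: derivative_eq_intros)
    note d = DERIV_mult[OF DERIV_chain'[OF i poly_DERIV[of p "1 / x"]] DERIV_chain'[OF DERIV_minus[OF i] DERIV_exp]]
    have "((\<lambda>x. poly p (1 / x) * exp (- (1 / x))) has_real_derivative
      flat ([:0, 0, 1:] * (p - pderiv p)) x) (at x)"
      by (rule DERIV_cong[OF d]) (use 3 in \<open>simp add: flat_def, simp add: algebra_simps diff_divide_distrib\<close>)
    then show ?thesis
      by (rule has_field_derivative_transform_within_open[of _ _ _ "{0<..}"]) (use 3 in \<open>auto simp: flat_def\<close>)
  next
    case 2
    have R: "((\<lambda>h. flat p h / h) \<longlongrightarrow> 0) (at_right 0)"
    proof -
      have "((\<lambda>h. poly (pCons 0 p) (inverse h) * exp (- inverse h)) \<longlongrightarrow> 0) (at_right (0::real))"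
        by (rule filterlim_compose[OF poly_exp_tendsto_0 filterlim_inverse_at_top_right])
      moreover have "\<forall>\<^sub>F h in at_right (0::real). poly (pCons 0 p) (inverse h) * exp (- inverse h) = flat p h / h"
        unfolding eventually_at_right_field by (rule exI[of _ 1]) (auto simp: flat_def field_simps)
      ultimately show ?thesis by (rule Lim_transform_eventually)
    qed
    have L: "((\<lambda>h. flat p h / h) \<longlongrightarrow> 0) (at_left 0)"
    proof (rule Lim_transform_eventually[OF tendsto_const])
      show "\<forall>\<^sub>F h in at_left 0. 0 = flat p h / h"
        unfolding eventually_at_left_field by (rule exI[of _ "-1"]) (auto simp: flat_def)
    qed
    have "((\<lambda>h. flat p h / h) \<longlongrightarrow> 0) (at 0)" using L R by (simp add: filterlim_split_at)
    then have "(flat p has_real_derivative 0) (at 0)"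
      by (simp add: has_field_derivative_iff) (simp add: flat_def)
    then show ?thesis using 2 by (simp add: flat_def)
  qed
qed

primrec flat_poly :: "nat \<Rightarrow> real poly" where
  "flat_poly 0 = 1"
| "flat_poly (Suc n) = [:0, 0, 1:] * (flat_poly n - pderiv (flat_poly n))"

text \<open>The \<open>m\<close>-th derivative of a smooth cut-off which vanishes for \<open>\<sigma> t \<ge> q\<close> and tends to 1 for
  \<open>\<sigma> t < q\<close> as \<open>l \<rightarrow> \<infinity>\<close>.\<close>
definition cutoff :: "real \<Rightarrow> real \<Rightarrow> real \<Rightarrow> nat \<Rightarrow> real \<Rightarrow> real" where
  "cutoff \<sigma> l q m t = (- (\<sigma> * l)) ^ m * flat (flat_poly m) (l * (q - \<sigma> * t))"

lemma cutoff_has_derivative: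
  "(cutoff \<sigma> l q m has_real_derivative cutoff \<sigma> l q (Suc m) t) (at t)"
proof -
  have "((\<lambda>t. l * (q - \<sigma> * t)) has_real_derivative - (\<sigma> * l)) (at t)"
    by (auto intro!: derivative_eq_intros)
  from DERIV_cmult[OF DERIV_chain'[OF this flat_has_derivative[of "flat_poly m"]], of "(- (\<sigma> * l)) ^ m"]
  show ?thesis
    unfolding cutoff_def[abs_def] flat_poly.simps power_Suc
    by (rule DERIV_cong) (simp only: mult_ac)
qed

lemma cutoff_zero: "0 < l \<Longrightarrow> q \<le> \<sigma> * t \<Longrightarrow> cutoff \<sigma> l q m t = 0"
  by (simp add: cutoff_def flat_def zero_less_mult_iff)

lemma cutoff_range: "0 \<le> cutoff \<sigma> l q 0 t" "cutoff \<sigma> l q 0 t \<le> 1"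
  by (auto simp: cutoff_def flat_def)

lemma cutoff_deriv_nonpos: "0 < l \<Longrightarrow> cutoff 1 l q 1 t \<le> 0"
  by (auto simp: cutoff_def flat_def mult_nonneg_nonneg)

text \<open>This reduces both time directions to the cut-off with \<sigma> = 1 in the reflected
  time.\<close>

lemma cutoff_sign:
  assumes "\<sigma> = 1 \<or> \<sigma> = - 1"
  shows "cutoff \<sigma> l q m (\<sigma> * t) = \<sigma> ^ m * cutoff 1 l q m t"
  using assms by (auto simp: cutoff_def power_mult_distrib[symmetric])

lemma cutoff_tendsto_1:
  assumes "t < q"
  shows "(\<lambda>n. cutoff 1 (real (Suc n)) q 0 t) \<longlonglongrightarrow> 1"
proof -
  have "(\<lambda>n. exp (- (1 / (real (Suc n) * (q - t))))) \<longlonglongrightarrow> 1"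
  proof -
    have "(\<lambda>n. exp (- (inverse (real (Suc n)) * (1 / (q - t))))) \<longlonglongrightarrow> exp (- (0 * (1 / (q - t))))"
      by (intro tendsto_intros LIMSEQ_inverse_real_of_nat)
    then show ?thesis by (simp add: divide_inverse)
  qed
  moreover have "cutoff 1 (real (Suc n)) q 0 t = exp (- (1 / (real (Suc n) * (q - t))))" for n
  proof -
    have "0 < real (Suc n) * (q - t)" using assms by (intro mult_pos_pos) auto
    then show ?thesis by (simp add: cutoff_def flat_def)
  qed
  ultimately show ?thesis by (simp only:)
qed

lemma continuous_cutoff: "continuous_on S (cutoff \<sigma> l q m)"
  by (rule continuous_on_subset[OF DERIV_continuous_on[where s = UNIV]]) (auto intro: cutoff_has_derivative)

text \<open>The sign in the exponent is such that integration over the torus produces the k-th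
  Fourier coefficient.\<close>

definition mode_test :: "real \<Rightarrow> real \<Rightarrow> real \<Rightarrow> int \<Rightarrow> real \<Rightarrow> real \<Rightarrow> complex" where
  "mode_test \<sigma> l q k t x = of_real (cutoff \<sigma> l q 0 t) * exp (- (\<i> * of_int k * of_real x))"

lemma mode_derivative:
  "((\<lambda>x. c * exp (- (\<i> * of_int k * of_real x))) has_vector_derivative
     c * (- (\<i> * of_int k)) * exp (- (\<i> * of_int k * of_real x))) (at x)"
  by (rule has_vector_derivative_real_field[of "\<lambda>z. c * exp (- (\<i> * of_int k * z))"])
     (auto intro!: derivative_eq_intros)

lemma cutoff_vector_derivative:
  "((\<lambda>t. of_real (cutoff \<sigma> l q m t) * c) has_vector_derivative of_real (cutoff \<sigma> l q (Suc m) t) * (c :: complex)) (at t)"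
  by (intro has_vector_derivative_mult_left has_vector_derivative_of_real cutoff_has_derivative)

lemma smooth_mode_test: "smooth_plane (mode_test \<sigma> l q k)"
  unfolding smooth_plane_def
proof (rule exI[of _ "\<lambda>m n t x. of_real (cutoff \<sigma> l q m t) * ((- (\<i> * of_int k)) ^ n * exp (- (\<i> * of_int k * of_real x)))"],
    intro conjI allI)
  let ?D = "\<lambda>m n t x. of_real (cutoff \<sigma> l q m t) * ((- (\<i> * of_int k)) ^ n * exp (- (\<i> * of_int k * of_real x)))"
  show "?D 0 0 = mode_test \<sigma> l q k" by (simp add: fun_eq_iff mode_test_def)
  fix m n
  show "continuous_on UNIV (\<lambda>(t, x). ?D m n t x)"
    unfolding case_prod_beta
    by (intro continuous_intros continuous_on_compose2[OF continuous_cutoff[of UNIV]]) auto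
  fix t x
  show "((\<lambda>\<tau>. ?D m n \<tau> x) has_vector_derivative ?D (Suc m) n t x) (at t)"
    by (rule cutoff_vector_derivative)
  show "(?D m n t has_vector_derivative ?D m (Suc n) t x) (at x)"
    using mode_derivative[of "of_real (cutoff \<sigma> l q m t) * (- (\<i> * of_int k)) ^ n" k x]
    by (simp add: mult_ac)
qed

lemma mode_test_derivs:
  "dt (mode_test \<sigma> l q k) t x = of_real (cutoff \<sigma> l q 1 t) * exp (- (\<i> * of_int k * of_real x))"
  "dx (mode_test \<sigma> l q k) t x = of_real (cutoff \<sigma> l q 0 t) * (- (\<i> * of_int k)) * exp (- (\<i> * of_int k * of_real x))"
  "dx (dx (mode_test \<sigma> l q k)) t x = - of_real (cutoff \<sigma> l q 0 t) * (of_int k)\<^sup>2 * exp (- (\<i> * of_int k * of_real x))"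
proof -
  show "dt (mode_test \<sigma> l q k) t x = of_real (cutoff \<sigma> l q 1 t) * exp (- (\<i> * of_int k * of_real x))"
    unfolding dt_def mode_test_def One_nat_def by (rule vector_derivative_at[OF cutoff_vector_derivative])
  have 1: "dx (mode_test \<sigma> l q k) = (\<lambda>t x. of_real (cutoff \<sigma> l q 0 t) * (- (\<i> * of_int k)) * exp (- (\<i> * of_int k * of_real x)))"
    unfolding dx_def mode_test_def by (intro ext vector_derivative_at mode_derivative)
  then show "dx (mode_test \<sigma> l q k) t x = of_real (cutoff \<sigma> l q 0 t) * (- (\<i> * of_int k)) * exp (- (\<i> * of_int k * of_real x))"
    by simp
  have "dx (dx (mode_test \<sigma> l q k)) t x = of_real (cutoff \<sigma> l q 0 t) * (- (\<i> * of_int k)) * (- (\<i> * of_int k)) * exp (- (\<i> * of_int k * of_real x))"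
    unfolding 1 dx_def by (rule vector_derivative_at[OF mode_derivative])
  also have "\<dots> = - of_real (cutoff \<sigma> l q 0 t) * (of_int k)\<^sup>2 * exp (- (\<i> * of_int k * of_real x))"
    by (simp add: power2_eq_square mult_ac)
  finally show "dx (dx (mode_test \<sigma> l q k)) t x = - of_real (cutoff \<sigma> l q 0 t) * (of_int k)\<^sup>2 * exp (- (\<i> * of_int k * of_real x))" .
qed

lemma mode_test_in_test_functions:
  assumes "0 < l" and "compact K" "K \<subseteq> J" "\<And>t. t \<in> J - K \<Longrightarrow> q \<le> \<sigma> * t"
  shows "mode_test \<sigma> l q k \<in> test_functions J"
proof -
  have "exp (- (\<i> * of_int k * of_real (x + 2 * pi))) = exp (- (\<i> * of_int k * of_real x))" for x
    unfolding ek_minus_eq by (rule ek_periodic)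
  then have "periodic (mode_test \<sigma> l q k t)" for t
    unfolding periodic_def mode_test_def by (simp only: simp_thms)
  moreover have "mode_test \<sigma> l q k t x = 0" if "t \<in> J - K" for t x
    using cutoff_zero[OF assms(1) assms(4)[OF that]] by (simp add: mode_test_def)
  ultimately show ?thesis
    unfolding test_functions_def using smooth_mode_test assms(2,3) by blast
qed

section \<open>From cut-off identities to an integral equation in time\<close>

lemma cutoff_dominated:
  fixes F :: "real \<Rightarrow> complex"
  assumes F: "continuous_on {0..q} F"
  shows "(\<lambda>n. integral {0..q} (\<lambda>t. F t * of_real (cutoff 1 (real (Suc n)) q 0 t))) \<longlonglongrightarrow> integral {0..q} F"
proof -
  \<comment> \<open>Every cut-off vanishes at q, so the pointwise limit differs from
    \<open>F\<close> at this one point.\<close>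
  let ?g = "\<lambda>t. if t = q then 0 else F t"
  have "(\<lambda>n. integral {0..q} (\<lambda>t. F t * of_real (cutoff 1 (real (Suc n)) q 0 t))) \<longlonglongrightarrow> integral {0..q} ?g"
  proof (rule dominated_convergence(2))
    show "(\<lambda>t. F t * of_real (cutoff 1 (real (Suc n)) q 0 t)) integrable_on {0..q}" for n
      by (intro integrable_continuous_real continuous_intros F continuous_cutoff)
    show "(\<lambda>t. cmod (F t)) integrable_on {0..q}"
      by (intro integrable_continuous_real continuous_intros F)
    show "cmod (F t * of_real (cutoff 1 (real (Suc n)) q 0 t)) \<le> cmod (F t)" for n t
      unfolding norm_mult norm_of_real using cutoff_range[of 1 "real (Suc n)" q t]
      by (intro mult_right_le_one_le) auto
    show "(\<lambda>n. F t * of_real (cutoff 1 (real (Suc n)) q 0 t)) \<longlonglongrightarrow> ?g t" if t: "t \<in> {0..q}" for t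
    proof (cases "t = q")
      case True
      have "cutoff 1 (real (Suc n)) q 0 q = 0" for n by (rule cutoff_zero) auto
      then show ?thesis using True by simp
    next
      case False
      then have "(\<lambda>n. F t * of_real (cutoff 1 (real (Suc n)) q 0 t)) \<longlonglongrightarrow> F t * of_real 1"
        using t by (intro tendsto_intros cutoff_tendsto_1) auto
      then show ?thesis using False by simp
    qed
  qed
  also have "integral {0..q} ?g = integral {0..q} F"
    by (rule integral_spike[of "{q}"]) auto
  finally show ?thesis .
qed

text \<open>The functions -w' are nonnegative with mass concentrating at q. By continuity |A t - A
  q| is at most r / 2 + K (q - t), and integration by parts shows that the first moment of -w' about
  q is q w(0) minus the integral of w, which tends to q - q = 0.\<close>

lemma cutoff_deriv_concentrates:
  fixes A :: "real \<Rightarrow> complex"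
  assumes A: "continuous_on {0..q} A" and q: "0 < q"
  shows "(\<lambda>n. integral {0..q} (\<lambda>t. (A t - A q) * of_real (cutoff 1 (real (Suc n)) q 1 t))) \<longlonglongrightarrow> 0"
proof (rule LIMSEQ_I)
  fix r :: real assume r: "0 < r"
  define w where "w n = cutoff 1 (real (Suc n)) q 0" for n
  define w' where "w' n = cutoff 1 (real (Suc n)) q 1" for n
  have dw: "(w n has_real_derivative w' n t) (at t)" for n t
    using cutoff_has_derivative[of 1 "real (Suc n)" q 0 t] by (simp add: w_def w'_def)
  have wq: "w n q = 0" for n unfolding w_def by (rule cutoff_zero) auto
  have w'le: "w' n t \<le> 0" for n t unfolding w'_def by (rule cutoff_deriv_nonpos) simp
  have cw: "continuous_on S (w n)" "continuous_on S (w' n)" for S n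
    unfolding w_def w'_def by (rule continuous_cutoff)+
  have "bounded (A ` {0..q})" by (intro compact_imp_bounded compact_continuous_image A) auto
  then obtain B where "\<forall>y\<in>A ` {0..q}. cmod y \<le> B" unfolding bounded_iff by blast
  then have B: "\<And>t. t \<in> {0..q} \<Longrightarrow> cmod (A t) \<le> B" by blast
  have B0: "0 \<le> B" using B[of q] q by (auto intro: order_trans[OF norm_ge_zero])
  obtain d where d: "0 < d" "\<And>t. t \<in> {0..q} \<Longrightarrow> dist t q < d \<Longrightarrow> dist (A t) (A q) < r / 2"
    using A q r unfolding continuous_on_iff by (metis atLeastAtMost_iff half_gt_zero less_eq_real_def order_refl)
  \<comment> \<open>At distance at least d from q the linear term K (q - t) alone exceeds the global
    bound 2 B.\<close>
  define K where "K = 2 * B / d"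
  have K: "0 \<le> K" using B0 d(1) by (simp add: K_def)
  have Ab: "cmod (A t - A q) \<le> r / 2 + K * (q - t)" if t: "t \<in> {0..q}" for t
  proof (cases "q - t < d")
    case True
    then have "cmod (A t - A q) < r / 2" using d(2)[OF t] t by (simp add: dist_norm)
    moreover have "0 \<le> K * (q - t)" using K t by (intro mult_nonneg_nonneg) auto
    ultimately show ?thesis by linarith
  next
    case False
    have "cmod (A t - A q) \<le> 2 * B"
      using norm_triangle_ineq4[of "A t" "A q"] B[OF t] B[of q] q by simp
    also have "\<dots> = K * d" using d(1) by (simp add: K_def)
    also have "\<dots> \<le> K * (q - t)" using False K by (intro mult_left_mono) auto
    finally show ?thesis using r by simp
  qed
  have bound: "cmod (integral {0..q} (\<lambda>t. (A t - A q) * of_real (w' n t)))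
      \<le> r / 2 * w n 0 + K * (q * w n 0 - integral {0..q} (w n))" for n
  proof -
    have "((\<lambda>t. - (r / 2 * w n t) - K * ((q - t) * w n t)) has_real_derivative
        (- (r / 2 * w' n t) - K * (- w n t + (q - t) * w' n t))) (at t within {0..q})" for t
      by (rule derivative_eq_intros DERIV_subset[OF dw] refl subset_UNIV)+ (simp add: algebra_simps)
    then have "((\<lambda>t. - (r / 2 * w' n t) - K * (- w n t + (q - t) * w' n t)) has_integral
        ((- (r / 2 * w n q) - K * ((q - q) * w n q)) - (- (r / 2 * w n 0) - K * ((q - 0) * w n 0)))) {0..q}"
      using q by (intro fundamental_theorem_of_calculus) (auto simp: has_real_derivative_iff_has_vector_derivative[symmetric])
    then have I1: "((\<lambda>t. - (r / 2 * w' n t) - K * (- w n t + (q - t) * w' n t)) has_integral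
        (r / 2 * w n 0 + K * (q * w n 0))) {0..q}"
      by (simp add: wq add.commute)
    have I2: "((\<lambda>t. K * w n t) has_integral K * integral {0..q} (w n)) {0..q}"
      by (intro has_integral_mult_right integrable_integral integrable_continuous_real cw)
    have I3: "((\<lambda>t. (r / 2 + K * (q - t)) * (- w' n t)) has_integral
        (r / 2 * w n 0 + K * (q * w n 0) - K * integral {0..q} (w n))) {0..q}"
      by (rule has_integral_eq[OF _ has_integral_diff[OF I1 I2]]) (simp add: field_simps)
    have "cmod (integral {0..q} (\<lambda>t. (A t - A q) * of_real (w' n t)))
        \<le> integral {0..q} (\<lambda>t. (r / 2 + K * (q - t)) * (- w' n t))"
    proof (rule integral_norm_bound_integral)
      show "(\<lambda>t. (A t - A q) * of_real (w' n t)) integrable_on {0..q}"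
        by (intro integrable_continuous_real continuous_intros A cw)
      show "(\<lambda>t. (r / 2 + K * (q - t)) * (- w' n t)) integrable_on {0..q}"
        by (intro integrable_continuous_real continuous_intros cw)
      fix t assume t: "t \<in> {0..q}"
      have "cmod ((A t - A q) * of_real (w' n t)) = cmod (A t - A q) * (- w' n t)"
        using w'le[of n t] by (simp add: norm_mult)
      also have "\<dots> \<le> (r / 2 + K * (q - t)) * (- w' n t)"
        using Ab[OF t] w'le[of n t] by (intro mult_right_mono) auto
      finally show "cmod ((A t - A q) * of_real (w' n t)) \<le> (r / 2 + K * (q - t)) * (- w' n t)" .
    qed
    also have "\<dots> = r / 2 * w n 0 + K * (q * w n 0) - K * integral {0..q} (w n)"
      by (rule integral_unique[OF I3])
    finally show ?thesis by (simp add: right_diff_distrib)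
  qed
  have lw0: "(\<lambda>n. w n 0) \<longlonglongrightarrow> 1" unfolding w_def using q by (rule cutoff_tendsto_1)
  have lI: "(\<lambda>n. integral {0..q} (w n)) \<longlonglongrightarrow> q"
  proof -
    have "(\<lambda>n. integral {0..q} (\<lambda>t. 1 * of_real (w n t) :: complex)) \<longlonglongrightarrow> integral {0..q} (\<lambda>t. 1 :: complex)"
      unfolding w_def by (rule cutoff_dominated) simp
    moreover have "integral {0..q} (\<lambda>t. 1 * of_real (w n t) :: complex) = of_real (integral {0..q} (w n))" for n
      using integral_linear[OF integrable_continuous_real[OF cw(1)] bounded_linear_of_real, of 0 q n]
      by (simp add: o_def)
    moreover have "integral {0..q} (\<lambda>t. 1 :: complex) = of_real q" using q by (simp add: scaleR_conv_of_real)
    ultimately show ?thesis by (simp add: tendsto_of_real_iff)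
  qed
  have "(\<lambda>n. r / 2 * w n 0 + K * (q * w n 0 - integral {0..q} (w n))) \<longlonglongrightarrow> r / 2 * 1 + K * (q * 1 - q)"
    by (intro tendsto_intros lw0 lI)
  then have "\<forall>\<^sub>F n in sequentially. r / 2 * w n 0 + K * (q * w n 0 - integral {0..q} (w n)) < r"
    by (rule order_tendstoD) (use r in simp)
  then have "\<forall>\<^sub>F n in sequentially. norm (integral {0..q} (\<lambda>t. (A t - A q) * of_real (w' n t)) - 0) < r"
    by eventually_elim (use bound in \<open>auto intro: le_less_trans\<close>)
  then show "\<exists>n0. \<forall>n\<ge>n0. norm (integral {0..q} (\<lambda>t. (A t - A q) * of_real (cutoff 1 (real (Suc n)) q 1 t)) - 0) < r"
    unfolding w'_def eventually_sequentially .
qed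

text \<open>As the cut-offs increase to the indicator of t < q, the term with their derivatives
  becomes the value \<open>A q\<close>, the boundary term becomes \<open>a0\<close>, and the
  right-hand side converges by dominated convergence.\<close>

lemma weak_scalar_integral_equation:
  fixes A F :: "real \<Rightarrow> complex"
  assumes A: "continuous_on {0..q} A" and F: "continuous_on {0..q} F" and q: "0 < q"
    and weak: "\<And>n. - integral {0..q} (\<lambda>t. A t * of_real (cutoff 1 (real (Suc n)) q 1 t))
        - a0 * of_real (cutoff 1 (real (Suc n)) q 0 0)
      = integral {0..q} (\<lambda>t. F t * of_real (cutoff 1 (real (Suc n)) q 0 t))"
  shows "A q = a0 + integral {0..q} F"
proof -
  define w where "w n = cutoff 1 (real (Suc n)) q 0" for n
  define w' where "w' n = cutoff 1 (real (Suc n)) q 1" for n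
  have wq: "w n q = 0" for n unfolding w_def by (rule cutoff_zero) auto
  have cw': "continuous_on S (w' n)" for S n unfolding w'_def by (rule continuous_cutoff)
  have split: "integral {0..q} (\<lambda>t. A t * of_real (w' n t))
      = integral {0..q} (\<lambda>t. (A t - A q) * of_real (w' n t)) - A q * of_real (w n 0)" for n
  proof -
    have "((\<lambda>t. of_real (w n t)) has_vector_derivative of_real (w' n t)) (at t within {0..q})" for t
      using cutoff_has_derivative[of 1 "real (Suc n)" q 0 t, THEN has_vector_derivative_of_real]
      by (auto simp: w_def w'_def intro: has_vector_derivative_at_within)
    then have "((\<lambda>t. of_real (w' n t) :: complex) has_integral (of_real (w n q) - of_real (w n 0))) {0..q}"
      using q by (intro fundamental_theorem_of_calculus) auto
    then have "((\<lambda>t. A q * of_real (w' n t)) has_integral (A q * (of_real (w n q) - of_real (w n 0)))) {0..q}"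
      by (rule has_integral_mult_right)
    moreover have "((\<lambda>t. (A t - A q) * of_real (w' n t)) has_integral
        integral {0..q} (\<lambda>t. (A t - A q) * of_real (w' n t))) {0..q}"
      by (intro integrable_integral integrable_continuous_real continuous_intros A cw')
    ultimately have "((\<lambda>t. (A t - A q) * of_real (w' n t) + A q * of_real (w' n t)) has_integral
      (integral {0..q} (\<lambda>t. (A t - A q) * of_real (w' n t)) + A q * (of_real (w n q) - of_real (w n 0)))) {0..q}"
      by (intro has_integral_add)
    moreover have "(A t - A q) * of_real (w' n t) + A q * of_real (w' n t) = A t * of_real (w' n t)" for t
      by (simp add: algebra_simps)
    ultimately show ?thesis by (simp add: wq integral_unique)
  qed
  have lw0: "(\<lambda>n. of_real (w n 0) :: complex) \<longlonglongrightarrow> of_real 1"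
    unfolding w_def using q by (intro tendsto_of_real cutoff_tendsto_1)
  have "(\<lambda>n. - (integral {0..q} (\<lambda>t. (A t - A q) * of_real (w' n t)) - A q * of_real (w n 0)) - a0 * of_real (w n 0))
      \<longlonglongrightarrow> - (0 - A q * of_real 1) - a0 * of_real 1"
    unfolding w'_def by (intro tendsto_intros lw0 cutoff_deriv_concentrates A q)
  moreover have "(\<lambda>n. - (integral {0..q} (\<lambda>t. (A t - A q) * of_real (w' n t)) - A q * of_real (w n 0)) - a0 * of_real (w n 0))
      \<longlonglongrightarrow> integral {0..q} F"
    unfolding split[symmetric] using weak cutoff_dominated[OF F] by (simp add: w_def w'_def)
  ultimately have "- (0 - A q * of_real 1) - a0 * of_real 1 = integral {0..q} F" by (rule LIMSEQ_unique)
  then show ?thesis by (simp add: algebra_simps)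
qed

section \<open>Continuity of the nonlinearity on Sobolev sequences\<close>

lemma Minkowski_infsum:
  fixes f g :: "'a \<Rightarrow> real"
  assumes f: "(\<lambda>x. (f x)\<^sup>2) summable_on A" and g: "(\<lambda>x. (g x)\<^sup>2) summable_on A"
  shows "(\<lambda>x. (f x + g x)\<^sup>2) summable_on A"
    and "sqrt (\<Sum>\<^sub>\<infinity>x\<in>A. (f x + g x)\<^sup>2) \<le> sqrt (\<Sum>\<^sub>\<infinity>x\<in>A. (f x)\<^sup>2) + sqrt (\<Sum>\<^sub>\<infinity>x\<in>A. (g x)\<^sup>2)"
proof -
  define S where "S = sqrt (\<Sum>\<^sub>\<infinity>x\<in>A. (f x)\<^sup>2) + sqrt (\<Sum>\<^sub>\<infinity>x\<in>A. (g x)\<^sup>2)"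
  have S: "0 \<le> S" by (simp add: S_def infsum_nonneg)
  have fin: "(\<Sum>x\<in>F. (f x + g x)\<^sup>2) \<le> S\<^sup>2" if "finite F" "F \<subseteq> A" for F
  proof -
    have "L2_set (\<lambda>x. f x + g x) F \<le> L2_set f F + L2_set g F" by (rule L2_set_triangle_ineq)
    also have "\<dots> \<le> S"
      unfolding S_def L2_set_def using that f g by (intro add_mono real_sqrt_le_mono finite_sum_le_infsum) auto
    finally have "sqrt (\<Sum>x\<in>F. (f x + g x)\<^sup>2) \<le> S" by (simp add: L2_set_def)
    then have "(sqrt (\<Sum>x\<in>F. (f x + g x)\<^sup>2))\<^sup>2 \<le> S\<^sup>2" by (intro power_mono) (auto simp: sum_nonneg)
    then show ?thesis by (simp add: sum_nonneg)
  qed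
  show s: "(\<lambda>x. (f x + g x)\<^sup>2) summable_on A"
    by (rule nonneg_bdd_above_summable_on) (auto intro!: bdd_aboveI2 fin)
  have "(\<Sum>\<^sub>\<infinity>x\<in>A. (f x + g x)\<^sup>2) \<le> S\<^sup>2" by (rule infsum_le_finite_sums[OF s fin])
  then have "sqrt (\<Sum>\<^sub>\<infinity>x\<in>A. (f x + g x)\<^sup>2) \<le> sqrt (S\<^sup>2)" by (rule real_sqrt_le_mono)
  then show "sqrt (\<Sum>\<^sub>\<infinity>x\<in>A. (f x + g x)\<^sup>2) \<le> sqrt (\<Sum>\<^sub>\<infinity>x\<in>A. (f x)\<^sup>2) + sqrt (\<Sum>\<^sub>\<infinity>x\<in>A. (g x)\<^sup>2)"
    using S by (simp add: S_def)
qed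

lemma weighted_l2_mono:
  assumes b: "weighted_l2 s b" and le: "\<And>k. cmod (a k) \<le> cmod (b k)"
  shows "weighted_l2 s a" "weighted_l2_norm s a \<le> weighted_l2_norm s b"
proof -
  have le2: "(jb k powr s * cmod (a k))\<^sup>2 \<le> (jb k powr s * cmod (b k))\<^sup>2" for k
    by (intro power_mono mult_left_mono le) auto
  show "weighted_l2 s a"
    using b unfolding weighted_l2_def by (rule summable_on_comparison_test) (use le2 in auto)
  then show "weighted_l2_norm s a \<le> weighted_l2_norm s b"
    using b le2 unfolding weighted_l2_def weighted_l2_norm_def by (intro real_sqrt_le_mono infsum_mono) auto
qed

lemma weighted_l2_triangle:
  assumes a: "weighted_l2 s a" and b: "weighted_l2 s b"
  shows "weighted_l2 s (\<lambda>k. a k + b k)"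
    "weighted_l2_norm s (\<lambda>k. a k + b k) \<le> weighted_l2_norm s a + weighted_l2_norm s b"
proof -
  note M = Minkowski_infsum[OF a[unfolded weighted_l2_def] b[unfolded weighted_l2_def]]
  have c: "cmod (of_real (cmod (a k) + cmod (b k))) = cmod (a k) + cmod (b k)" for k
    unfolding norm_of_real by simp
  have s: "weighted_l2 s (\<lambda>k. of_real (cmod (a k) + cmod (b k)))"
    using M(1) unfolding weighted_l2_def c distrib_left .
  have n: "weighted_l2_norm s (\<lambda>k. of_real (cmod (a k) + cmod (b k))) \<le> weighted_l2_norm s a + weighted_l2_norm s b"
    using M(2) unfolding weighted_l2_norm_def c distrib_left .
  have le: "cmod (a k + b k) \<le> cmod (of_real (cmod (a k) + cmod (b k)))" for k
    unfolding c by (rule norm_triangle_ineq)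
  note W = weighted_l2_mono[where a = "\<lambda>k. a k + b k", OF s le]
  show "weighted_l2 s (\<lambda>k. a k + b k)" by (rule W(1))
  show "weighted_l2_norm s (\<lambda>k. a k + b k) \<le> weighted_l2_norm s a + weighted_l2_norm s b"
    using W(2) n by (rule order_trans)
qed

lemma weighted_l2_diff:
  assumes "weighted_l2 s a" "weighted_l2 s b"
  shows "weighted_l2 s (\<lambda>k. a k - b k)"
proof -
  have "weighted_l2 s (\<lambda>k. - b k)" using assms(2) by (simp add: weighted_l2_def)
  from weighted_l2_triangle(1)[OF assms(1) this] show ?thesis by simp
qed

text \<open>Made to match \<open>symb_le_jb\<close>: for fixed k the symbol costs one weight in the
  first slot, which the order s \<ge> 1 provides.\<close>

lemma trilinear_weighted:
  fixes a b c :: "int \<Rightarrow> complex"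
  assumes s: "1 \<le> s" and a: "weighted_l2 s a" and b: "weighted_l2 s b" and c: "weighted_l2 s c"
  shows "(\<lambda>p. jb (fst p) * cmod (a (fst p)) * cmod (b (snd p)) * cmod (c (fst p + snd p - k))) summable_on UNIV"
    "(\<Sum>\<^sub>\<infinity>p. jb (fst p) * cmod (a (fst p)) * cmod (b (snd p)) * cmod (c (fst p + snd p - k)))
      \<le> jb_const * (weighted_l2_norm s a * weighted_l2_norm s b * weighted_l2_norm s c)"
proof -
  define f where "f j = jb j * cmod (a j)" for j
  define g where "g j = cmod (b j)" for j
  have j1: "jb j \<le> jb j powr s" for j using powr_mono[of 1 s "jb j"] s by simp
  have fle: "(f j)\<^sup>2 \<le> (jb j powr s * cmod (a j))\<^sup>2" for j
    unfolding f_def by (intro power_mono mult_right_mono j1) auto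
  have "1 * cmod (b j) \<le> jb j powr s * cmod (b j)" for j
    by (intro mult_right_mono order_trans[OF jb_ge_1 j1]) auto
  then have gle: "(g j)\<^sup>2 \<le> (jb j powr s * cmod (b j))\<^sup>2" for j
    unfolding g_def by (intro power_mono) auto
  have f2: "(\<lambda>j. (f j)\<^sup>2) summable_on UNIV"
    using a unfolding weighted_l2_def by (rule summable_on_comparison_test) (use fle in auto)
  have g2: "(\<lambda>j. (g j)\<^sup>2) summable_on UNIV"
    using b unfolding weighted_l2_def by (rule summable_on_comparison_test) (use gle in auto)
  have fn: "sqrt (\<Sum>\<^sub>\<infinity>j. (f j)\<^sup>2) \<le> weighted_l2_norm s a"
    unfolding weighted_l2_norm_def using a f2 fle by (intro real_sqrt_le_mono infsum_mono) (auto simp: weighted_l2_def)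
  have gn: "sqrt (\<Sum>\<^sub>\<infinity>j. (g j)\<^sup>2) \<le> weighted_l2_norm s b"
    unfolding weighted_l2_norm_def using b g2 gle by (intro real_sqrt_le_mono infsum_mono) (auto simp: weighted_l2_def)
  note l1 = weighted_l2_imp_l1[OF s c]
  have ab: "\<bar>f j\<bar> = jb j * cmod (a j)" "\<bar>g j\<bar> = cmod (b j)" for j
    by (simp_all add: f_def g_def abs_mult abs_of_pos[OF jb_pos])
  note T = trilinear_bound[OF f2 g2 l1(1) norm_ge_zero slot_bijs(3)[of k] slot_bijs(4)[of k], unfolded ab]
  show "(\<lambda>p. jb (fst p) * cmod (a (fst p)) * cmod (b (snd p)) * cmod (c (fst p + snd p - k))) summable_on UNIV"
    by (rule T(1))
  have "sqrt (\<Sum>\<^sub>\<infinity>j. (f j)\<^sup>2) * sqrt (\<Sum>\<^sub>\<infinity>j. (g j)\<^sup>2) * (\<Sum>\<^sub>\<infinity>j. cmod (c j))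
      \<le> weighted_l2_norm s a * weighted_l2_norm s b * (jb_const * weighted_l2_norm s c)"
    by (intro mult_mono fn gn l1(2)) (auto intro!: infsum_nonneg)
  with T(2) show "(\<Sum>\<^sub>\<infinity>p. jb (fst p) * cmod (a (fst p)) * cmod (b (snd p)) * cmod (c (fst p + snd p - k)))
      \<le> jb_const * (weighted_l2_norm s a * weighted_l2_norm s b * weighted_l2_norm s c)"
    by (simp add: mult_ac)
qed

lemma symb_le_jb: "cmod (symb \<gamma> \<gamma>' \<Gamma> k x) \<le> 2 * (\<bar>\<gamma>\<bar> + \<bar>\<gamma>'\<bar> + \<bar>\<Gamma>\<bar>) * jb k * jb x"
proof -
  have "jb k * 1 \<le> jb k * jb x" by (intro mult_left_mono) auto
  moreover have "1 * jb x \<le> jb k * jb x" by (intro mult_right_mono) auto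
  ultimately have "jb k + \<bar>of_int (k - x)\<bar> \<le> 2 * (jb k * jb x)"
  proof -
    assume *: "jb k * 1 \<le> jb k * jb x" "1 * jb x \<le> jb k * jb x"
    have "(1 + \<bar>real_of_int k\<bar>) * (1 + \<bar>real_of_int x\<bar>) = 1 + \<bar>real_of_int k\<bar> + \<bar>real_of_int x\<bar> + \<bar>real_of_int k\<bar> * \<bar>real_of_int x\<bar>"
      by (simp add: algebra_simps)
    moreover have "0 \<le> \<bar>real_of_int k\<bar> * \<bar>real_of_int x\<bar>" by simp
    moreover have "\<bar>real_of_int (k - x)\<bar> \<le> \<bar>real_of_int k\<bar> + \<bar>real_of_int x\<bar>" by simp
    ultimately show ?thesis unfolding japanese_bracket_def by linarith
  qed
  then have "(\<bar>\<gamma>\<bar> + \<bar>\<gamma>'\<bar> + \<bar>\<Gamma>\<bar>) * (jb k + \<bar>of_int (k - x)\<bar>) \<le> (\<bar>\<gamma>\<bar> + \<bar>\<gamma>'\<bar> + \<bar>\<Gamma>\<bar>) * (2 * (jb k * jb x))"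
    by (intro mult_left_mono) auto
  then show ?thesis using symb_bound[of \<gamma> \<gamma>' \<Gamma> k x] by (simp add: mult_ac)
qed

text \<open>The difference of the two triple products telescopes slot by slot, so that each term
  contains \<open>d\<close> once. The constant may grow with k because modes are treated one at a
  time.\<close>

lemma cubic_sum_diff_bound:
  fixes a b :: "int \<Rightarrow> complex"
  assumes s: "1 \<le> s" and a: "weighted_l2 s a" and b: "weighted_l2 s b"
  defines "N \<equiv> weighted_l2_norm s"
  defines "d \<equiv> (\<lambda>k. a k - b k)"
  shows "cmod ((\<Sum>\<^sub>\<infinity>p. symb \<gamma> \<gamma>' \<Gamma> k (fst p) * trip a k p) - (\<Sum>\<^sub>\<infinity>p. symb \<gamma> \<gamma>' \<Gamma> k (fst p) * trip b k p))
    \<le> 2 * (\<bar>\<gamma>\<bar> + \<bar>\<gamma>'\<bar> + \<bar>\<Gamma>\<bar>) * jb k * (jb_const * (N d * N a * N a + N b * N d * N a + N b * N b * N d))"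
proof -
  define C where "C = 2 * (\<bar>\<gamma>\<bar> + \<bar>\<gamma>'\<bar> + \<bar>\<Gamma>\<bar>) * jb k"
  have C: "0 \<le> C" by (simp add: C_def less_imp_le)
  define t where "t u v w p = jb (fst p) * cmod (u (fst p)) * cmod (v (snd p)) * cmod (w (fst p + snd p - k))"
    for u v w :: "int \<Rightarrow> complex" and p
  have dw: "weighted_l2 s d" unfolding d_def by (rule weighted_l2_diff[OF a b])
  note T1 = trilinear_weighted[OF s dw a a, of k, folded t_def N_def]
  note T2 = trilinear_weighted[OF s b dw a, of k, folded t_def N_def]
  note T3 = trilinear_weighted[OF s b b dw, of k, folded t_def N_def]
  have sa: "(\<lambda>p. symb \<gamma> \<gamma>' \<Gamma> k (fst p) * trip a k p) summable_on UNIV"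
    by (rule Infinite_Sum.abs_summable_summable[OF nonlin_summable[OF s a]])
  have sb: "(\<lambda>p. symb \<gamma> \<gamma>' \<Gamma> k (fst p) * trip b k p) summable_on UNIV"
    by (rule Infinite_Sum.abs_summable_summable[OF nonlin_summable[OF s b]])
  have ts: "(\<lambda>p. C * (t d a a p + t b d a p + t b b d p)) summable_on UNIV"
    by (intro summable_on_cmult_right summable_on_add T1 T2 T3)
  have le: "cmod (symb \<gamma> \<gamma>' \<Gamma> k (fst p) * trip a k p + - (symb \<gamma> \<gamma>' \<Gamma> k (fst p) * trip b k p))
      \<le> C * (t d a a p + t b d a p + t b b d p)" for p
  proof -
    obtain x y where p: "p = (x, y)" by force
    define z where "z = x + y - k"
    have "trip a k p - trip b k p = d x * a y * cnj (a z) + b x * d y * cnj (a z) + b x * b y * cnj (d z)"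
      by (simp add: trip_def p z_def d_def algebra_simps)
    then have "cmod (trip a k p - trip b k p) \<le>
      cmod (d x) * cmod (a y) * cmod (a z) + cmod (b x) * cmod (d y) * cmod (a z) + cmod (b x) * cmod (b y) * cmod (d z)"
      using norm_triangle_ineq[of "d x * a y * cnj (a z) + b x * d y * cnj (a z)" "b x * b y * cnj (d z)"]
        norm_triangle_ineq[of "d x * a y * cnj (a z)" "b x * d y * cnj (a z)"]
      by (simp add: norm_mult)
    then have "cmod (symb \<gamma> \<gamma>' \<Gamma> k x) * cmod (trip a k p - trip b k p) \<le> (C * jb x) *
      (cmod (d x) * cmod (a y) * cmod (a z) + cmod (b x) * cmod (d y) * cmod (a z) + cmod (b x) * cmod (b y) * cmod (d z))"
      using C symb_le_jb[of \<gamma> \<gamma>' \<Gamma> k x] unfolding C_def[symmetric]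
      by (intro mult_mono) (auto intro!: mult_nonneg_nonneg)
    also have "\<dots> = C * (t d a a p + t b d a p + t b b d p)"
      by (simp add: t_def p z_def algebra_simps)
    finally show ?thesis
      by (simp add: p norm_mult[symmetric] right_diff_distrib)
  qed
  have "(\<Sum>\<^sub>\<infinity>p. symb \<gamma> \<gamma>' \<Gamma> k (fst p) * trip a k p) - (\<Sum>\<^sub>\<infinity>p. symb \<gamma> \<gamma>' \<Gamma> k (fst p) * trip b k p)
    = (\<Sum>\<^sub>\<infinity>p. symb \<gamma> \<gamma>' \<Gamma> k (fst p) * trip a k p + - (symb \<gamma> \<gamma>' \<Gamma> k (fst p) * trip b k p))"
    using infsum_add[OF sa summable_on_uminus[THEN iffD2, OF sb]] by (simp add: infsum_uminus)
  also have "cmod \<dots> \<le> (\<Sum>\<^sub>\<infinity>p. C * (t d a a p + t b d a p + t b b d p))"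
    by (rule norm_infsum_le[OF has_sum_infsum[OF summable_on_add[OF sa summable_on_uminus[THEN iffD2, OF sb]]]
          has_sum_infsum[OF ts] le])
  also have "\<dots> = C * ((\<Sum>\<^sub>\<infinity>p. t d a a p) + (\<Sum>\<^sub>\<infinity>p. t b d a p) + (\<Sum>\<^sub>\<infinity>p. t b b d p))"
    unfolding infsum_cmult_right' infsum_add[OF summable_on_add[OF T1(1) T2(1)] T3(1)] infsum_add[OF T1(1) T2(1)] ..
  also have "\<dots> \<le> C * (jb_const * (N d * N a * N a) + jb_const * (N b * N d * N a) + jb_const * (N b * N b * N d))"
    using C T1(2) T2(2) T3(2) by (intro mult_left_mono add_mono)
  finally show ?thesis unfolding C_def by (simp add: distrib_left)
qed

lemma cubic_sum_continuous:
  fixes a :: "real \<Rightarrow> int \<Rightarrow> complex"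
  assumes s: "1 \<le> s" and a: "\<And>t. t \<in> S \<Longrightarrow> weighted_l2 s (a t)"
    and lim: "\<And>t. t \<in> S \<Longrightarrow> ((\<lambda>\<tau>. weighted_l2_norm s (\<lambda>k. a \<tau> k - a t k)) \<longlongrightarrow> 0) (at t within S)"
  shows "continuous_on S (\<lambda>t. \<Sum>\<^sub>\<infinity>p. symb \<gamma> \<gamma>' \<Gamma> k (fst p) * trip (a t) k p)"
  unfolding continuous_on_def
proof
  fix t assume t: "t \<in> S"
  define N where "N = weighted_l2_norm s"
  define n where "n \<tau> = N (\<lambda>k. a \<tau> k - a t k)" for \<tau>
  define C where "C = 2 * (\<bar>\<gamma>\<bar> + \<bar>\<gamma>'\<bar> + \<bar>\<Gamma>\<bar>) * jb k"
  let ?f = "\<lambda>t. \<Sum>\<^sub>\<infinity>p. symb \<gamma> \<gamma>' \<Gamma> k (fst p) * trip (a t) k p"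
  have n0: "(n \<longlongrightarrow> 0) (at t within S)" unfolding n_def N_def by (rule lim[OF t])
  have C: "0 \<le> C" by (simp add: C_def less_imp_le)
  have nn: "0 \<le> n \<tau>" "0 \<le> N b" for \<tau> b by (simp_all add: n_def N_def)
  have "((\<lambda>\<tau>. ?f \<tau> - ?f t) \<longlongrightarrow> 0) (at t within S)"
  proof (rule Lim_null_comparison)
    let ?g = "\<lambda>\<tau>. C * (jb_const * (n \<tau> * (N (a t) + n \<tau>) * (N (a t) + n \<tau>) + N (a t) * n \<tau> * (N (a t) + n \<tau>) + N (a t) * N (a t) * n \<tau>))"
    have "\<forall>\<^sub>F \<tau> in at t within S. \<tau> \<in> S" by (simp add: eventually_at_filter)
    then show "\<forall>\<^sub>F \<tau> in at t within S. norm (?f \<tau> - ?f t) \<le> ?g \<tau>"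
    proof eventually_elim
      fix \<tau> assume \<tau>: "\<tau> \<in> S"
      have "N (a \<tau>) \<le> N (a t) + n \<tau>"
        using weighted_l2_triangle(2)[OF a[OF t] weighted_l2_diff[OF a[OF \<tau>] a[OF t]]]
        by (simp add: N_def n_def)
      then have "C * (jb_const * (n \<tau> * N (a \<tau>) * N (a \<tau>) + N (a t) * n \<tau> * N (a \<tau>) + N (a t) * N (a t) * n \<tau>)) \<le> ?g \<tau>"
        using C nn by (intro mult_left_mono add_mono mult_mono) auto
      then show "norm (?f \<tau> - ?f t) \<le> ?g \<tau>"
        using cubic_sum_diff_bound[OF s a[OF \<tau>] a[OF t], of \<gamma> \<gamma>' \<Gamma> k]
        unfolding N_def[symmetric] n_def[symmetric] C_def[symmetric] by linarith
    qed
    have "(?g \<longlongrightarrow> C * (jb_const * (0 * (N (a t) + 0) * (N (a t) + 0) + N (a t) * 0 * (N (a t) + 0) + N (a t) * N (a t) * 0))) (at t within S)"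
      by (intro tendsto_intros n0)
    then show "(?g \<longlongrightarrow> 0) (at t within S)" by simp
  qed
  then show "(?f \<longlongrightarrow> ?f t) (at t within S)" by (simp add: LIM_zero_iff)
qed

lemma coeff_continuous:
  fixes a :: "real \<Rightarrow> int \<Rightarrow> complex"
  assumes s: "0 \<le> s" and a: "\<And>t. t \<in> S \<Longrightarrow> weighted_l2 s (a t)"
    and lim: "\<And>t. t \<in> S \<Longrightarrow> ((\<lambda>\<tau>. weighted_l2_norm s (\<lambda>k. a \<tau> k - a t k)) \<longlongrightarrow> 0) (at t within S)"
  shows "continuous_on S (\<lambda>t. a t k)"
  unfolding continuous_on_def
proof
  fix t assume t: "t \<in> S"
  have "((\<lambda>\<tau>. a \<tau> k - a t k) \<longlongrightarrow> 0) (at t within S)"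
  proof (rule Lim_null_comparison[OF _ lim[OF t]])
    have "\<forall>\<^sub>F \<tau> in at t within S. \<tau> \<in> S" by (simp add: eventually_at_filter)
    then show "\<forall>\<^sub>F \<tau> in at t within S. norm (a \<tau> k - a t k) \<le> weighted_l2_norm s (\<lambda>k. a \<tau> k - a t k)"
    proof eventually_elim
      fix \<tau> assume \<tau>: "\<tau> \<in> S"
      have "1 \<le> jb k powr s" using s by (simp add: ge_one_powr_ge_zero)
      then have "1 * cmod (a \<tau> k - a t k) \<le> jb k powr s * cmod (a \<tau> k - a t k)" by (intro mult_right_mono) auto
      also have "\<dots> \<le> weighted_l2_norm s (\<lambda>k. a \<tau> k - a t k)"
        by (rule weighted_l2_pointwise[OF weighted_l2_diff[OF a[OF \<tau>] a[OF t]]])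
      finally show "norm (a \<tau> k - a t k) \<le> weighted_l2_norm s (\<lambda>k. a \<tau> k - a t k)" by simp
    qed
  qed
  then show "((\<lambda>t. a t k) \<longlongrightarrow> a t k) (at t within S)" by (simp add: LIM_zero_iff)
qed

lemma weighted_l2_reflect:
  "weighted_l2 s (\<lambda>k. a (- k)) \<longleftrightarrow> weighted_l2 s a"
  "weighted_l2_norm s (\<lambda>k. a (- k)) = weighted_l2_norm s a"
proof -
  note b = bij_uminus[where 'a = int]
  have j: "jb (- k) = jb k" for k by (simp add: japanese_bracket_def)
  show "weighted_l2 s (\<lambda>k. a (- k)) \<longleftrightarrow> weighted_l2 s a"
    using summable_on_reindex_bij_betw[OF b, of "\<lambda>k. (jb k powr s * cmod (a k))\<^sup>2"] by (simp only: weighted_l2_def j)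
  show "weighted_l2_norm s (\<lambda>k. a (- k)) = weighted_l2_norm s a"
    using infsum_reindex_bij_betw[OF b, of "\<lambda>k. (jb k powr s * cmod (a k))\<^sup>2"] by (simp only: weighted_l2_norm_def j)
qed

text \<open>The substitution p \<rightarrow> -p, under which the \<gamma>' and \<Gamma> parts of the
  symbol are odd. Time reversal changes the sign of the whole right-hand side, so after both
  reflections \<gamma>' and \<Gamma> are as before, while \<gamma> and the coefficient of the even
  multiplier k^2 have changed sign.\<close>

lemma nonlin_reflect:
  "nonlin (- \<gamma>) \<gamma>' \<Gamma> (\<lambda>k. a (- k)) k = - nonlin \<gamma> \<gamma>' \<Gamma> a (- k)"
proof -
  have b: "bij_betw (\<lambda>p::int \<times> int. (- fst p, - snd p)) UNIV UNIV"
    by (rule bij_betw_byWitness[where f' = "\<lambda>p. (- fst p, - snd p)"]) auto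
  have eq: "symb (- \<gamma>) \<gamma>' \<Gamma> k (fst p) * trip (\<lambda>k. a (- k)) k p
    = - (symb \<gamma> \<gamma>' \<Gamma> (- k) (- fst p) * trip a (- k) (- fst p, - snd p))" for p
  proof -
    have "- (fst p + snd p - k) = - fst p + - snd p - - k" by simp
    then have "trip (\<lambda>k. a (- k)) k p = trip a (- k) (- fst p, - snd p)" by (simp only: trip_def fst_conv snd_conv)
    moreover have "symb (- \<gamma>) \<gamma>' \<Gamma> k (fst p) = - symb \<gamma> \<gamma>' \<Gamma> (- k) (- fst p)"
      by (simp add: symb_def algebra_simps)
    ultimately show ?thesis by simp
  qed
  show ?thesis
    unfolding nonlin_def eq infsum_uminus
    using infsum_reindex_bij_betw[OF b, of "\<lambda>p. symb \<gamma> \<gamma>' \<Gamma> (- k) (fst p) * trip a (- k) p"] by simp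
qed

section \<open>Testing the equation with a single mode\<close>

lemma set_lebesgue_integral_half_line:
  fixes H :: "real \<Rightarrow> complex"
  assumes J: "(\<sigma> = 1 \<and> J = {0..<T}) \<or> (\<sigma> = - 1 \<and> J = {- T<..0})" and q: "0 \<le> q" "q < T"
    and H: "continuous_on {0..q} (\<lambda>t. H (\<sigma> * t))" and zero: "\<And>t. q < \<sigma> * t \<Longrightarrow> H t = 0"
  shows "(LINT t:J|lebesgue. H t) = integral {0..q} (\<lambda>t. H (\<sigma> * t))"
  using J
proof
  assume *: "\<sigma> = 1 \<and> J = {0..<T}"
  have "(LINT t:J|lebesgue. H t) = (LINT t:{0..q}|lebesgue. H t)"
    unfolding set_lebesgue_integral_def using * q zero
    by (intro Bochner_Integration.integral_cong refl) (auto simp: indicator_def)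
  also have "\<dots> = integral {0..q} H"
    using H * by (intro set_lebesgue_integral_eq_integral(2) absolutely_integrable_continuous_real) simp
  finally show ?thesis using * by simp
next
  assume *: "\<sigma> = - 1 \<and> J = {- T<..0}"
  have c: "continuous_on {- q..0} H"
  proof -
    have "continuous_on {- q..0} (\<lambda>t. (\<lambda>t. H (\<sigma> * t)) (- t))"
      by (rule continuous_on_compose2[OF H]) (auto intro!: continuous_intros)
    then show ?thesis using * by simp
  qed
  have "(LINT t:J|lebesgue. H t) = (LINT t:{- q..0}|lebesgue. H t)"
    unfolding set_lebesgue_integral_def using * q zero
    by (intro Bochner_Integration.integral_cong refl) (auto simp: indicator_def)
  also have "\<dots> = integral {- q..0} H"
    by (intro set_lebesgue_integral_eq_integral(2) absolutely_integrable_continuous_real c)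
  also have "\<dots> = integral {0..q} (\<lambda>t. H (- t))"
    using Henstock_Kurzweil_Integration.integral_reflect_real[of q 0 "\<lambda>t. H (- t)"] by simp
  finally show ?thesis using * by simp
qed

lemma nonlin_split:
  assumes "1 \<le> s" "weighted_l2 s a"
  shows "nonlin \<gamma> \<gamma>' \<Gamma> a k = of_real (1 / (2 * pi)) *
    ((\<i> * of_real \<gamma> + \<i> * of_real \<gamma>' * of_int k) * infsum (trip a k) UNIV
      + of_real \<Gamma> * (\<Sum>\<^sub>\<infinity>p. of_int (k - fst p) * trip a k p))"
proof -
  note ts = trip_summable[OF assms, of k]
  have "(\<Sum>\<^sub>\<infinity>p. symb \<gamma> \<gamma>' \<Gamma> k (fst p) * trip a k p) =
     (\<Sum>\<^sub>\<infinity>p. (\<i> * of_real \<gamma> + \<i> * of_real \<gamma>' * of_int k) * trip a k p + of_real \<Gamma> * (of_int (k - fst p) * trip a k p))"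
    by (simp only: symb_def distrib_right mult.assoc)
  also have "\<dots> = (\<i> * of_real \<gamma> + \<i> * of_real \<gamma>' * of_int k) * infsum (trip a k) UNIV
      + of_real \<Gamma> * (\<Sum>\<^sub>\<infinity>p. of_int (k - fst p) * trip a k p)"
    by (subst infsum_add) (intro summable_on_cmult_right ts, intro summable_on_cmult_right ts, simp only: infsum_cmult_right')
  finally show ?thesis by (simp only: nonlin_def)
qed

lemma torus_integral_mode:
  "torus_integral (\<lambda>x. f x * (c * exp (- (\<i> * of_int k * of_real x)))) = of_real (sqrt (2 * pi)) * (c * fourier_coeff f k)"
proof -
  have "f x * (c * exp (- (\<i> * of_int k * of_real x))) = c * (ek (- k) x * f x)" for x
    unfolding ek_minus_eq by (simp only: mult_ac)
  then have "torus_integral (\<lambda>x. f x * (c * exp (- (\<i> * of_int k * of_real x)))) = c * integral\<^sup>L tor (\<lambda>x. ek (- k) x * f x)"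
    by (simp only: torus_integral_eq integral_mult_right_zero)
  then show ?thesis by (simp only: integral_ek_eq_fourier_coeff minus_minus mult.left_commute)
qed

lemma torus_integral_cubic_mode:
  assumes u: "u \<in> Hs s" and s: "1 \<le> s"
  shows "torus_integral (\<lambda>x. \<i> * of_real \<alpha> * u x * (- w * (of_int k)\<^sup>2 * exp (- (\<i> * of_int k * of_real x)))
      + of_real ((cmod (u x))\<^sup>2) * u x * (\<i> * of_real \<gamma> * (w * exp (- (\<i> * of_int k * of_real x)))
          - of_real \<gamma>' * (w * (- (\<i> * of_int k)) * exp (- (\<i> * of_int k * of_real x)))))
    = of_real (sqrt (2 * pi)) * (w * (- \<i> * of_real \<alpha> * (of_int k)\<^sup>2 * fourier_coeff u k
        + of_real (1 / (2 * pi)) * ((\<i> * of_real \<gamma> + \<i> * of_real \<gamma>' * of_int k) * infsum (trip (fourier_coeff u) k) UNIV)))"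
    (is "torus_integral ?f = _")
proof -
  let ?V = "\<lambda>x. of_real ((cmod (u x))\<^sup>2) * u x"
  have alg: "\<i> * A * U * (- w * K * E) + V * U * (\<i> * g * (w * E) - h * (w * (- (\<i> * m)) * E))
    = (- \<i> * A * K * w) * (E * U) + ((\<i> * g + \<i> * h * m) * w) * (E * (V * U))"
    for A U K E V g h m :: complex
    by (simp add: algebra_simps)
  have "?f x = (- \<i> * of_real \<alpha> * (of_int k)\<^sup>2 * w) * (ek (- k) x * u x)
      + ((\<i> * of_real \<gamma> + \<i> * of_real \<gamma>' * of_int k) * w) * (ek (- k) x * ?V x)" for x
    unfolding ek_minus_eq by (rule alg)
  then have "torus_integral ?f = integral\<^sup>L tor (\<lambda>x. (- \<i> * of_real \<alpha> * (of_int k)\<^sup>2 * w) * (ek (- k) x * u x)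
      + ((\<i> * of_real \<gamma> + \<i> * of_real \<gamma>' * of_int k) * w) * (ek (- k) x * ?V x))"
    by (simp only: torus_integral_eq)
  also have "\<dots> = (- \<i> * of_real \<alpha> * (of_int k)\<^sup>2 * w) * integral\<^sup>L tor (\<lambda>x. ek (- k) x * u x)
      + ((\<i> * of_real \<gamma> + \<i> * of_real \<gamma>' * of_int k) * w) * integral\<^sup>L tor (\<lambda>x. ek (- k) x * ?V x)"
    by (subst Bochner_Integration.integral_add)
       (intro integrable_mult_right integrable_ek_mult HsD(1)[OF u s], intro integrable_mult_right integrable_ek_mult cubic_fourier(1)[OF u s],
        simp only: integral_mult_right_zero)
  also have "\<dots> = of_real (sqrt (2 * pi)) * (w * (- \<i> * of_real \<alpha> * (of_int k)\<^sup>2 * fourier_coeff u k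
      + (\<i> * of_real \<gamma> + \<i> * of_real \<gamma>' * of_int k) * fourier_coeff ?V k))"
    unfolding integral_ek_eq_fourier_coeff minus_minus by (simp only: algebra_simps)
  also have "fourier_coeff ?V k = of_real (1 / (2 * pi)) * infsum (trip (fourier_coeff u) k) UNIV"
    unfolding cubic_fourier(2)[OF u s, symmetric] by simp
  finally show ?thesis by (simp only: mult.left_commute)
qed

text \<open>Testing with \<open>mode_test\<close> leaves scalar integrals in time, to which
  \<open>weak_scalar_integral_equation\<close> applies. Time is written as \<sigma> t with t \<ge>
  0, whence the factor \<sigma> in \<open>F\<close>. The condition \<tau> < T keeps the cut-offs,
  which vanish beyond q \<le> \<tau>, compactly supported in the half-open interval
  \<open>J\<close>.\<close>

lemma mode_integral_equation:
  fixes u :: "real \<Rightarrow> real \<Rightarrow> complex"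
  defines "a \<equiv> \<lambda>\<sigma> t. fourier_coeff (u (\<sigma> * t))"
  assumes J: "(\<sigma> = 1 \<and> J = {0..<T}) \<or> (\<sigma> = - 1 \<and> J = {- T<..0})" and \<tau>: "\<tau> < T" and s: "1 \<le> s"
    and uH: "\<And>t. t \<in> {0..\<tau>} \<Longrightarrow> u (\<sigma> * t) \<in> Hs s"
    and lim: "\<And>t. t \<in> {0..\<tau>} \<Longrightarrow> ((\<lambda>r. weighted_l2_norm s (\<lambda>k. a \<sigma> r k - a \<sigma> t k)) \<longlongrightarrow> 0) (at t within {0..\<tau>})"
    and weak: "\<And>\<phi>. \<phi> \<in> test_functions J \<Longrightarrow> weak_identity \<alpha> \<gamma> \<gamma>' \<Gamma> J \<sigma> u0 u \<phi>"
  defines "F \<equiv> \<lambda>k t. of_real \<sigma> * (- \<i> * of_real \<alpha> * (of_int k)\<^sup>2 * a \<sigma> t k + nonlin \<gamma> \<gamma>' \<Gamma> (a \<sigma> t) k)"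
  shows "continuous_on {0..\<tau>} (\<lambda>t. a \<sigma> t k)" "continuous_on {0..\<tau>} (F k)"
    and "0 < q \<Longrightarrow> q \<le> \<tau> \<Longrightarrow> a \<sigma> q k = fourier_coeff u0 k + integral {0..q} (F k)"
proof -
  have wl: "weighted_l2 s (a \<sigma> t)" if "t \<in> {0..\<tau>}" for t
    unfolding a_def by (rule HsD(3)[OF uH[OF that] s])
  have ca: "continuous_on {0..\<tau>} (\<lambda>t. a \<sigma> t k)"
    by (rule coeff_continuous[OF _ wl lim]) (use s in auto)
  then show "continuous_on {0..\<tau>} (\<lambda>t. a \<sigma> t k)" .
  have cN: "continuous_on {0..\<tau>} (\<lambda>t. nonlin \<gamma> \<gamma>' \<Gamma> (a \<sigma> t) k)"
    unfolding nonlin_def by (intro continuous_intros cubic_sum_continuous[OF s wl lim])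
  show cF: "continuous_on {0..\<tau>} (F k)"
    unfolding F_def by (intro continuous_intros ca cN)
  \<comment> \<open>The two parts of the nonlinearity are kept apart because they enter through
    different integrals: \<open>S1\<close> through the cubic term, \<open>S2\<close> through the
    duality pairing.\<close>
  define S1 where "S1 t = infsum (trip (a \<sigma> t) k) UNIV" for t
  define S2 where "S2 t = (\<Sum>\<^sub>\<infinity>p. of_int (k - fst p) * trip (a \<sigma> t) k p)" for t
  have cS1: "continuous_on {0..\<tau>} S1"
  proof -
    have "symb 1 0 0 k x = \<i>" for x by (simp add: symb_def)
    then have "continuous_on {0..\<tau>} (\<lambda>t. \<Sum>\<^sub>\<infinity>p. \<i> * trip (a \<sigma> t) k p)"
      using cubic_sum_continuous[OF s wl lim, where \<gamma> = 1 and \<gamma>' = 0 and \<Gamma> = 0 and k = k] by (simp only:)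
    then have "continuous_on {0..\<tau>} (\<lambda>t. \<i> * S1 t)" by (simp only: S1_def infsum_cmult_right')
    then have "continuous_on {0..\<tau>} (\<lambda>t. - \<i> * (\<i> * S1 t))" by (rule continuous_on_mult_left)
    moreover have "- \<i> * (\<i> * S1 t) = S1 t" for t by simp
    ultimately show ?thesis by (simp only:)
  qed
  have cS2: "continuous_on {0..\<tau>} S2"
  proof -
    have "symb 0 0 1 k x = of_int (k - x)" for x by (simp add: symb_def)
    then show ?thesis
      using cubic_sum_continuous[OF s wl lim, where \<gamma> = 0 and \<gamma>' = 0 and \<Gamma> = 1 and k = k] 
      unfolding S2_def by (simp only:)
  qed
  assume q: "0 < q" "q \<le> \<tau>"
  have sub: "{0..q} \<subseteq> {0..\<tau>}" using q by auto
  have \<sigma>: "\<sigma> = 1 \<or> \<sigma> = - 1" using J by auto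
  then have \<sigma>2: "of_real \<sigma> * (of_real \<sigma> * z) = z" for z :: complex by auto
  have qT: "0 \<le> q" "q < T" using q \<tau> by auto
  define c where "c = complex_of_real (sqrt (2 * pi))"
  have c0: "c \<noteq> 0" by (simp add: c_def)
  have cc: "c * c = of_real (2 * pi)" unfolding c_def of_real_mult[symmetric] by simp
  show "a \<sigma> q k = fourier_coeff u0 k + integral {0..q} (F k)"
  proof (rule weak_scalar_integral_equation[OF _ _ q(1)])
    show "continuous_on {0..q} (\<lambda>t. a \<sigma> t k)" "continuous_on {0..q} (F k)"
      by (rule continuous_on_subset[OF _ sub], rule ca cF)+
    fix n
    define l where "l = real (Suc n)"
    have l: "0 < l" by (simp add: l_def)
    define \<phi> where "\<phi> = mode_test \<sigma> l q k"
    define W where "W r = complex_of_real (cutoff 1 l q 0 r)" for r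
    define W' where "W' r = complex_of_real (cutoff 1 l q 1 r)" for r
    have cW: "continuous_on {0..q} W" "continuous_on {0..q} W'"
      unfolding W_def W'_def by (intro continuous_intros continuous_cutoff)+
    have W: "of_real (cutoff \<sigma> l q 0 (\<sigma> * r)) = W r" "of_real (cutoff \<sigma> l q 1 (\<sigma> * r)) = of_real \<sigma> * W' r" for r
      by (simp_all add: W_def W'_def cutoff_sign[OF \<sigma>])
    have tf: "\<phi> \<in> test_functions J"
      using J
    proof
      assume *: "\<sigma> = 1 \<and> J = {0..<T}"
      show ?thesis unfolding \<phi>_def
        by (rule mode_test_in_test_functions[OF l, of "{0..q}"]) (use * qT in auto)
    next
      assume *: "\<sigma> = - 1 \<and> J = {- T<..0}"
      show ?thesis unfolding \<phi>_def
        by (rule mode_test_in_test_functions[OF l, of "{- q..0}"]) (use * qT in auto)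
    qed
    define H1 where "H1 t = torus_integral (\<lambda>x. u t x * dt \<phi> t x)" for t
    define H2 where "H2 t = torus_integral (\<lambda>x. \<i> * of_real \<alpha> * u t x * dx (dx \<phi>) t x
         + of_real ((cmod (u t x))\<^sup>2) * u t x * (\<i> * of_real \<gamma> * \<phi> t x - of_real \<gamma>' * dx \<phi> t x))" for t
    define H3 where "H3 t = duality_pairing (dx_abs_sq u t) (\<lambda>x. u t x * \<phi> t x)" for t
    have wi: "- (LINT t:J|lebesgue. H1 t) - of_real \<sigma> * torus_integral (\<lambda>x. u0 x * \<phi> 0 x)
       = (LINT t:J|lebesgue. H2 t) - \<i> * of_real \<Gamma> * (LINT t:J|lebesgue. H3 t)"
      using weak[OF tf] unfolding weak_identity_def H1_def H2_def H3_def .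
    have h1: "H1 t = c * (of_real (cutoff \<sigma> l q 1 t) * fourier_coeff (u t) k)" for t
      unfolding H1_def \<phi>_def mode_test_derivs c_def by (rule torus_integral_mode)
    have h0: "torus_integral (\<lambda>x. u0 x * \<phi> 0 x) = c * (W 0 * fourier_coeff u0 k)"
      using torus_integral_mode[of u0 "of_real (cutoff \<sigma> l q 0 0)" k] W(1)[of 0]
      by (simp add: \<phi>_def mode_test_def c_def)
    have h2: "H2 (\<sigma> * r) = c * (W r * (- \<i> * of_real \<alpha> * (of_int k)\<^sup>2 * a \<sigma> r k
        + of_real (1 / (2 * pi)) * ((\<i> * of_real \<gamma> + \<i> * of_real \<gamma>' * of_int k) * S1 r)))" if "r \<in> {0..q}" for r
      unfolding H2_def \<phi>_def mode_test_derivs mode_test_def c_def S1_def a_def W(1)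
      using that sub by (intro torus_integral_cubic_mode[OF uH s]) auto
    have h3: "c * H3 (\<sigma> * r) = W r * \<i> * S2 r" if "r \<in> {0..q}" for r
      unfolding H3_def \<phi>_def mode_test_def c_def S2_def a_def W(1) dx_abs_sq_def
      using that sub by (intro duality_fourier[OF uH s]) auto
    have zero: "H1 t = 0" "H2 t = 0" "H3 t = 0" if "q < \<sigma> * t" for t
    proof -
      have z: "cutoff \<sigma> l q m t = 0" for m by (rule cutoff_zero[OF l]) (use that in simp)
      show "H1 t = 0" by (simp add: h1 z)
      show "H2 t = 0" unfolding H2_def \<phi>_def mode_test_derivs mode_test_def z by (simp add: torus_integral_eq)
      have "fourier_coeff (\<lambda>x. u t x * \<phi> t x) j = 0" for j
        unfolding fourier_coeff_eq \<phi>_def mode_test_def z by simp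
      then show "H3 t = 0" by (simp add: H3_def duality_pairing_def)
    qed
    have H3': "H3 (\<sigma> * r) = W r * \<i> * S2 r / c" if "r \<in> {0..q}" for r
      using h3[OF that] c0 by (simp add: field_simps)
    note cs = continuous_on_subset[OF _ sub]
    have c1: "continuous_on {0..q} (\<lambda>r. H1 (\<sigma> * r))"
    proof -
      have "continuous_on {0..q} (\<lambda>r. c * (of_real \<sigma> * W' r * a \<sigma> r k))"
        by (intro continuous_intros cW cs[OF ca])
      then show ?thesis by (simp only: h1 W(2) a_def)
    qed
    have c2: "continuous_on {0..q} (\<lambda>r. H2 (\<sigma> * r))"
    proof -
      have "continuous_on {0..q} (\<lambda>r. c * (W r * (- \<i> * of_real \<alpha> * (of_int k)\<^sup>2 * a \<sigma> r k
        + of_real (1 / (2 * pi)) * ((\<i> * of_real \<gamma> + \<i> * of_real \<gamma>' * of_int k) * S1 r))))"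
        by (intro continuous_intros cW cs[OF ca] cs[OF cS1])
      then show ?thesis by (rule continuous_on_eq) (rule h2[symmetric])
    qed
    have c3: "continuous_on {0..q} (\<lambda>r. H3 (\<sigma> * r))"
    proof -
      have "continuous_on {0..q} (\<lambda>r. W r * \<i> * S2 r / c)"
        by (intro continuous_intros cW cs[OF cS2]) (use c0 in auto)
      then show ?thesis by (rule continuous_on_eq) (rule H3'[symmetric])
    qed
    note half = set_lebesgue_integral_half_line[OF J qT]
    have I1: "(LINT t:J|lebesgue. H1 t) = c * (of_real \<sigma> * integral {0..q} (\<lambda>r. a \<sigma> r k * W' r))"
    proof -
      have "(LINT t:J|lebesgue. H1 t) = integral {0..q} (\<lambda>r. H1 (\<sigma> * r))" by (rule half[OF c1 zero(1)])
      also have "\<dots> = integral {0..q} (\<lambda>r. c * (of_real \<sigma> * (a \<sigma> r k * W' r)))"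
        unfolding h1 W(2) a_def by (simp only: mult_ac)
      finally show ?thesis by simp
    qed
    have I23: "(LINT t:J|lebesgue. H2 t) - \<i> * of_real \<Gamma> * (LINT t:J|lebesgue. H3 t)
      = c * (of_real \<sigma> * integral {0..q} (\<lambda>r. F k r * W r))"
    proof -
      have "(LINT t:J|lebesgue. H2 t) - \<i> * of_real \<Gamma> * (LINT t:J|lebesgue. H3 t)
        = integral {0..q} (\<lambda>r. H2 (\<sigma> * r)) - \<i> * of_real \<Gamma> * integral {0..q} (\<lambda>r. H3 (\<sigma> * r))"
        by (simp only: half[OF c2 zero(2)] half[OF c3 zero(3)])
      also have "\<dots> = integral {0..q} (\<lambda>r. H2 (\<sigma> * r) - \<i> * of_real \<Gamma> * H3 (\<sigma> * r))"
        using c2 c3 by (subst Henstock_Kurzweil_Integration.integral_diff)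
          (auto intro!: integrable_continuous_real continuous_intros)
      also have "\<dots> = integral {0..q} (\<lambda>r. c * (of_real \<sigma> * (F k r * W r)))"
      proof (rule Henstock_Kurzweil_Integration.integral_cong)
        fix r assume r: "r \<in> {0..q}"
        have N: "nonlin \<gamma> \<gamma>' \<Gamma> (a \<sigma> r) k = of_real (1 / (2 * pi)) *
          ((\<i> * of_real \<gamma> + \<i> * of_real \<gamma>' * of_int k) * S1 r + of_real \<Gamma> * S2 r)"
          unfolding S1_def S2_def by (rule nonlin_split[OF s wl]) (use r sub in auto)
        \<comment> \<open>The pairing carries a factor \<open>1 / c\<close>, the other integrals a
          factor \<open>c\<close>; this identity reconciles them and produces the prefactor of
          \<open>nonlin\<close>.\<close>
        have "1 / c = c * of_real (1 / (2 * pi))"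
          using cc c0 by (simp add: field_simps)
        then have "H3 (\<sigma> * r) = c * of_real (1 / (2 * pi)) * (W r * \<i> * S2 r)"
          using H3'[OF r] by (simp only: divide_inverse mult_1 mult.commute)
        then have "\<i> * of_real \<Gamma> * H3 (\<sigma> * r) = - (c * (W r * (of_real (1 / (2 * pi)) * (of_real \<Gamma> * S2 r))))"
          by (simp add: mult_ac)
        then have "H2 (\<sigma> * r) - \<i> * of_real \<Gamma> * H3 (\<sigma> * r) =
          c * (W r * (- \<i> * of_real \<alpha> * (of_int k)\<^sup>2 * a \<sigma> r k + nonlin \<gamma> \<gamma>' \<Gamma> (a \<sigma> r) k))"
          unfolding h2[OF r] N by (simp only: algebra_simps add_minus_cancel)
        also have "\<dots> = c * (of_real \<sigma> * (F k r * W r))"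
          unfolding F_def by (simp only: mult.assoc \<sigma>2) (simp only: mult_ac)
        finally show "H2 (\<sigma> * r) - \<i> * of_real \<Gamma> * H3 (\<sigma> * r) = c * (of_real \<sigma> * (F k r * W r))" .
      qed
      finally show ?thesis by simp
    qed
    have "c * (of_real \<sigma> * (- integral {0..q} (\<lambda>r. a \<sigma> r k * W' r) - fourier_coeff u0 k * W 0))
      = c * (of_real \<sigma> * integral {0..q} (\<lambda>r. F k r * W r))"
      using wi unfolding I1 I23 h0 by (simp add: algebra_simps)
    then have "- integral {0..q} (\<lambda>r. a \<sigma> r k * W' r) - fourier_coeff u0 k * W 0 = integral {0..q} (\<lambda>r. F k r * W r)"
      using c0 \<sigma> by auto
    then show "- integral {0..q} (\<lambda>t. a \<sigma> t k * of_real (cutoff 1 (real (Suc n)) q 1 t))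
        - fourier_coeff u0 k * of_real (cutoff 1 (real (Suc n)) q 0 0)
      = integral {0..q} (\<lambda>t. F k t * of_real (cutoff 1 (real (Suc n)) q 0 t))"
      unfolding W_def W'_def l_def .
  qed
qed

section \<open>The initial datum\<close>

text \<open>The factor 2 counts the two signs of a frequency \<plusminus> 2^j.\<close>

lemma lacunary_sum:
  fixes \<phi> :: "real \<Rightarrow> real"
  assumes nn: "\<And>x. 0 \<le> \<phi> x" and sm: "summable (\<lambda>j::nat. \<phi> (2 ^ j))"
  defines "h \<equiv> \<lambda>k::int. if \<bar>k\<bar> \<in> range (\<lambda>j::nat. 2 ^ j) then \<phi> \<bar>of_int k\<bar> else 0"
  shows "(h has_sum 2 * (\<Sum>j. \<phi> (2 ^ j))) UNIV"
proof -
  define e where "e j = (2::int) ^ j" for j :: nat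
  have inj: "inj e" by (simp add: inj_def e_def)
  define h1 where "h1 k = (if k \<in> range e then \<phi> (of_int k) else 0)" for k
  have "((\<lambda>j. \<phi> (2 ^ j)) has_sum (\<Sum>j. \<phi> (2 ^ j))) UNIV"
    by (rule sums_nonneg_imp_has_sum[OF summable_sums[OF sm] nn])
  then have "((h1 \<circ> e) has_sum (\<Sum>j. \<phi> (2 ^ j))) UNIV" by (simp add: h1_def o_def e_def)
  then have "(h1 has_sum (\<Sum>j. \<phi> (2 ^ j))) (range e)" by (subst has_sum_reindex[OF inj])
  then have 1: "(h1 has_sum (\<Sum>j. \<phi> (2 ^ j))) UNIV"
    by (subst (asm) has_sum_cong_neutral[of UNIV "range e" h1]) (auto simp: h1_def)
  have 2: "((\<lambda>k. h1 (- k)) has_sum (\<Sum>j. \<phi> (2 ^ j))) UNIV"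
    using 1 has_sum_reindex_bij_betw[OF bij_uminus, of h1] by simp
  have pos: "0 < k" if "k \<in> range e" for k using that by (auto simp: e_def)
  have "h k = h1 k + h1 (- k)" for k
  proof -
    have r: "range (\<lambda>j::nat. 2 ^ j) = range e" by (simp add: e_def[abs_def])
    show ?thesis
      unfolding h_def h1_def r using pos[of k] pos[of "- k"] by (cases "0 < k") auto
  qed
  then have "h = (\<lambda>k. h1 k + h1 (- k))" by (rule ext)
  then show ?thesis using has_sum_add[OF 1 2] by simp
qed

text \<open>Both signs of the frequency are present because forward solutions will be contradicted
  at the positive frequencies and backward solutions at the negative ones.\<close>

definition lac_coeff :: "real \<Rightarrow> real \<Rightarrow> int \<Rightarrow> complex" where
  "lac_coeff \<kappa> p k = (if k = 0 then 1 else
     of_real (if \<bar>k\<bar> \<in> range (\<lambda>j::nat. 2 ^ j) then \<kappa> * \<bar>of_int k\<bar> powr (- p) else 0))"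

lemma two_powr_summable:
  assumes "0 < q"
  shows "summable (\<lambda>j::nat. ((2::real) ^ j) powr (- q))" "(\<Sum>j. ((2::real) ^ j) powr (- q)) = 1 / (1 - 2 powr (- q))"
proof -
  have eq: "((2::real) ^ j) powr (- q) = (2 powr (- q)) ^ j" for j :: nat
    by (simp add: powr_powr mult.commute flip: powr_realpow)
  have "2 powr (- q) < (1::real)" using assms powr_less_mono[of "- q" 0 2] by simp
  then have "norm ((2::real) powr (- q)) < 1" by simp
  then show "summable (\<lambda>j::nat. ((2::real) ^ j) powr (- q))" "(\<Sum>j. ((2::real) ^ j) powr (- q)) = 1 / (1 - 2 powr (- q))"
    unfolding eq by (rule summable_geometric, rule suminf_geometric)
qed

lemma summable_delta: "(\<lambda>k::int. if k = 0 then 1 else 0 :: real) summable_on UNIV"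
  by (rule finite_nonzero_values_imp_summable_on) (rule finite_subset[of _ "{0}"], auto)

text \<open>Away from 0 the sum is 2 \<kappa> times a geometric series whose ratio is at most
  1/2.\<close>

lemma lac_coeff_l1:
  assumes \<kappa>: "0 \<le> \<kappa>" and p: "1 \<le> p"
  shows "(\<lambda>k. cmod (lac_coeff \<kappa> p k)) summable_on UNIV"
    and "finite F \<Longrightarrow> 0 \<notin> F \<Longrightarrow> (\<Sum>k\<in>F. cmod (lac_coeff \<kappa> p k)) \<le> 4 * \<kappa>"
proof -
  define h where "h k = (if \<bar>k\<bar> \<in> range (\<lambda>j::nat. 2 ^ j) then \<kappa> * \<bar>of_int k\<bar> powr (- p) else 0)" for k :: int
  note tp = two_powr_summable[of p]
  have h: "(h has_sum 2 * (\<kappa> * (1 / (1 - 2 powr (- p))))) UNIV"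
    using lacunary_sum[of "\<lambda>x. \<kappa> * x powr (- p)"] \<kappa> p tp
    unfolding h_def by (simp add: summable_mult suminf_mult)
  have "2 powr (- p) \<le> 2 powr (- 1 :: real)" using p by (intro powr_mono) auto
  then have r: "2 powr (- p) \<le> 1 / 2" by (simp add: powr_minus_divide)
  have "1 / (1 - 2 powr (- p)) \<le> 1 / (1 - 1 / 2)" using r by (intro divide_left_mono) auto
  then have "2 * (\<kappa> * (1 / (1 - 2 powr (- p)))) \<le> 2 * (\<kappa> * (1 / (1 - 1 / 2)))"
    using \<kappa> by (intro mult_left_mono) auto
  then have S: "2 * (\<kappa> * (1 / (1 - 2 powr (- p)))) \<le> 4 * \<kappa>" by simp
  have nn: "0 \<le> h k" for k using \<kappa> by (simp add: h_def)
  have eq: "cmod (lac_coeff \<kappa> p k) = h k + (if k = 0 then 1 else 0)" for k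
    using nn[of k] by (simp add: lac_coeff_def h_def[symmetric]) (simp add: h_def)
  show "(\<lambda>k. cmod (lac_coeff \<kappa> p k)) summable_on UNIV"
    unfolding eq by (intro summable_on_add has_sum_imp_summable[OF h] summable_delta)
  assume F: "finite F" "0 \<notin> F"
  have "(\<Sum>k\<in>F. cmod (lac_coeff \<kappa> p k)) = sum h F"
    unfolding eq using F by (intro sum.cong) auto
  also have "\<dots> \<le> infsum h UNIV"
    using F nn by (intro finite_sum_le_infsum has_sum_imp_summable[OF h]) auto
  also have "\<dots> \<le> 4 * \<kappa>" using S infsumI[OF h] by simp
  finally show "(\<Sum>k\<in>F. cmod (lac_coeff \<kappa> p k)) \<le> 4 * \<kappa>" .
qed

text \<open>Along powers of two the weighted squares form a geometric series of ratio
  \<open>2 powr (- (2 * (p - s)))\<close>, convergent as soon as s < p. The factor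
  \<open>2 powr s\<close> comes from \<open>jb k\<close> \<le> 2 |k| for nonzero k.\<close>

lemma lac_coeff_weighted_l2:
  assumes \<kappa>: "0 \<le> \<kappa>" and s: "0 \<le> s" "s < p"
  shows "weighted_l2 s (lac_coeff \<kappa> p)"
proof -
  define \<phi> where "\<phi> x = (2 powr s * \<kappa>)\<^sup>2 * x powr (- (2 * (p - s)))" for x :: real
  define h where "h k = (if \<bar>k\<bar> \<in> range (\<lambda>j::nat. 2 ^ j) then \<phi> \<bar>of_int k\<bar> else 0)" for k :: int
  have "(h has_sum 2 * (\<Sum>j. \<phi> (2 ^ j))) UNIV"
    unfolding h_def
  proof (rule lacunary_sum)
    show "summable (\<lambda>j::nat. \<phi> (2 ^ j))"
      unfolding \<phi>_def by (intro summable_mult two_powr_summable(1)) (use s in simp)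
  qed (simp add: \<phi>_def)
  then have h: "h summable_on UNIV" by (rule has_sum_imp_summable)
  have "(\<lambda>k. h k + (if k = 0 then 1 else 0)) summable_on UNIV" by (intro summable_on_add h summable_delta)
  then show ?thesis
    unfolding weighted_l2_def
  proof (rule summable_on_comparison_test)
    fix k :: int
    show "(jb k powr s * cmod (lac_coeff \<kappa> p k))\<^sup>2 \<le> h k + (if k = 0 then 1 else 0)"
    proof (cases "k = 0")
      case True
      then show ?thesis by (simp add: lac_coeff_def japanese_bracket_def h_def \<phi>_def)
    next
      case False
      define r where "r = \<bar>real_of_int k\<bar>"
      have "1 \<le> \<bar>k\<bar>" using False by simp
      then have r: "1 \<le> r" unfolding r_def by (metis of_int_1_le_iff of_int_abs)
      show ?thesis
      proof (cases "\<bar>k\<bar> \<in> range (\<lambda>j::nat. 2 ^ j)")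
        case True
        have "jb k powr s \<le> (2 * r) powr s"
          using r s by (intro powr_mono2) (auto simp: japanese_bracket_def r_def)
        then have "jb k powr s * (\<kappa> * r powr (- p)) \<le> (2 * r) powr s * (\<kappa> * r powr (- p))"
          using \<kappa> by (intro mult_right_mono) auto
        also have "\<dots> = 2 powr s * \<kappa> * (r powr s * r powr (- p))" using r by (simp add: powr_mult)
        also have "r powr s * r powr (- p) = r powr (- (p - s))" by (simp flip: powr_add)
        finally have "(jb k powr s * (\<kappa> * r powr (- p)))\<^sup>2 \<le> (2 powr s * \<kappa> * r powr (- (p - s)))\<^sup>2"
          using \<kappa> by (intro power_mono) auto
        also have "\<dots> = \<phi> r"
          using r by (simp add: \<phi>_def power_mult_distrib power2_eq_square[of "r powr _"] flip: powr_add)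
        finally have "(jb k powr s * (\<kappa> * r powr (- p)))\<^sup>2 \<le> \<phi> r" .
        moreover have "cmod (lac_coeff \<kappa> p k) = \<kappa> * r powr (- p)"
          using True False \<kappa> by (simp add: lac_coeff_def r_def norm_mult)
        ultimately show ?thesis using True False by (simp add: h_def r_def)
      qed (use False in \<open>simp add: lac_coeff_def h_def\<close>)
    qed
  qed simp
qed

lemma trig_series_in_Hs:
  fixes c :: "int \<Rightarrow> complex"
  assumes l1: "(\<lambda>k. cmod (c k)) summable_on UNIV" and wl: "weighted_l2 s c"
  defines "f \<equiv> \<lambda>x. \<Sum>\<^sub>\<infinity>k. (of_real (1 / sqrt (2 * pi)) * c k) * ek k x"
  shows "f \<in> Hs s" "fourier_coeff f = c"
proof -
  define b where "b k = of_real (1 / sqrt (2 * pi)) * c k" for k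
  have bs: "(\<lambda>k. cmod (b k)) summable_on UNIV"
    unfolding b_def norm_mult by (intro summable_on_cmult_right l1)
  have f: "f = (\<lambda>x. \<Sum>\<^sub>\<infinity>k. b k * ek k x)" by (simp add: f_def b_def)
  show fc: "fourier_coeff f = c"
  proof
    fix j
    have "fourier_coeff f j = of_real (sqrt (2 * pi)) * b j"
      unfolding f by (rule trig_series_integral(3)[OF bs])
    also have "\<dots> = c j" unfolding b_def mult.assoc[symmetric] sqrt_2pi by simp
    finally show "fourier_coeff f j = c j" .
  qed
  have bx: "(\<lambda>k. cmod (b k * ek k x)) summable_on UNIV" for x
    using bs by (simp only: norm_mult norm_ek mult_1_right)
  have hs: "((\<lambda>k. b k * ek k x) has_sum f x) UNIV" for x
    unfolding f by (rule has_sum_infsum[OF Infinite_Sum.abs_summable_summable[OF bx]])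
  have per: "periodic f"
    unfolding periodic_def
  proof
    fix x
    show "f (x + 2 * pi) = f x" by (simp only: f ek_periodic)
  qed
  have meas: "f \<in> borel_measurable lebesgue"
  proof (rule borel_measurable_LIMSEQ_metric)
    fix n :: nat
    have "continuous_on UNIV (\<lambda>x. \<Sum>i<n. b (int_decode i) * ek (int_decode i) x)"
      by (intro continuous_intros)
    then show "(\<lambda>x. \<Sum>i<n. b (int_decode i) * ek (int_decode i) x) \<in> borel_measurable lebesgue"
      using continuous_imp_measurable_on_sets_lebesgue[of UNIV] by (simp add: lebesgue_on_UNIV_eq)
  next
    fix x
    have "((\<lambda>i. b (int_decode i) * ek (int_decode i) x) has_sum f x) UNIV"
      using hs[of x] has_sum_reindex_bij_betw[OF bij_int_decode, of "\<lambda>k. b k * ek k x"] by simp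
    from has_sum_imp_sums[OF this] show "(\<lambda>n. \<Sum>i<n. b (int_decode i) * ek (int_decode i) x) \<longlonglongrightarrow> f x"
      by (simp add: sums_def)
  qed
  interpret finite_measure tor by (rule finite_measure_tor)
  have bound: "cmod (f x) \<le> (\<Sum>\<^sub>\<infinity>k. cmod (b k))" for x
    by (rule norm_infsum_le[OF hs has_sum_infsum[OF bs]]) (simp only: norm_mult norm_ek mult_1_right)
  have "integrable tor (\<lambda>x. (cmod (f x))\<^sup>2)"
  proof (rule integrable_const_bound)
    show "AE x in tor. norm ((cmod (f x))\<^sup>2) \<le> (\<Sum>\<^sub>\<infinity>k. cmod (b k))\<^sup>2"
      using bound by (auto intro!: power_mono)
    have "f \<in> borel_measurable tor" using meas by (rule measurable_restrict_space1)
    then show "(\<lambda>x. (cmod (f x))\<^sup>2) \<in> borel_measurable tor" by measurable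
  qed
  then show "f \<in> Hs s" using per meas wl by (simp add: Hs_def set_integrable_tor fc)
qed

text \<open>Continuity with values in the Sobolev space carries the smallness of the datum over to a
  short interval, on which \<open>positive_frequency_decay\<close> applies. Shortening the interval
  costs nothing, since the conclusion concerns time 0. For \<sigma> = -1 the reflected sequence
  \<open>a t (- k)\<close> is used.\<close>

lemma initial_coefficients_decay:
  fixes u :: "real \<Rightarrow> real \<Rightarrow> complex" and \<sigma> \<alpha> \<gamma> \<gamma>' \<Gamma> s T \<delta> :: real
  defines "a \<equiv> \<lambda>t. fourier_coeff (u (\<sigma> * t))"
  assumes J: "(\<sigma> = 1 \<and> J = {0..<T}) \<or> (\<sigma> = - 1 \<and> J = {- T<..0})" and T: "0 < T"
    and \<alpha>: "\<alpha> \<noteq> 0" and \<Gamma>: "0 < \<Gamma>" and s: "1 \<le> s"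
    and uH: "\<And>t. t \<in> {0..T} \<Longrightarrow> u (\<sigma> * t) \<in> Hs s"
    and lim: "\<And>t. t \<in> {0..T} \<Longrightarrow> ((\<lambda>r. weighted_l2_norm s (\<lambda>k. a r k - a t k)) \<longlongrightarrow> 0) (at t within {0..T})"
    and weak: "\<And>\<phi>. \<phi> \<in> test_functions J \<Longrightarrow> weak_identity \<alpha> \<gamma> \<gamma>' \<Gamma> J \<sigma> u0 u \<phi>"
    and c0: "fourier_coeff u0 0 = 1"
    and \<delta>: "0 < \<delta>" "\<delta> \<le> 1" "\<delta> * (640 * (\<bar>\<gamma>\<bar> + \<bar>\<gamma>'\<bar> + \<bar>\<Gamma>\<bar>) * 2 powr (s + 1)) \<le> \<Gamma>"
    and small: "\<And>F. finite F \<Longrightarrow> 0 \<notin> F \<Longrightarrow> (\<Sum>k\<in>F. cmod (fourier_coeff u0 k)) \<le> \<delta> / 2"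
  shows "\<exists>C. \<forall>k>0. cmod (fourier_coeff u0 (if \<sigma> = 1 then k else - k)) \<le> C * of_int k powr (- s - 1)"
proof -
  define N where "N = weighted_l2_norm s"
  \<comment> \<open>The bound 1/2 keeps the zero mode, initially 1, between 1/2 and 2; the other one
    lets the l1 norm move by at most \<delta> / 2. Adding 1 to \<open>jb_const\<close> makes the
    denominator evidently positive.\<close>
  define \<eta> where "\<eta> = min (1 / 2) (\<delta> / (2 * (jb_const + 1)))"
  have jc: "0 < jb_const + 1" using jb_const_nonneg by linarith
  have \<eta>: "0 < \<eta>" "\<eta> \<le> 1 / 2"
  proof -
    show "0 < \<eta>" using \<delta>(1) jc by (simp add: \<eta>_def)
    show "\<eta> \<le> 1 / 2" unfolding \<eta>_def by (rule min.cobounded1)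
  qed
  have \<eta>2: "jb_const * \<eta> \<le> \<delta> / 2"
  proof -
    have "jb_const * \<eta> \<le> (jb_const + 1) * (\<delta> / (2 * (jb_const + 1)))"
      using \<eta>(1) by (intro mult_mono) (auto simp: \<eta>_def)
    also have "\<dots> = \<delta> / 2"
    proof -
      have "e * (\<delta> / (2 * e)) = \<delta> / 2" if "0 < e" for e :: real using that by simp
      then show ?thesis using jc .
    qed
    finally show ?thesis .
  qed
  have wlT: "weighted_l2 s (a t)" if "t \<in> {0..T}" for t
    unfolding a_def by (rule HsD(3)[OF uH[OF that] s])
  have "\<forall>\<^sub>F r in at 0 within {0..T}. N (\<lambda>k. a r k - a 0 k) < \<eta>"
    unfolding N_def by (rule order_tendstoD(2)[OF lim]) (use T \<eta> in auto)
  then obtain d where d: "0 < d" "\<And>r. r \<in> {0..T} \<Longrightarrow> r \<noteq> 0 \<Longrightarrow> dist r 0 < d \<Longrightarrow> N (\<lambda>k. a r k - a 0 k) < \<eta>"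
    unfolding eventually_at by blast
  \<comment> \<open>The halves give strict inequalities: \<tau> < d for closeness to the datum and
    \<tau> < T for the support of the test functions.\<close>
  define \<tau> where "\<tau> = min (d / 2) (T / 2)"
  have \<tau>: "0 < \<tau>" "\<tau> < T" "\<tau> < d" using d(1) T by (auto simp: \<tau>_def)
  have sub: "t \<in> {0..T}" if "t \<in> {0..\<tau>}" for t using that \<tau> by auto
  have near: "N (\<lambda>k. a t k - a 0 k) \<le> \<eta>" if t: "t \<in> {0..\<tau>}" for t
  proof (cases "t = 0")
    case True
    then show ?thesis using \<eta>(1) by (simp add: N_def weighted_l2_norm_def)
  next
    case False
    then show ?thesis using d(2)[OF sub[OF t]] t \<tau> by (simp add: dist_norm less_imp_le)
  qed
  have wl: "weighted_l2 s (a t)" if "t \<in> {0..\<tau>}" for t by (rule wlT[OF sub[OF that]])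
  have lim': "((\<lambda>r. weighted_l2_norm s (\<lambda>k. a r k - a t k)) \<longlongrightarrow> 0) (at t within {0..\<tau>})" if "t \<in> {0..\<tau>}" for t
    by (rule tendsto_within_subset[OF lim[OF sub[OF that]]]) (use \<tau> in auto)
  define F where "F k t = of_real \<sigma> * (- \<i> * of_real \<alpha> * (of_int k)\<^sup>2 * a t k + nonlin \<gamma> \<gamma>' \<Gamma> (a t) k)" for k t
  have a_app: "fourier_coeff (u (\<sigma> * t)) = a t" for t by (simp add: a_def)
  note mie = mode_integral_equation[OF J \<tau>(2) s uH[OF sub] lim'[unfolded a_def] weak, unfolded a_app]
  have ca: "continuous_on {0..\<tau>} (\<lambda>t. a t k)" for k by (rule mie(1))
  have cF: "continuous_on {0..\<tau>} (F k)" for k unfolding F_def by (rule mie(2))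
  have eq: "a q k = fourier_coeff u0 k + integral {0..q} (F k)" if "0 < q" "q \<le> \<tau>" for q k
    unfolding F_def by (rule mie(3)) (use that in auto)
  have dI: "((\<lambda>t. fourier_coeff u0 k + integral {0..t} (F k)) has_vector_derivative F k t) (at t within {0..\<tau>})"
    if "t \<in> {0..\<tau>}" for t k
    using has_vector_derivative_add[OF has_vector_derivative_const integral_has_vector_derivative[OF cF that]] by simp
  \<comment> \<open>The initial value is encoded in the weak identity; letting q tend to 0 in the
    integral equation and using continuity identifies it with the trace at time 0.\<close>
  have a0: "a 0 k = fourier_coeff u0 k" for k
  proof -
    have z: "0 \<in> {0..\<tau>}" using \<tau> by simp
    have "((\<lambda>t. fourier_coeff u0 k + integral {0..t} (F k)) \<longlongrightarrow> fourier_coeff u0 k + integral {0..0} (F k)) (at 0 within {0..\<tau>})"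
      using has_vector_derivative_continuous[OF dI[OF z]] by (simp add: continuous_within)
    moreover have "\<forall>\<^sub>F t in at 0 within {0..\<tau>}. fourier_coeff u0 k + integral {0..t} (F k) = a t k"
      unfolding eventually_at_filter using eq by (auto intro!: always_eventually)
    ultimately have "((\<lambda>t. a t k) \<longlongrightarrow> fourier_coeff u0 k) (at 0 within {0..\<tau>})"
      by (simp add: Lim_transform_eventually)
    moreover have "((\<lambda>t. a t k) \<longlongrightarrow> a 0 k) (at 0 within {0..\<tau>})"
      using ca z by (simp add: continuous_on_def)
    moreover have "at 0 within {0..\<tau>} \<noteq> bot"
      using \<tau> by (simp add: trivial_limit_within islimpt_Icc)
    ultimately show ?thesis using tendsto_unique by blast
  qed
  have der: "((\<lambda>t. a t k) has_vector_derivative F k t) (at t within {0..\<tau>})" if t: "t \<in> {0..\<tau>}" for t k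
  proof (rule has_vector_derivative_transform[OF t _ dI[OF t]])
    fix r assume "r \<in> {0..\<tau>}"
    then show "a r k = fourier_coeff u0 k + integral {0..r} (F k)"
      using eq[of r k] a0[of k] by (cases "r = 0") auto
  qed
  define M where "M = N (a 0) + 1"
  have z: "0 \<in> {0..\<tau>}" using \<tau> by simp
  have diff: "weighted_l2 s (\<lambda>k. a t k - a 0 k)" if "t \<in> {0..\<tau>}" for t by (rule weighted_l2_diff[OF wl[OF that] wl[OF z]])
  have NM: "weighted_l2_norm s (a t) \<le> M" if t: "t \<in> {0..\<tau>}" for t
    using weighted_l2_triangle(2)[OF wl[OF z] diff[OF t]] near[OF t] \<eta> by (simp add: M_def N_def)
  have a00: "cmod (a t 0 - 1) \<le> 1 / 2" if t: "t \<in> {0..\<tau>}" for t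
    using weighted_l2_pointwise[OF diff[OF t], of 0] near[OF t] \<eta>(2)
    by (simp add: a0 c0 N_def japanese_bracket_def)
  have A0: "1 / 2 \<le> cmod (a t 0)" "cmod (a t 0) \<le> 2" if t: "t \<in> {0..\<tau>}" for t
    using a00[OF t] norm_triangle_ineq2[of 1 "a t 0"] norm_triangle_ineq[of "a t 0 - 1" 1]
    by (simp_all add: norm_minus_commute)
  have sm: "(\<Sum>j\<in>F. cmod (a t j)) \<le> \<delta>" if t: "t \<in> {0..\<tau>}" and F: "finite F" "0 \<notin> F" for t F
  proof -
    have "(\<Sum>j\<in>F. cmod (a t j)) \<le> (\<Sum>j\<in>F. cmod (a 0 j) + cmod (a t j - a 0 j))"
    proof (rule sum_mono)
      fix j show "cmod (a t j) \<le> cmod (a 0 j) + cmod (a t j - a 0 j)"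
        using norm_triangle_ineq[of "a 0 j" "a t j - a 0 j"] by simp
    qed
    also have "\<dots> = (\<Sum>j\<in>F. cmod (a 0 j)) + (\<Sum>j\<in>F. cmod (a t j - a 0 j))" by (rule sum.distrib)
    also have "(\<Sum>j\<in>F. cmod (a t j - a 0 j)) \<le> (\<Sum>\<^sub>\<infinity>j. cmod (a t j - a 0 j))"
      using F by (intro finite_sum_le_infsum weighted_l2_imp_l1(1)[OF s diff[OF t]]) auto
    also have "\<dots> \<le> jb_const * N (\<lambda>k. a t k - a 0 k)"
      unfolding N_def by (rule weighted_l2_imp_l1(2)[OF s diff[OF t]])
    also have "\<dots> \<le> jb_const * \<eta>" by (intro mult_left_mono near[OF t]) simp
    also have "\<dots> \<le> \<delta> / 2" by (rule \<eta>2)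
    also have "(\<Sum>j\<in>F. cmod (a 0 j)) \<le> \<delta> / 2" unfolding a0 by (rule small[OF F])
    finally show ?thesis by simp
  qed
  from J show ?thesis
  proof
    assume *: "\<sigma> = 1 \<and> J = {0..<T}"
    have "\<exists>C. \<forall>k>0. cmod (a 0 k) \<le> C * of_int k powr (- s - 1)"
    proof (rule positive_frequency_decay[OF \<alpha> \<Gamma> s \<tau>(1) wl NM _ A0 _ \<delta>(2,3) sm])
      show "((\<lambda>t. a t k) has_vector_derivative - \<i> * of_real \<alpha> * (of_int k)\<^sup>2 * a t k + nonlin \<gamma> \<gamma>' \<Gamma> (a t) k) (at t within {0..\<tau>})"
        if "t \<in> {0..\<tau>}" for t k
        using der[OF that, of k] * by (simp add: F_def)
    qed (use \<delta> in auto)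
    then show ?thesis using * by (simp add: a0)
  next
    assume *: "\<sigma> = - 1 \<and> J = {- T<..0}"
    have "\<exists>C. \<forall>k>0. cmod (a 0 (- k)) \<le> C * of_int k powr (- s - 1)"
    proof (rule positive_frequency_decay[where a = "\<lambda>t k. a t (- k)" and \<alpha> = "- \<alpha>" and \<gamma> = "- \<gamma>" and \<gamma>' = \<gamma>'
          and M = M and \<delta> = \<delta>, OF _ \<Gamma> s \<tau>(1)])
      fix t k assume t: "t \<in> {0..\<tau>}"
      show "((\<lambda>t. a t (- k)) has_vector_derivative - \<i> * of_real (- \<alpha>) * (of_int k)\<^sup>2 * a t (- k)
          + nonlin (- \<gamma>) \<gamma>' \<Gamma> (\<lambda>k. a t (- k)) k) (at t within {0..\<tau>})"
        using der[OF t, of "- k"] * by (simp add: F_def nonlin_reflect)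
      show "weighted_l2 s (\<lambda>k. a t (- k))" using wl[OF t] by (simp only: weighted_l2_reflect)
      show "weighted_l2_norm s (\<lambda>k. a t (- k)) \<le> M" using NM[OF t] by (simp only: weighted_l2_reflect)
      show "1 / 2 \<le> cmod (a t (- 0))" "cmod (a t (- 0)) \<le> 2" using A0[OF t] by simp_all
    next
      fix t and F :: "int set" assume t: "t \<in> {0..\<tau>}" and F: "finite F" "0 \<notin> F"
      have "(\<Sum>j\<in>F. cmod (a t (- j))) = (\<Sum>j\<in>uminus ` F. cmod (a t j))"
        by (simp add: sum.reindex)
      also have "\<dots> \<le> \<delta>" using F by (intro sm[OF t]) auto
      finally show "(\<Sum>j\<in>F. cmod (a t (- j))) \<le> \<delta>" .
    qed (use \<alpha> \<delta> in auto)
    then show ?thesis using * by (simp add: a0)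
  qed
qed

lemma continuous_Hs_coeff_tendsto:
  assumes u: "u \<in> continuous_Hs I s" and s: "1 \<le> s" and I: "I = (\<lambda>t. \<sigma> * t) ` {0..T}" and \<sigma>: "\<sigma> \<noteq> 0"
    and t: "t \<in> {0..T}"
  shows "((\<lambda>r. weighted_l2_norm s (\<lambda>k. fourier_coeff (u (\<sigma> * r)) k - fourier_coeff (u (\<sigma> * t)) k)) \<longlongrightarrow> 0) (at t within {0..T})"
proof -
  have H: "u (\<sigma> * r) \<in> Hs s" if "r \<in> {0..T}" for r
    using u that unfolding I continuous_Hs_def by blast
  have "((\<lambda>\<tau>. Hs_norm s (\<lambda>x. u \<tau> x - u (\<sigma> * t) x)) \<longlongrightarrow> 0) (at (\<sigma> * t) within I)"
    using u t unfolding I continuous_Hs_def by blast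
  moreover have "filterlim (\<lambda>r. \<sigma> * r) (at (\<sigma> * t) within I) (at t within {0..T})"
    unfolding filterlim_at
  proof
    show "\<forall>\<^sub>F r in at t within {0..T}. \<sigma> * r \<in> I \<and> \<sigma> * r \<noteq> \<sigma> * t"
      unfolding eventually_at_filter I using \<sigma> by (auto intro!: always_eventually)
    show "((\<lambda>r. \<sigma> * r) \<longlongrightarrow> \<sigma> * t) (at t within {0..T})" by (intro tendsto_intros)
  qed
  ultimately have "((\<lambda>r. Hs_norm s (\<lambda>x. u (\<sigma> * r) x - u (\<sigma> * t) x)) \<longlongrightarrow> 0) (at t within {0..T})"
    by (rule filterlim_compose)
  moreover have "\<forall>\<^sub>F r in at t within {0..T}. Hs_norm s (\<lambda>x. u (\<sigma> * r) x - u (\<sigma> * t) x)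
      = weighted_l2_norm s (\<lambda>k. fourier_coeff (u (\<sigma> * r)) k - fourier_coeff (u (\<sigma> * t)) k)"
  proof -
    have "fourier_coeff (\<lambda>x. u (\<sigma> * r) x - u (\<sigma> * t) x) = (\<lambda>k. fourier_coeff (u (\<sigma> * r)) k - fourier_coeff (u (\<sigma> * t)) k)"
      if r: "r \<in> {0..T}" for r
    proof
      fix k
      have "integral\<^sup>L tor (\<lambda>x. ek (- k) x * (u (\<sigma> * r) x - u (\<sigma> * t) x))
        = integral\<^sup>L tor (\<lambda>x. ek (- k) x * u (\<sigma> * r) x) - integral\<^sup>L tor (\<lambda>x. ek (- k) x * u (\<sigma> * t) x)"
        unfolding right_diff_distrib
        by (intro Bochner_Integration.integral_diff integrable_ek_mult HsD(1)[OF H s] r t)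
      then show "fourier_coeff (\<lambda>x. u (\<sigma> * r) x - u (\<sigma> * t) x) k = fourier_coeff (u (\<sigma> * r)) k - fourier_coeff (u (\<sigma> * t)) k"
        by (simp only: fourier_coeff_eq right_diff_distrib)
    qed
    then show ?thesis
      unfolding eventually_at_filter Hs_norm_def by (auto intro!: always_eventually)
  qed
  ultimately show ?thesis by (rule Lim_transform_eventually)
qed

text \<open>At the frequency 2^j such a bound would give \<kappa> \<le> C 2^(-(r - p) j), and the
  right-hand side tends to 0. The flag \<open>b\<close> selects the positive or the negative
  frequencies.\<close>

lemma lac_coeff_not_decaying:
  assumes \<kappa>: "0 < \<kappa>" and p: "p < r"
  shows "\<not> (\<forall>k>0. cmod (lac_coeff \<kappa> p (if b then k else - k)) \<le> C * of_int k powr (- r))"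
proof
  assume le: "\<forall>k>0. cmod (lac_coeff \<kappa> p (if b then k else - k)) \<le> C * of_int k powr (- r)"
  have "\<kappa> \<le> C * (2 powr (- (r - p))) ^ j" for j :: nat
  proof -
    have "(0::int) < 2 ^ j" by simp
    then have "cmod (lac_coeff \<kappa> p (if b then 2 ^ j else - (2 ^ j))) \<le> C * of_int (2 ^ j) powr (- r)"
      using le by blast
    moreover have "cmod (lac_coeff \<kappa> p (if b then 2 ^ j else - (2 ^ j))) = \<kappa> * (2 ^ j) powr (- p)"
      using \<kappa> by (simp add: lac_coeff_def norm_mult)
    ultimately have "\<kappa> * (2 ^ j) powr (- p) \<le> C * (2 ^ j) powr (- r)" by simp
    then have "\<kappa> * (2 ^ j) powr (- p) * (2 ^ j) powr p \<le> C * (2 ^ j) powr (- r) * (2 ^ j) powr p"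
      by (intro mult_right_mono) auto
    then have "\<kappa> \<le> C * (2 ^ j) powr (- (r - p))"
      by (simp add: mult.assoc flip: powr_add)
    also have "((2::real) ^ j) powr (- (r - p)) = (2 powr (- (r - p))) ^ j"
      by (simp add: powr_powr mult.commute flip: powr_realpow)
    finally show ?thesis .
  qed
  moreover have "(\<lambda>j. C * (2 powr (- (r - p))) ^ j) \<longlonglongrightarrow> C * 0"
  proof (intro tendsto_intros LIMSEQ_power_zero)
    show "norm ((2::real) powr (- (r - p))) < 1"
      using p powr_less_mono[of "- (r - p)" 0 2] by simp
  qed
  ultimately have "\<kappa> \<le> C * 0" by (intro LIMSEQ_le_const) auto
  then show False using \<kappa> by simp
qed

theorem proposition2p9:
  fixes \<alpha>\<^sub>2 \<gamma>\<^sub>1 \<gamma>\<^sub>2 \<Gamma> s s\<^sub>1 :: real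
  assumes "\<Gamma> > 0" and "\<alpha>\<^sub>2 \<noteq> 0"
    and "1 \<le> s\<^sub>1" and "s\<^sub>1 \<le> s" and "s < s\<^sub>1 + 1"
  shows "\<exists>u0\<in>Hs s.
    (\<forall>T>0. \<not> (\<exists>u. u \<in> continuous_Hs {0..T} s\<^sub>1 \<and>
                  closed_forward_solution \<alpha>\<^sub>2 \<gamma>\<^sub>1 \<gamma>\<^sub>2 \<Gamma> T u0 u)) \<and>
    (\<forall>T>0. \<not> (\<exists>u. u \<in> continuous_Hs {-T..0} s\<^sub>1 \<and>
                  closed_backward_solution \<alpha>\<^sub>2 \<gamma>\<^sub>1 \<gamma>\<^sub>2 \<Gamma> T u0 u))"
proof -
  define D where "D = 640 * (\<bar>\<gamma>\<^sub>1\<bar> + \<bar>\<gamma>\<^sub>2\<bar> + \<bar>\<Gamma>\<bar>) * 2 powr (s\<^sub>1 + 1)"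
  define \<delta> where "\<delta> = min 1 (\<Gamma> / D)"
  \<comment> \<open>The midpoint of s and \<open>s\<^sub>1 + 1\<close>: above s for membership in
    the Sobolev space, below \<open>s\<^sub>1 + 1\<close> to violate the decay of the initial
    coefficients.\<close>
  define p where "p = (s + s\<^sub>1 + 1) / 2"
  have D: "0 < D" using assms(1) by (auto simp: D_def intro!: mult_pos_pos add_nonneg_pos)
  have \<delta>: "0 < \<delta>" "\<delta> \<le> 1" "\<delta> * D \<le> \<Gamma>"
  proof -
    show "0 < \<delta>" "\<delta> \<le> 1" using D assms(1) by (auto simp: \<delta>_def)
    have "\<delta> * D \<le> \<Gamma> / D * D" using D by (intro mult_right_mono) (auto simp: \<delta>_def)
    then show "\<delta> * D \<le> \<Gamma>" using D by simp
  qed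
  have p: "1 \<le> p" "s < p" "p < s\<^sub>1 + 1" using assms by (auto simp: p_def)
  \<comment> \<open>The amplitude \<delta> / 8 makes the l1 bound of \<open>lac_coeff_l1\<close>,
    four times the amplitude, equal to the admissible \<delta> / 2.\<close>
  define c where "c = lac_coeff (\<delta> / 8) p"
  define u0 where "u0 = (\<lambda>x. \<Sum>\<^sub>\<infinity>k. (of_real (1 / sqrt (2 * pi)) * c k) * ek k x)"
  have l1: "(\<lambda>k. cmod (c k)) summable_on UNIV"
    unfolding c_def by (rule lac_coeff_l1(1)) (use \<delta> p in auto)
  have wl: "weighted_l2 s c"
    unfolding c_def by (rule lac_coeff_weighted_l2) (use \<delta> p assms in auto)
  have u0: "u0 \<in> Hs s" "fourier_coeff u0 = c"
    unfolding u0_def by (rule trig_series_in_Hs[OF l1 wl])+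
  have c0: "fourier_coeff u0 0 = 1" by (simp add: u0 c_def lac_coeff_def)
  have small: "(\<Sum>k\<in>F. cmod (fourier_coeff u0 k)) \<le> \<delta> / 2" if "finite F" "0 \<notin> F" for F
    using lac_coeff_l1(2)[OF _ p(1) that, of "\<delta> / 8"] \<delta> by (simp add: u0 c_def)
  have contra: False
    if J: "(\<sigma> = 1 \<and> J = {0..<T}) \<or> (\<sigma> = - 1 \<and> J = {- T<..0})" and T: "0 < T"
      and u: "u \<in> continuous_Hs ((\<lambda>t. \<sigma> * t) ` {0..T}) s\<^sub>1"
      and weak: "\<And>\<phi>. \<phi> \<in> test_functions J \<Longrightarrow> weak_identity \<alpha>\<^sub>2 \<gamma>\<^sub>1 \<gamma>\<^sub>2 \<Gamma> J \<sigma> u0 u \<phi>"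
    for \<sigma> T J u
  proof -
    have \<sigma>: "\<sigma> \<noteq> 0" using J by auto
    have H: "u (\<sigma> * t) \<in> Hs s\<^sub>1" if "t \<in> {0..T}" for t
      using u that unfolding continuous_Hs_def by blast
    have "\<exists>C. \<forall>k>0. cmod (fourier_coeff u0 (if \<sigma> = 1 then k else - k)) \<le> C * of_int k powr (- s\<^sub>1 - 1)"
      by (rule initial_coefficients_decay[OF J T assms(2,1,3) H continuous_Hs_coeff_tendsto[OF u assms(3) refl \<sigma>]
            weak c0 \<delta>(1,2) \<delta>(3)[unfolded D_def] small])
    then obtain C where "\<forall>k>0. cmod (lac_coeff (\<delta> / 8) p (if \<sigma> = 1 then k else - k)) \<le> C * of_int k powr (- (s\<^sub>1 + 1))"
      by (auto simp: u0 c_def)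
    then show False using lac_coeff_not_decaying[of "\<delta> / 8" p "s\<^sub>1 + 1" "\<sigma> = 1" C] \<delta> p by simp
  qed
  have "\<not> (\<exists>u. u \<in> continuous_Hs {0..T} s\<^sub>1 \<and> closed_forward_solution \<alpha>\<^sub>2 \<gamma>\<^sub>1 \<gamma>\<^sub>2 \<Gamma> T u0 u)" if T: "0 < T" for T
  proof
    assume "\<exists>u. u \<in> continuous_Hs {0..T} s\<^sub>1 \<and> closed_forward_solution \<alpha>\<^sub>2 \<gamma>\<^sub>1 \<gamma>\<^sub>2 \<Gamma> T u0 u"
    then obtain u where u: "u \<in> continuous_Hs {0..T} s\<^sub>1"
      and w: "\<And>\<phi>. \<phi> \<in> test_functions {0..<T} \<Longrightarrow> weak_identity \<alpha>\<^sub>2 \<gamma>\<^sub>1 \<gamma>\<^sub>2 \<Gamma> {0..<T} 1 u0 u \<phi>"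
      unfolding closed_forward_solution_def forward_solution_def solution_on_def by blast
    show False by (rule contra[of 1 "{0..<T}" T u]) (use T u w in simp_all)
  qed
  moreover have "\<not> (\<exists>u. u \<in> continuous_Hs {- T..0} s\<^sub>1 \<and> closed_backward_solution \<alpha>\<^sub>2 \<gamma>\<^sub>1 \<gamma>\<^sub>2 \<Gamma> T u0 u)" if T: "0 < T" for T
  proof
    assume "\<exists>u. u \<in> continuous_Hs {- T..0} s\<^sub>1 \<and> closed_backward_solution \<alpha>\<^sub>2 \<gamma>\<^sub>1 \<gamma>\<^sub>2 \<Gamma> T u0 u"
    then obtain u where u: "u \<in> continuous_Hs {- T..0} s\<^sub>1"
      and w: "\<And>\<phi>. \<phi> \<in> test_functions {- T<..0} \<Longrightarrow> weak_identity \<alpha>\<^sub>2 \<gamma>\<^sub>1 \<gamma>\<^sub>2 \<Gamma> {- T<..0} (- 1) u0 u \<phi>"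
      unfolding closed_backward_solution_def backward_solution_def solution_on_def by blast
    have im: "(\<lambda>t. - 1 * t) ` {0..T} = {- T..0}" using image_uminus_atLeastAtMost[of 0 T] by simp
    show False by (rule contra[of "- 1" "{- T<..0}" T u]) (use T u w im in simp_all)
  qed
  ultimately show ?thesis using u0(1) by blast
qed

end
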